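(* For all integers $0\leq r\leq k$, we have $$E_{2k-r,k} = \sum_{p=1}^r \left[\!\left[ \begin{matrix} 2k-p-1\\ k-p \end{matrix} \right]\!\right] \sum_{i=0}^{r-p} \frac{(-1)^{i+p+1}(2k-p-i)^{k-p-1}}{i!\, (r-p-i)!}.$$
   Context: A series extension of a graph is a graph obtained by subdividing an edge; a parallel extension is a graph obtained by adding a new edge parallel to an existing one. A graph (loops and multiple edges allowed) is series-parallel if it can be constructed from a 2-cycle (two vertices joined by two parallel edges) by a (possibly empty) sequence of series and parallel extensions; by convention, a single edge (non-loop) and a single loop are also series-parallel graphs. A series-parallel matroid is the (cycle/graphic) matroid associated with a series-parallel graph. The empty matroid is not a series-parallel matroid. A matroid is simple if it has no loops and no pairs of parallel elements. $[n]=\{1,\ldots,n\}$. $E_{n,k}$ denotes the number of simple series-parallel matroids with ground set $[n]$ and rank $k$ (counted as matroids on the labelled set $[n]$, not up to isomorphism and not as graphs); in particular $E_{0,0}=0$. $\left[\!\left[ \begin{matrix} n\\ k \end{matrix} \right]\!\right]$ is the unsigned associated Stirling number of the first kind: the number of derangements (fixed-point-free permutations) of $[n]$ with exactly $k$ cycles; it equals $1$ for $n=k=0$. Empty sums are $0$, and negative exponents denote reciprocals (the identity is in $\mathbb{Q}$). *)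

theory Defs
  imports Complex_Main "HOL-Combinatorics.Orbits"
begin

section \<open>Matroids\<close>

record 'a set_system =
  ground :: "'a set"
  indep :: "'a set set"

locale matroid =
  fixes M :: "'a set_system"
  assumes finite_ground: "finite (ground M)"
    and indep_ground: "I \<in> indep M \<Longrightarrow> I \<subseteq> ground M"
    and indep_empty: "{} \<in> indep M"
    and indep_subset: "I \<in> indep M \<Longrightarrow> J \<subseteq> I \<Longrightarrow> J \<in> indep M"
    and indep_augment: "I \<in> indep M \<Longrightarrow> J \<in> indep M \<Longrightarrow> card I < card J \<Longrightarrow>
      \<exists>x \<in> J - I. insert x I \<in> indep M"

definition matroid_rank :: "'a set_system \<Rightarrow> nat" where
  "matroid_rank M = Max (card ` indep M)"

definition circuit :: "'a set_system \<Rightarrow> 'a set \<Rightarrow> bool" where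
  "circuit M C \<longleftrightarrow> C \<subseteq> ground M \<and> C \<notin> indep M \<and> (\<forall>D. D \<subset> C \<longrightarrow> D \<in> indep M)"

definition matroid_loop :: "'a set_system \<Rightarrow> 'a \<Rightarrow> bool" where
  "matroid_loop M e \<longleftrightarrow> circuit M {e}"

definition parallel_elements :: "'a set_system \<Rightarrow> 'a \<Rightarrow> 'a \<Rightarrow> bool" where
  "parallel_elements M e f \<longleftrightarrow> e \<noteq> f \<and> circuit M {e, f}"

definition simple_matroid :: "'a set_system \<Rightarrow> bool" where
  "simple_matroid M \<longleftrightarrow> (\<nexists>e. matroid_loop M e) \<and> (\<nexists>e f. parallel_elements M e f)"


section \<open>Multigraphs\<close>

text \<open>
  Edges are labels: \<open>ends G e\<close> is the set of end vertices of the edge \<open>e\<close>, a singleton if \<open>e\<close> is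
  a loop. Values of \<open>ends G\<close> outside \<open>edges G\<close> carry no meaning.
\<close>

record ('v, 'e) multigraph =
  verts :: "'v set"
  edges :: "'e set"
  ends :: "'e \<Rightarrow> 'v set"

text \<open>
  A cycle, given by its edge set: a loop is a cycle of length 1, two distinct parallel edges form
  a cycle of length 2.
\<close>

definition cycle_edges :: "('v, 'e) multigraph \<Rightarrow> 'e set \<Rightarrow> bool" where
  "cycle_edges G C \<longleftrightarrow> (\<exists>vs es. es \<noteq> [] \<and> length vs = length es \<and> distinct vs \<and> distinct es \<and>
     set vs \<subseteq> verts G \<and> set es \<subseteq> edges G \<and> C = set es \<and>
     (\<forall>i < length es. ends G (es ! i) = {vs ! i, vs ! (Suc i mod length es)}))"

definition cycle_matroid :: "('v, 'e) multigraph \<Rightarrow> 'e set_system" where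
  "cycle_matroid G = \<lparr> ground = edges G,
     indep = {I. I \<subseteq> edges G \<and> (\<nexists>C. C \<subseteq> I \<and> cycle_edges G C)} \<rparr>"


section \<open>Series-parallel graphs and matroids\<close>

definition two_cycle :: "('v, 'e) multigraph \<Rightarrow> bool" where
  "two_cycle G \<longleftrightarrow> (\<exists>u v e f. u \<noteq> v \<and> e \<noteq> f \<and> verts G = {u, v} \<and> edges G = {e, f} \<and>
     ends G e = {u, v} \<and> ends G f = {u, v})"

definition single_edge :: "('v, 'e) multigraph \<Rightarrow> bool" where
  "single_edge G \<longleftrightarrow> (\<exists>u v e. u \<noteq> v \<and> verts G = {u, v} \<and> edges G = {e} \<and> ends G e = {u, v})"

definition single_loop :: "('v, 'e) multigraph \<Rightarrow> bool" where
  "single_loop G \<longleftrightarrow> (\<exists>v e. verts G = {v} \<and> edges G = {e} \<and> ends G e = {v})"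

text \<open>
  Subdividing \<open>e\<close> by a new vertex \<open>w\<close>: one half keeps the label \<open>e\<close>, the other gets a new label
  \<open>f\<close>. Either half may keep the label, since \<open>u\<close> and \<open>v\<close> can be exchanged.
\<close>

definition series_extension :: "('v, 'e) multigraph \<Rightarrow> ('v, 'e) multigraph \<Rightarrow> bool" where
  "series_extension G H \<longleftrightarrow> (\<exists>e u v w f. e \<in> edges G \<and> ends G e = {u, v} \<and>
     w \<notin> verts G \<and> f \<notin> edges G \<and>
     H = \<lparr> verts = insert w (verts G), edges = insert f (edges G),
           ends = (ends G)(e := {u, w}, f := {w, v}) \<rparr>)"

definition parallel_extension :: "('v, 'e) multigraph \<Rightarrow> ('v, 'e) multigraph \<Rightarrow> bool" where
  "parallel_extension G H \<longleftrightarrow> (\<exists>e f. e \<in> edges G \<and> f \<notin> edges G \<and>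
     H = \<lparr> verts = verts G, edges = insert f (edges G), ends = (ends G)(f := ends G e) \<rparr>)"

text \<open>
  The single edge and the single loop are series-parallel by convention only; they are not
  extended further (subdividing a single edge would give a path).
\<close>

definition series_parallel_graph :: "('v, 'e) multigraph \<Rightarrow> bool" where
  "series_parallel_graph G \<longleftrightarrow>
     (\<exists>C. two_cycle C \<and> (\<lambda>A B. series_extension A B \<or> parallel_extension A B)\<^sup>*\<^sup>* C G) \<or>
     single_edge G \<or> single_loop G"

text \<open>
  Vertices are natural numbers without loss of generality: the graphs are finite and the cycle
  matroid does not depend on the names of the vertices.
\<close>

definition series_parallel_matroid :: "'e set_system \<Rightarrow> bool" where
  "series_parallel_matroid M \<longleftrightarrow>
     matroid M \<and> (\<exists>G :: (nat, 'e) multigraph. series_parallel_graph G \<and> M = cycle_matroid G)"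

definition num_simple_sp_matroids :: "nat \<Rightarrow> nat \<Rightarrow> nat" where
  "num_simple_sp_matroids n k =
     card {M :: nat set_system. series_parallel_matroid M \<and> simple_matroid M \<and>
            ground M = {1..n} \<and> matroid_rank M = k}"


section \<open>Associated Stirling numbers of the first kind\<close>

text \<open>The cycles of a permutation \<open>p\<close> of \<open>{1..n}\<close> are counted as its orbits on \<open>{1..n}\<close>.\<close>

definition assoc_stirling1 :: "nat \<Rightarrow> nat \<Rightarrow> nat" where
  "assoc_stirling1 n k =
     card {p. p permutes {1..n} \<and> (\<forall>i \<in> {1..n}. p i \<noteq> i) \<and> card (orbit p ` {1..n}) = k}"

end

theory Submission
  imports Defs "HOL-Computational_Algebra.Formal_Power_Series" "HOL-Computational_Algebra.Polynomial"
begin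

text \<open>
  The matroid of a series-parallel graph is determined by its cycle space \<open>Z\<close>, and \<open>Z\<close> is determined
  by the sets \<open>D - {n}\<close> with \<open>n \<in> D \<in> Z\<close> for a fixed element \<open>n\<close>. The families arising in this way are
  exactly the two-terminal series-parallel networks on the remaining elements, built from single
  elements by series and parallel composition, and the decomposition into non-series (non-parallel)
  parts is unique because the relation ``lie on a common minimal path'' is a cograph. Let \<open>N\<close>, \<open>S\<close>
  and \<open>Q\<close> be the exponential generating functions of the simple networks, of those that are series
  compositions, and of those without a path of length 1, a network of nullity \<open>d\<close> having weight
  \<open>z\<^sup>d\<close>. Splitting off the part containing a fixed element gives
  \<open>S' = (N' - S') N\<close>, \<open>Q' = S' + z S' Q\<close> and \<open>N = x + Q + z x Q\<close>,
  whence \<open>1 + z Q = \<theta> (N)\<close> and \<open>1 + z N = (1 + z x) \<theta> (N)\<close> for \<open>\<theta> (t) = exp (z (t - ln (1 + t)))\<close>.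
  The powers of \<open>\<theta>\<close> are generating functions of derangements by number of cycles, and Lagrange
  inversion gives the formula.
\<close>

section \<open>Binary matroids\<close>

text \<open>What is counted are matroids, and different graphs may share a cycle matroid, for
  instance after the parts of a series composition are reordered. Cycle spaces remove this
  ambiguity: \<open>binary_matroid\<close> is injective on them, and series composition of set
  families is commutative by its form. Dimensions over the two-element field are handled by
  counting, a family of dimension \<open>d\<close> having \<open>2 ^ d\<close> members. A network
  with \<open>m\<close> elements and nullity \<open>d\<close> becomes, together with its root, a
  matroid of rank \<open>m - d\<close>, so the weight records the rank. The rooted matroid is simple
  iff the network is simple and has no one-element path; hence the answer is a coefficient of
  \<open>Q\<close>, not of \<open>N\<close>. The inverse function of \<open>N\<close> is
  \<open>((1 + z * x) / \<theta> - 1) / z\<close>. Its Lagrange power is expanded by a negative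
  binomial series whose index is \<open>r - p\<close> in the final sum; the terms beyond
  \<open>r\<close> vanish because a derangement of \<open>n\<close> points has at most
  \<open>n div 2\<close> cycles. The expansion has negative powers of the number \<open>z\<close>;
  they are cleared before coefficients of polynomials are compared.\<close>

definition symdiff :: "'a set \<Rightarrow> 'a set \<Rightarrow> 'a set" (infixl "\<triangle>" 65) where
  "A \<triangle> B = (A - B) \<union> (B - A)"

lemma in_symdiff [simp]: "x \<in> A \<triangle> B \<longleftrightarrow> (x \<in> A) \<noteq> (x \<in> B)"
  by (auto simp: symdiff_def)

lemma symdiff_self [simp]: "A \<triangle> A = {}"
  by auto

lemma symdiff_empty [simp]: "A \<triangle> {} = A" "{} \<triangle> A = A"
  by auto

lemma symdiff_eq_empty_iff: "A \<triangle> B = {} \<longleftrightarrow> A = B"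
  by (auto simp: symdiff_def)

definition cycle_space :: "'a set \<Rightarrow> 'a set set \<Rightarrow> bool" where
  "cycle_space E Z \<longleftrightarrow> finite E \<and> Z \<subseteq> Pow E \<and> {} \<in> Z \<and> (\<forall>C\<in>Z. \<forall>D\<in>Z. C \<triangle> D \<in> Z)"

lemma cycle_space_ground: "cycle_space E Z \<Longrightarrow> finite E"
  and cycle_space_empty: "cycle_space E Z \<Longrightarrow> {} \<in> Z"
  and cycle_space_subset: "cycle_space E Z \<Longrightarrow> D \<in> Z \<Longrightarrow> D \<subseteq> E"
  and cycle_space_symdiff: "cycle_space E Z \<Longrightarrow> C \<in> Z \<Longrightarrow> D \<in> Z \<Longrightarrow> C \<triangle> D \<in> Z"
  unfolding cycle_space_def by blast+

lemma cycle_space_finite: "cycle_space E Z \<Longrightarrow> D \<in> Z \<Longrightarrow> finite D"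
  unfolding cycle_space_def by (meson PowD finite_subset subsetD)

definition binary_matroid :: "'a set \<Rightarrow> 'a set set \<Rightarrow> 'a set_system" where
  "binary_matroid E Z =
     \<lparr>ground = E, indep = {I. I \<subseteq> E \<and> (\<nexists>D. D \<in> Z \<and> D \<noteq> {} \<and> D \<subseteq> I)}\<rparr>"

lemma ground_binary_matroid [simp]: "ground (binary_matroid E Z) = E"
  by (simp add: binary_matroid_def)

lemma indep_binary_matroid:
  "I \<in> indep (binary_matroid E Z) \<longleftrightarrow> I \<subseteq> E \<and> (\<forall>D\<in>Z. D \<subseteq> I \<longrightarrow> D = {})"
  by (auto simp: binary_matroid_def)

text \<open>The sets \<open>D\<close> act as fundamental cycles of the elements outside
  \<open>I\<close>: adding them one at a time cancels those elements of \<open>T\<close>. In linear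
  terms \<open>I\<close> spans \<open>T\<close> modulo \<open>Z\<close>.\<close>

lemma cycle_space_reduce:
  assumes Z: "cycle_space E Z" and "finite T"
    and fund: "\<And>x. x \<in> T \<Longrightarrow> x \<notin> I \<Longrightarrow> \<exists>D\<in>Z. x \<in> D \<and> D \<subseteq> insert x I"
  shows "\<exists>S\<subseteq>I. T \<triangle> S \<in> Z"
  using \<open>finite T\<close> fund
proof (induction T rule: finite_induct)
  case empty
  then show ?case using cycle_space_empty[OF Z] by auto
next
  case (insert x T)
  then obtain S where S: "S \<subseteq> I" "T \<triangle> S \<in> Z" by auto
  show ?case
  proof (cases "x \<in> I")
    case True
    have "insert x T \<triangle> (S \<triangle> {x}) = T \<triangle> S" using insert.hyps by auto
    then show ?thesis using S True by (intro exI[of _ "S \<triangle> {x}"]) auto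
  next
    case False
    then obtain D where D: "D \<in> Z" "x \<in> D" "D \<subseteq> insert x I" using insert.prems by auto
    have "insert x T \<triangle> (S \<triangle> (D - {x})) = (T \<triangle> S) \<triangle> D" using insert.hyps D S False by auto
    also have "\<dots> \<in> Z" using S D by (simp add: cycle_space_symdiff[OF Z])
    finally show ?thesis using S D by (intro exI[of _ "S \<triangle> (D - {x})"]) auto
  qed
qed

lemma binary_matroid_dependent_insert:
  assumes "I \<in> indep (binary_matroid E Z)" "insert x I \<notin> indep (binary_matroid E Z)" "x \<in> E"
  shows "\<exists>D\<in>Z. x \<in> D \<and> D \<subseteq> insert x I"
  using assms unfolding indep_binary_matroid by blast

text \<open>Augmentation by a count in place of a dimension argument: if it failed, \<open>I\<close>
  would span \<open>J\<close>, every subset of \<open>J\<close> would be congruent modulo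
  \<open>Z\<close> to a subset of \<open>I\<close>, and independence of \<open>J\<close> makes this
  assignment injective, so that \<open>2 ^ card J \<le> 2 ^ card I\<close>.\<close>

lemma matroid_binary_matroid:
  assumes Z: "cycle_space E Z"
  shows "matroid (binary_matroid E Z)"
proof
  let ?M = "binary_matroid E Z"
  show "finite (ground ?M)" using Z by (simp add: cycle_space_def)
  show "I \<subseteq> ground ?M" if "I \<in> indep ?M" for I
    using that by (simp add: indep_binary_matroid)
  show "{} \<in> indep ?M" by (auto simp: indep_binary_matroid)
  show "J \<in> indep ?M" if "I \<in> indep ?M" "J \<subseteq> I" for I J
    using that unfolding indep_binary_matroid by blast
  show "\<exists>x\<in>J - I. insert x I \<in> indep ?M"
    if I: "I \<in> indep ?M" and J: "J \<in> indep ?M" and less: "card I < card J" for I J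
  proof (rule ccontr)
    assume contra: "\<not> ?thesis"
    have fin: "finite I" "finite J"
      using I J cycle_space_ground[OF Z] unfolding indep_binary_matroid by (meson finite_subset)+
    have fund: "\<exists>D\<in>Z. x \<in> D \<and> D \<subseteq> insert x I" if "x \<in> J" "x \<notin> I" for x
    proof (rule binary_matroid_dependent_insert[OF I])
      show "insert x I \<notin> indep ?M" using contra that by blast
      show "x \<in> E" using J that by (auto simp: indep_binary_matroid)
    qed
    have "\<exists>S\<subseteq>I. T \<triangle> S \<in> Z" if "T \<in> Pow J" for T
    proof (rule cycle_space_reduce[OF Z])
      show "finite T" using that fin(2) by (meson PowD finite_subset)
      show "\<exists>D\<in>Z. x \<in> D \<and> D \<subseteq> insert x I" if "x \<in> T" "x \<notin> I" for x
        using fund[of x] \<open>T \<in> Pow J\<close> that by blast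
    qed
    then obtain f where f: "\<And>T. T \<in> Pow J \<Longrightarrow> f T \<subseteq> I \<and> T \<triangle> f T \<in> Z"
      by metis
    have "inj_on f (Pow J)"
    proof
      fix T T' assume T: "T \<in> Pow J" "T' \<in> Pow J" and eq: "f T = f T'"
      have "T \<triangle> T' = (T \<triangle> f T) \<triangle> (T' \<triangle> f T')" using eq by auto
      also have "\<dots> \<in> Z" using f T by (simp add: cycle_space_symdiff[OF Z])
      finally have "T \<triangle> T' \<in> Z" .
      moreover have "T \<triangle> T' \<subseteq> J" using T by auto
      ultimately have "T \<triangle> T' = {}" using J unfolding indep_binary_matroid by blast
      then show "T = T'" by (simp add: symdiff_eq_empty_iff)
    qed
    moreover have "f ` Pow J \<subseteq> Pow I" using f by auto
    ultimately have "card (Pow J) \<le> card (Pow I)" using fin by (intro card_inj_on_le) auto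
    then show False using fin less by (simp add: card_Pow)
  qed
qed

text \<open>A basis \<open>B\<close> yields a complement of \<open>Z\<close>: each subset of
  \<open>E\<close> is in exactly one way a sum of a member of \<open>Z\<close> and a subset of
  \<open>B\<close>. Thus the rank is the codimension of \<open>Z\<close>.\<close>

lemma card_cycle_space:
  assumes Z: "cycle_space E Z"
  shows "2 ^ card E = card Z * 2 ^ matroid_rank (binary_matroid E Z)"
proof -
  let ?M = "binary_matroid E Z"
  have finE: "finite E" using Z by (simp add: cycle_space_def)
  have "indep ?M \<subseteq> Pow E" by (auto simp: indep_binary_matroid)
  then have fini: "finite (indep ?M)" using finE by (simp add: finite_subset)
  have "{} \<in> indep ?M" by (auto simp: indep_binary_matroid)
  then have "matroid_rank ?M \<in> card ` indep ?M"
    unfolding matroid_rank_def using fini by (intro Max_in) auto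
  then obtain B where B: "B \<in> indep ?M" and cB: "matroid_rank ?M = card B" by auto
  have finB: "finite B" using B finE unfolding indep_binary_matroid by (meson finite_subset)
  \<comment> \<open>A largest independent set cannot be enlarged, so each further element closes a
    cycle with it.\<close>
  have fund: "\<exists>D\<in>Z. x \<in> D \<and> D \<subseteq> insert x B" if "x \<in> E" "x \<notin> B" for x
  proof (rule binary_matroid_dependent_insert[OF B _ \<open>x \<in> E\<close>], rule notI)
    assume "insert x B \<in> indep ?M"
    then have "card (insert x B) \<le> matroid_rank ?M"
      unfolding matroid_rank_def using fini by (intro Max_ge) auto
    then show False using cB finB \<open>x \<notin> B\<close> by simp
  qed
  have "bij_betw (\<lambda>(D, S). D \<triangle> S) (Z \<times> Pow B) (Pow E)"
    unfolding bij_betw_def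
  proof (intro conjI inj_onI set_eqI iffI)
    fix x y assume xy: "x \<in> Z \<times> Pow B" "y \<in> Z \<times> Pow B"
      and eq0: "(case x of (D, S) \<Rightarrow> D \<triangle> S) = (case y of (D, S) \<Rightarrow> D \<triangle> S)"
    obtain D S D' S' where x: "x = (D, S)" and y: "y = (D', S')" by fastforce
    have eq: "D \<triangle> S = D' \<triangle> S'" using eq0 x y by simp
    then have "S \<triangle> S' = D \<triangle> D'" by (auto simp: set_eq_iff)
    also have "\<dots> \<in> Z" using xy x y by (simp add: cycle_space_symdiff[OF Z])
    finally have "S \<triangle> S' \<in> Z" .
    moreover have "S \<triangle> S' \<subseteq> B" using xy x y by auto
    ultimately have "S \<triangle> S' = {}" using B unfolding indep_binary_matroid by blast
    then have "S = S'" by (simp add: symdiff_eq_empty_iff)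
    moreover from this have "D = D'" using eq by (auto simp: set_eq_iff)
    ultimately show "x = y" using x y by simp
  next
    fix T assume "T \<in> (\<lambda>(D, S). D \<triangle> S) ` (Z \<times> Pow B)"
    then obtain D S where "T = D \<triangle> S" "D \<in> Z" "S \<subseteq> B" by auto
    moreover have "Z \<subseteq> Pow E" "B \<subseteq> E"
      using Z B by (simp_all add: cycle_space_def indep_binary_matroid)
    ultimately have "D \<subseteq> E" "S \<subseteq> E" by blast+
    with \<open>T = D \<triangle> S\<close> show "T \<in> Pow E" by auto
  next
    fix T assume T: "T \<in> Pow E"
    then have "\<exists>S\<subseteq>B. T \<triangle> S \<in> Z"
    proof (intro cycle_space_reduce[OF Z])
      show "finite T" using T finE by (meson PowD finite_subset)
      show "\<exists>D\<in>Z. x \<in> D \<and> D \<subseteq> insert x B" if "x \<in> T" "x \<notin> B" for x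
        using fund[of x] T that by blast
    qed
    then obtain S where S: "S \<subseteq> B" "T \<triangle> S \<in> Z" by auto
    have "T = (T \<triangle> S) \<triangle> S" by auto
    then show "T \<in> (\<lambda>(D, S). D \<triangle> S) ` (Z \<times> Pow B)" 
      using S by (intro image_eqI[of _ _ "(T \<triangle> S, S)"]) simp_all
  qed
  then have "card (Pow E) = card (Z \<times> Pow B)" by (metis bij_betw_same_card)
  then show ?thesis using finE finB cB by (simp add: card_Pow card_cartesian_product)
qed

lemma cycle_space_minimal:
  assumes Z: "cycle_space E Z" and "D \<in> Z" "D \<noteq> {}"
  shows "\<exists>C\<in>Z. C \<noteq> {} \<and> C \<subseteq> D \<and> (\<forall>C'\<in>Z. C' \<subseteq> C \<longrightarrow> C' = {} \<or> C' = C)"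
proof -
  have "finite {C \<in> Z. C \<noteq> {} \<and> C \<subseteq> D}"
    using cycle_space_ground[OF Z] cycle_space_subset[OF Z]
    by (auto intro!: finite_subset[where A="{C \<in> Z. C \<noteq> {} \<and> C \<subseteq> D}" and B="Pow E"])
  moreover have "{C \<in> Z. C \<noteq> {} \<and> C \<subseteq> D} \<noteq> {}" using assms by auto
  ultimately obtain C where C: "C \<in> {C \<in> Z. C \<noteq> {} \<and> C \<subseteq> D}"
    and min: "\<forall>C'\<in>{C \<in> Z. C \<noteq> {} \<and> C \<subseteq> D}. C' \<le> C \<longrightarrow> C = C'"
    by (metis (no_types, lifting) finite_has_minimal)
  show ?thesis
  proof (intro bexI[of _ C] conjI ballI impI)
    show "C \<in> Z" "C \<noteq> {}" "C \<subseteq> D" using C by simp_all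
    show "C' = {} \<or> C' = C" if "C' \<in> Z" "C' \<subseteq> C" for C'
      using that \<open>C \<subseteq> D\<close> min by (metis (mono_tags, lifting) mem_Collect_eq order_trans)
  qed
qed

text \<open>Dependent sets are those containing a nonempty member, so the minimal nonempty members
  of \<open>Z\<close> and \<open>Z'\<close> agree; and every member is a sum of minimal ones. The
  induction on \<open>card D\<close> splits off one minimal \<open>C\<close> at a time.\<close>

lemma binary_matroid_inj_aux:
  assumes Z: "cycle_space E Z" and Z': "cycle_space E' Z'"
    and eq: "binary_matroid E Z = binary_matroid E' Z'"
  shows "Z \<subseteq> Z'"
proof
  have E: "E = E'" using eq by (metis ground_binary_matroid)
  have transfer: "\<exists>D\<in>Y. D \<noteq> {} \<and> D \<subseteq> C"
    if "binary_matroid E X = binary_matroid E Y" "C \<in> X" "C \<noteq> {}" "C \<subseteq> E" for X Y C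
  proof -
    have "C \<notin> indep (binary_matroid E X)"
      using that(2,3) by (auto simp: indep_binary_matroid)
    then have "C \<notin> indep (binary_matroid E Y)" using that(1) by simp
    then show ?thesis using \<open>C \<subseteq> E\<close> by (auto simp: indep_binary_matroid)
  qed
  fix D assume "D \<in> Z"
  then show "D \<in> Z'"
  proof (induction "card D" arbitrary: D rule: less_induct)
    case less
    show ?case
    proof (cases "D = {}")
      case True then show ?thesis using cycle_space_empty[OF Z'] by simp
    next
      case False
      then obtain C where C: "C \<in> Z" "C \<noteq> {}" "C \<subseteq> D"
        and min: "\<forall>C'\<in>Z. C' \<subseteq> C \<longrightarrow> C' = {} \<or> C' = C"
        using cycle_space_minimal[OF Z less.prems] by blast
      have CE: "C \<subseteq> E" and finD: "finite D"
        using cycle_space_subset[OF Z C(1)] cycle_space_finite[OF Z less.prems] by simp_all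
      obtain C' where C': "C' \<in> Z'" "C' \<noteq> {}" "C' \<subseteq> C" using transfer[OF eq[folded E] C(1,2) CE]
        by blast
      obtain C'' where C'': "C'' \<in> Z" "C'' \<noteq> {}" "C'' \<subseteq> C'"
        using transfer[OF eq[folded E, symmetric] C'(1,2)] C'(3) CE by blast
      \<comment> \<open>\<open>C''\<close> is a nonempty member of \<open>Z\<close> below the
        minimal \<open>C\<close>, so the chain \<open>C'' \<subseteq> C' \<subseteq> C\<close>
        collapses and \<open>C\<close> itself belongs to \<open>Z'\<close>.\<close>
      have "C'' = C" using min C''(1,2) subset_trans[OF C''(3) C'(3)] by blast
      then have "C' = C" using C'(3) C''(3) by blast
      have "D \<triangle> C \<in> Z" using less.prems C(1) by (rule cycle_space_symdiff[OF Z])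
      moreover have "D \<triangle> C \<subset> D" using C by auto
      ultimately have "D \<triangle> C \<in> Z'" using less.hyps[OF psubset_card_mono[OF finD]] by blast
      then have "(D \<triangle> C) \<triangle> C \<in> Z'" using C' \<open>C' = C\<close> by (simp add: cycle_space_symdiff[OF Z'])
      moreover have "(D \<triangle> C) \<triangle> C = D" by auto
      ultimately show ?thesis by simp
    qed
  qed
qed

lemma binary_matroid_inj:
  assumes "cycle_space E Z" "cycle_space E' Z'" "binary_matroid E Z = binary_matroid E' Z'"
  shows "Z = Z'"
  using binary_matroid_inj_aux[OF assms] binary_matroid_inj_aux[OF assms(2,1) assms(3)[symmetric]]
  by (rule subset_antisym)

lemma circuit_binary_matroid:
  "circuit (binary_matroid E Z) C \<longleftrightarrow>
     C \<subseteq> E \<and> C \<in> Z \<and> C \<noteq> {} \<and> (\<forall>D\<in>Z. D \<subseteq> C \<longrightarrow> D = {} \<or> D = C)" (is "?L \<longleftrightarrow> ?R")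
proof
  assume C: ?L
  then have CE: "C \<subseteq> E" and dep: "C \<notin> indep (binary_matroid E Z)"
    and ind: "\<And>D. D \<subset> C \<Longrightarrow> D \<in> indep (binary_matroid E Z)"
    by (simp_all add: circuit_def)
  have *: "D = C" if "D \<in> Z" "D \<subseteq> C" "D \<noteq> {}" for D
  proof (rule ccontr)
    assume "D \<noteq> C"
    then have "D \<in> indep (binary_matroid E Z)" using ind that(2) by blast
    then show False using that by (simp add: indep_binary_matroid)
  qed
  obtain D where D: "D \<in> Z" "D \<subseteq> C" "D \<noteq> {}"
    using dep CE by (auto simp: indep_binary_matroid)
  have "D = C" using *[OF D] .
  then show ?R using D CE * by blast
next
  assume R: ?R
  then have "C \<notin> indep (binary_matroid E Z)" unfolding indep_binary_matroid by blast
  moreover have "D \<in> indep (binary_matroid E Z)" if "D \<subset> C" for D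
    unfolding indep_binary_matroid
  proof (intro conjI ballI impI)
    show "D \<subseteq> E" using that R by blast
    show "D' = {}" if "D' \<in> Z" "D' \<subseteq> D" for D'
    proof -
      have "D' \<noteq> C" "D' \<subseteq> C" using that \<open>D \<subset> C\<close> by auto
      then show ?thesis using R that(1) by blast
    qed
  qed
  ultimately show ?L using R by (simp add: circuit_def)
qed

text \<open>A nonempty member with at most two elements contains a minimal one, which is a loop or a
  parallel pair; conversely, loops and parallel pairs are members of this size.\<close>

lemma simple_binary_matroid:
  assumes Z: "cycle_space E Z"
  shows "simple_matroid (binary_matroid E Z) \<longleftrightarrow> (\<forall>D\<in>Z. D \<noteq> {} \<longrightarrow> 3 \<le> card D)" (is "?L \<longleftrightarrow> ?R")
proof
  assume s: ?L
  show ?R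
  proof (intro ballI impI, rule ccontr)
    fix D assume D: "D \<in> Z" "D \<noteq> {}" "\<not> 3 \<le> card D"
    obtain C where C: "C \<in> Z" "C \<noteq> {}" "C \<subseteq> D" and min: "\<forall>C'\<in>Z. C' \<subseteq> C \<longrightarrow> C' = {} \<or> C' = C"
      using cycle_space_minimal[OF Z D(1,2)] by blast
    have CE: "C \<subseteq> E" and fin: "finite D"
      using cycle_space_subset[OF Z C(1)] cycle_space_finite[OF Z D(1)] by simp_all
    have circ: "circuit (binary_matroid E Z) C"
      using C min CE by (simp add: circuit_binary_matroid)
    have "card C \<le> 2" using C(3) fin D(3) card_mono[of D C] by auto
    moreover have "card C \<noteq> 0" using C fin by (auto simp: finite_subset)
    ultimately consider "card C = 1" | "card C = 2" by linarith
    then show False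
    proof cases
      case 1 then show False
        using s circ unfolding simple_matroid_def matroid_loop_def by (metis card_1_singletonE)
    next
      case 2 then show False
        using s circ unfolding simple_matroid_def parallel_elements_def by (metis card_2_iff)
    qed
  qed
next
  assume r: ?R
  have no: "\<not> circuit (binary_matroid E Z) C" if "card C \<le> 2" for C
    using r that by (auto simp: circuit_binary_matroid)
  have "card {e, f} \<le> 2" for e f :: 'a by (simp add: card_insert_if)
  then have "\<not> circuit (binary_matroid E Z) {e, f}" "\<not> circuit (binary_matroid E Z) {e}" for e f
    by (simp_all add: no)
  then show ?L
    by (simp add: simple_matroid_def matroid_loop_def parallel_elements_def)
qed

section \<open>Networks as affine families of path sets\<close>

text \<open>
  A network with two terminals is represented by the family \<open>F\<close> of edge sets whose vertices of odd
  degree are exactly the terminals. Its cycle space is then \<open>symdiffs F\<close>, and the minimal members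
  of \<open>F\<close> are the paths between the terminals.
\<close>

definition symdiffs :: "'a set set \<Rightarrow> 'a set set" where
  "symdiffs F = {p \<triangle> q |p q. p \<in> F \<and> q \<in> F}"

text \<open>Grading by the parity at the terminals: \<open>True\<close> selects the sets of odd
  degree at both terminals, \<open>False\<close> the sets of the cycle space.\<close>

definition layer :: "'a set set \<Rightarrow> bool \<Rightarrow> 'a set set" where
  "layer F b = (if b then F else symdiffs F)"

definition ser :: "'a set set \<Rightarrow> 'a set set \<Rightarrow> 'a set set" where
  "ser F G = {p \<union> q |p q. p \<in> F \<and> q \<in> G}"

text \<open>At shared terminals the parities of the two parts add up, so exactly one part must be
  odd there. In \<open>ser\<close> the joint vertex has even degree, which forces both parts to be
  odd.\<close>

definition par :: "'a set set \<Rightarrow> 'a set set \<Rightarrow> 'a set set" where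
  "par F G = {p \<union> q |p q. \<exists>b. p \<in> layer F b \<and> q \<in> layer G (\<not> b)}"

text \<open>Replacement of the edge \<open>a\<close> by a network \<open>G\<close>: a set using
  \<open>a\<close> runs through \<open>G\<close> from terminal to terminal, a set avoiding
  \<open>a\<close> can only pick up cycles of \<open>G\<close>.\<close>

definition subst_elem :: "'a set set \<Rightarrow> 'a \<Rightarrow> 'a set set \<Rightarrow> 'a set set" where
  "subst_elem K a G = {(p - {a}) \<union> q |p q. p \<in> K \<and> q \<in> layer G (a \<in> p)}"

text \<open>Closure under sums of three characterises the affine subspaces over the two-element
  field without the choice of a base point.\<close>

definition coset :: "'a set \<Rightarrow> 'a set set \<Rightarrow> bool" where
  "coset A F \<longleftrightarrow> F \<subseteq> Pow A \<and> F \<noteq> {} \<and> (\<forall>p\<in>F. \<forall>q\<in>F. \<forall>r\<in>F. p \<triangle> q \<triangle> r \<in> F)"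

section \<open>Parity calculus of layers\<close>

lemma layer_True [simp]: "layer F True = F"
  and layer_False [simp]: "layer F False = symdiffs F"
  by (simp_all add: layer_def)

lemma symdiff_assoc: "(A \<triangle> B) \<triangle> C = A \<triangle> (B \<triangle> C)"
  by auto

lemma symdiff_cancel: "p \<triangle> (p \<triangle> q) = q" "(q \<triangle> p) \<triangle> p = q"
  by auto

lemma symdiff_subset: "p \<subseteq> A \<Longrightarrow> q \<subseteq> A \<Longrightarrow> p \<triangle> q \<subseteq> A"
  by auto

lemma symdiff_Un:
  assumes "p \<subseteq> A" "p' \<subseteq> A" "q \<subseteq> B" "q' \<subseteq> B" "A \<inter> B = {}"
  shows "(p \<union> q) \<triangle> (p' \<union> q') = (p \<triangle> p') \<union> (q \<triangle> q')"
  using assms unfolding symdiff_def by blast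

lemma symdiffsI: "p \<in> F \<Longrightarrow> q \<in> F \<Longrightarrow> p \<triangle> q \<in> symdiffs F"
  unfolding symdiffs_def by blast

lemma symdiffsE: "c \<in> symdiffs F \<Longrightarrow> (\<And>p q. p \<in> F \<Longrightarrow> q \<in> F \<Longrightarrow> c = p \<triangle> q \<Longrightarrow> P) \<Longrightarrow> P"
  unfolding symdiffs_def by blast

lemma serI: "p \<in> F \<Longrightarrow> q \<in> G \<Longrightarrow> p \<union> q \<in> ser F G"
  unfolding ser_def by blast

lemma serE: "r \<in> ser F G \<Longrightarrow> (\<And>p q. p \<in> F \<Longrightarrow> q \<in> G \<Longrightarrow> r = p \<union> q \<Longrightarrow> P) \<Longrightarrow> P"
  unfolding ser_def by blast

lemma parI: "p \<in> layer F b \<Longrightarrow> q \<in> layer G (\<not> b) \<Longrightarrow> p \<union> q \<in> par F G"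
  unfolding par_def by blast

lemma parE:
  "r \<in> par F G \<Longrightarrow> (\<And>p q b. p \<in> layer F b \<Longrightarrow> q \<in> layer G (\<not> b) \<Longrightarrow> r = p \<union> q \<Longrightarrow> P) \<Longrightarrow> P"
  unfolding par_def by blast

lemma subst_elemI: "p \<in> K \<Longrightarrow> q \<in> layer G (a \<in> p) \<Longrightarrow> (p - {a}) \<union> q \<in> subst_elem K a G"
  unfolding subst_elem_def by blast

lemma subst_elemE:
  "r \<in> subst_elem K a G \<Longrightarrow>
     (\<And>p q. p \<in> K \<Longrightarrow> q \<in> layer G (a \<in> p) \<Longrightarrow> r = (p - {a}) \<union> q \<Longrightarrow> P) \<Longrightarrow> P"
  unfolding subst_elem_def by blast

lemma ser_commute: "ser F G = ser G F"
  unfolding ser_def by (auto simp: Un_commute)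

lemma par_commute: "par F G = par G F"
proof -
  have "par F G \<subseteq> par G F" for F G :: "'a set set"
  proof
    fix r assume "r \<in> par F G"
    then obtain p q b where "p \<in> layer F b" "q \<in> layer G (\<not> b)" "r = p \<union> q" by (rule parE)
    then show "r \<in> par G F" using parI[of q G "\<not> b" p F] by (simp add: Un_commute)
  qed
  from this[of F G] this[of G F] show ?thesis by (rule subset_antisym)
qed

lemma layer_subset: "F \<subseteq> Pow A \<Longrightarrow> p \<in> layer F b \<Longrightarrow> p \<subseteq> A"
proof (cases b)
  case False
  assume F: "F \<subseteq> Pow A" and "p \<in> layer F b"
  then obtain r s where "p = r \<triangle> s" "r \<in> F" "s \<in> F" using False by (auto elim: symdiffsE)
  moreover from this F have "r \<subseteq> A" "s \<subseteq> A" by blast+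
  ultimately show ?thesis by (simp add: symdiff_subset)
qed (simp add: Pow_def subset_eq)

lemma cosetD:
  "coset A F \<Longrightarrow> F \<subseteq> Pow A" "coset A F \<Longrightarrow> F \<noteq> {}"
  "coset A F \<Longrightarrow> p \<in> F \<Longrightarrow> q \<in> F \<Longrightarrow> r \<in> F \<Longrightarrow> p \<triangle> q \<triangle> r \<in> F"
  unfolding coset_def by blast+

lemma empty_in_symdiffs: "F \<noteq> {} \<Longrightarrow> {} \<in> symdiffs F"
  using symdiffsI[of _ F] symdiff_self by (metis ex_in_conv)

lemma layer_nonempty: "F \<noteq> {} \<Longrightarrow> layer F b \<noteq> {}"
  using empty_in_symdiffs[of F] by (cases b) auto

lemma symdiff_layer:
  assumes F: "coset A F" and p: "p \<in> layer F a" and q: "q \<in> layer F b"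
  shows "p \<triangle> q \<in> layer F (a \<noteq> b)"
proof (cases a; cases b)
  assume "a" "b"
  then show ?thesis using p q by (simp add: symdiffsI)
next
  assume "a" "\<not> b"
  then obtain r s where "r \<in> F" "s \<in> F" "q = r \<triangle> s" using q by (auto elim: symdiffsE)
  then show ?thesis using p \<open>a\<close> \<open>\<not> b\<close> cosetD(3)[OF F, of p r s] by (simp add: symdiff_assoc)
next
  assume "\<not> a" "b"
  then obtain r s where "r \<in> F" "s \<in> F" "p = r \<triangle> s" using p by (auto elim: symdiffsE)
  then show ?thesis using q \<open>\<not> a\<close> \<open>b\<close> cosetD(3)[OF F, of r s q] by simp
next
  assume "\<not> a" "\<not> b"
  then obtain r s t u where *: "r \<in> F" "s \<in> F" "p = r \<triangle> s" "t \<in> F" "u \<in> F" "q = t \<triangle> u"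
    using p q by (auto elim!: symdiffsE)
  have "p \<triangle> q = (r \<triangle> s \<triangle> t) \<triangle> u" using * by (simp add: symdiff_assoc)
  then show ?thesis using \<open>\<not> a\<close> \<open>\<not> b\<close> symdiffsI[OF cosetD(3)[OF F, of r s t], of u] * by simp
qed

lemma layer_ser:
  assumes "F \<subseteq> Pow A" "G \<subseteq> Pow B" "A \<inter> B = {}"
  shows "layer (ser F G) b = ser (layer F b) (layer G b)"
proof (cases b)
  case False
  have "symdiffs (ser F G) = ser (symdiffs F) (symdiffs G)"
  proof (intro subset_antisym subsetI)
    fix r assume "r \<in> symdiffs (ser F G)"
    then obtain p q p' q' where *: "p \<in> F" "q \<in> G" "p' \<in> F" "q' \<in> G" "r = (p \<union> q) \<triangle> (p' \<union> q')"
      by (auto elim!: symdiffsE serE)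
    then have "r = (p \<triangle> p') \<union> (q \<triangle> q')" using symdiff_Un[of p A p' q B q'] assms by blast
    then show "r \<in> ser (symdiffs F) (symdiffs G)" using * by (simp add: serI symdiffsI)
  next
    fix r assume "r \<in> ser (symdiffs F) (symdiffs G)"
    then obtain p q p' q' where *: "p \<in> F" "q \<in> G" "p' \<in> F" "q' \<in> G" "r = (p \<triangle> p') \<union> (q \<triangle> q')"
      by (auto elim!: symdiffsE serE)
    then have "r = (p \<union> q) \<triangle> (p' \<union> q')" using symdiff_Un[of p A p' q B q'] assms by blast
    then show "r \<in> symdiffs (ser F G)" using * by (simp add: serI symdiffsI)
  qed
  with False show ?thesis by simp
qed simp

text \<open>For \<open>c = True\<close> this is the definition of \<open>par\<close>. For
  \<open>c = False\<close> it says that a cycle meets both parts in sets of equal parity: it either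
  stays closed in each part or crosses both between the terminals.\<close>

lemma layer_par:
  assumes F: "coset A F" and G: "coset B G" and disj: "A \<inter> B = {}"
  shows "layer (par F G) c = {p \<union> q |p q. \<exists>a b. p \<in> layer F a \<and> q \<in> layer G b \<and> (a \<noteq> b) = c}"
    (is "_ = ?R c")
proof (cases c)
  case True
  have "par F G = ?R True"
    unfolding par_def by (simp add: ex_bool_eq disj_commute)
  with True show ?thesis by simp
next
  case False
  note FG = cosetD(1)[OF F] cosetD(1)[OF G]
  have "symdiffs (par F G) = ?R False"
  proof (intro subset_antisym subsetI)
    fix r assume "r \<in> symdiffs (par F G)"
    then obtain p q a p' q' b where *: "p \<in> layer F a" "q \<in> layer G (\<not> a)" "p' \<in> layer F b"
      "q' \<in> layer G (\<not> b)" "r = (p \<union> q) \<triangle> (p' \<union> q')"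
      by (auto elim!: symdiffsE parE)
    then have "r = (p \<triangle> p') \<union> (q \<triangle> q')"
      using symdiff_Un[of p A p' q B q'] disj layer_subset[OF FG(1)] layer_subset[OF FG(2)] by blast
    moreover have "p \<triangle> p' \<in> layer F (a \<noteq> b)" using symdiff_layer[OF F] * by blast
    moreover have "q \<triangle> q' \<in> layer G (a \<noteq> b)"
      using symdiff_layer[OF G, of q "\<not> a" q' "\<not> b"] * by simp
    ultimately show "r \<in> ?R False" by blast
  next
    fix r assume "r \<in> ?R False"
    then obtain p q a where *: "p \<in> layer F a" "q \<in> layer G a" "r = p \<union> q" by auto
    \<comment> \<open>The pair \<open>p\<close>, \<open>q\<close> of equal parity has to be a
      difference of two members of \<open>par F G\<close>. Shifting by the mixed pair
      \<open>s\<close>, \<open>t\<close> produces the first, and \<open>s \<union> t\<close> is the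
      second.\<close>
    obtain s where s: "s \<in> layer F False" using layer_nonempty[OF cosetD(2)[OF F]] by blast
    obtain t where t: "t \<in> layer G True" using layer_nonempty[OF cosetD(2)[OF G]] by blast
    have 1: "p \<triangle> s \<in> layer F a" using symdiff_layer[OF F *(1) s] by simp
    have 2: "q \<triangle> t \<in> layer G (\<not> a)" using symdiff_layer[OF G *(2) t] by simp
    have "((p \<triangle> s) \<union> (q \<triangle> t)) \<triangle> (s \<union> t) = ((p \<triangle> s) \<triangle> s) \<union> ((q \<triangle> t) \<triangle> t)"
      by (rule symdiff_Un[OF layer_subset[OF FG(1) 1] layer_subset[OF FG(1) s]
            layer_subset[OF FG(2) 2] layer_subset[OF FG(2) t] disj])
    then have "r = ((p \<triangle> s) \<union> (q \<triangle> t)) \<triangle> (s \<union> t)" using *(3) by (simp add: symdiff_cancel)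
    then show "r \<in> symdiffs (par F G)" using symdiffsI parI[OF 1 2] parI[of s F False t G] s t
      by simp
  qed
  with False show ?thesis by simp
qed

lemma symdiff_subst_elem:
  assumes "p \<subseteq> E" "p' \<subseteq> E" "q \<subseteq> B" "q' \<subseteq> B" "(E - {a}) \<inter> B = {}"
  shows "((p - {a}) \<union> q) \<triangle> ((p' - {a}) \<union> q') = ((p \<triangle> p') - {a}) \<union> (q \<triangle> q')"
  using assms unfolding symdiff_def by blast

text \<open>Substitution commutes with passing to the cycle space because the parity
  \<open>a \<in> p\<close> is additive in \<open>p\<close>. This lets it pass through
  \<open>par\<close>, where both layers occur.\<close>

lemma layer_subst_elem:
  assumes K: "K \<subseteq> Pow E" and G: "coset B G" and disj: "(E - {a}) \<inter> B = {}"
  shows "layer (subst_elem K a G) b = subst_elem (layer K b) a G"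
proof (cases b)
  case False
  note sub = layer_subset[OF cosetD(1)[OF G]]
  have "symdiffs (subst_elem K a G) = subst_elem (symdiffs K) a G"
  proof (intro subset_antisym subsetI)
    fix r assume "r \<in> symdiffs (subst_elem K a G)"
    then obtain p q p' q' where *: "p \<in> K" "q \<in> layer G (a \<in> p)" "p' \<in> K" "q' \<in> layer G (a \<in> p')"
      "r = ((p - {a}) \<union> q) \<triangle> ((p' - {a}) \<union> q')"
      by (auto elim!: symdiffsE subst_elemE)
    have "r = ((p \<triangle> p') - {a}) \<union> (q \<triangle> q')"
      unfolding *(5) using * K by (intro symdiff_subst_elem[OF _ _ _ _ disj]) (auto dest: sub)
    moreover have "q \<triangle> q' \<in> layer G (a \<in> p \<triangle> p')" using symdiff_layer[OF G *(2,4)] by simp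
    ultimately show "r \<in> subst_elem (symdiffs K) a G" using * by (simp add: subst_elemI symdiffsI)
  next
    fix r assume "r \<in> subst_elem (symdiffs K) a G"
    then obtain p p' q where *: "p \<in> K" "p' \<in> K" "q \<in> layer G (a \<in> p \<triangle> p')"
      "r = ((p \<triangle> p') - {a}) \<union> q"
      by (auto elim!: symdiffsE subst_elemE)
    \<comment> \<open>Any completion \<open>q'\<close> of \<open>p'\<close> will do; the rest
      \<open>q \<triangle> q'\<close> then automatically has the parity that completes
      \<open>p\<close>.\<close>
    obtain q' where q': "q' \<in> layer G (a \<in> p')" using layer_nonempty[OF cosetD(2)[OF G]] by blast
    have eq: "((a \<in> p \<triangle> p') \<noteq> (a \<in> p')) = (a \<in> p)" by auto
    have qq: "q \<triangle> q' \<in> layer G (a \<in> p)" using symdiff_layer[OF G *(3) q'] unfolding eq .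
    have "((p - {a}) \<union> (q \<triangle> q')) \<triangle> ((p' - {a}) \<union> q') = ((p \<triangle> p') - {a}) \<union> ((q \<triangle> q') \<triangle> q')"
      using * K qq q' by (intro symdiff_subst_elem[OF _ _ _ _ disj]) (auto dest!: sub)
    then have "r = ((p - {a}) \<union> (q \<triangle> q')) \<triangle> ((p' - {a}) \<union> q')" using * by (simp add: symdiff_cancel)
    then show "r \<in> symdiffs (subst_elem K a G)"
      using symdiffsI[OF subst_elemI[OF *(1) qq] subst_elemI[OF *(2) q']] by simp
  qed
  with False show ?thesis by simp
qed simp

text \<open>Disjoint grounds make every element occur once, so networks are read-once expressions in
  \<open>ser\<close> and \<open>par\<close>. Both operations are commutative on families, hence
  order and orientation of the parts leave no trace.\<close>

inductive net :: "'a set \<Rightarrow> 'a set set \<Rightarrow> bool" where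
  single: "net {a} {{a}}"
| series: "net A F \<Longrightarrow> net B G \<Longrightarrow> A \<inter> B = {} \<Longrightarrow> net (A \<union> B) (ser F G)"
| parallel: "net A F \<Longrightarrow> net B G \<Longrightarrow> A \<inter> B = {} \<Longrightarrow> net (A \<union> B) (par F G)"

lemma coset_ser:
  assumes F: "coset A F" and G: "coset B G" and disj: "A \<inter> B = {}"
  shows "coset (A \<union> B) (ser F G)"
  unfolding coset_def
proof (intro conjI ballI)
  note FG = cosetD(1)[OF F] cosetD(1)[OF G]
  show "ser F G \<subseteq> Pow (A \<union> B)" using FG by (auto elim!: serE)
  show "ser F G \<noteq> {}" using cosetD(2)[OF F] cosetD(2)[OF G] unfolding ser_def by blast
  fix x y z assume "x \<in> ser F G" "y \<in> ser F G" "z \<in> ser F G"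
  then obtain p q p' q' p'' q'' where *: "p \<in> F" "p' \<in> F" "p'' \<in> F" "q \<in> G" "q' \<in> G" "q'' \<in> G"
    "x = p \<union> q" "y = p' \<union> q'" "z = p'' \<union> q''"
    by (auto elim!: serE)
  have "x \<triangle> y \<triangle> z = (p \<triangle> p' \<triangle> p'') \<union> (q \<triangle> q' \<triangle> q'')"
  proof -
    have sub: "p \<subseteq> A" "p' \<subseteq> A" "p'' \<subseteq> A" "q \<subseteq> B" "q' \<subseteq> B" "q'' \<subseteq> B" using * FG by blast+
    show ?thesis
      unfolding * symdiff_Un[OF sub(1,2,4,5) disj]
        symdiff_Un[OF symdiff_subset[OF sub(1,2)] sub(3) symdiff_subset[OF sub(4,5)] sub(6) disj] ..
  qed
  also have "\<dots> \<in> ser F G" by (intro serI cosetD(3)[OF F] cosetD(3)[OF G] *)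
  finally show "x \<triangle> y \<triangle> z \<in> ser F G" .
qed

lemma coset_par:
  assumes F: "coset A F" and G: "coset B G" and disj: "A \<inter> B = {}"
  shows "coset (A \<union> B) (par F G)"
  unfolding coset_def
proof (intro conjI ballI)
  note FG = cosetD(1)[OF F] cosetD(1)[OF G]
  note sub = layer_subset[OF FG(1)] layer_subset[OF FG(2)]
  show "par F G \<subseteq> Pow (A \<union> B)" by (auto elim!: parE dest: sub[THEN subsetD])
  show "par F G \<noteq> {}"
  proof -
    obtain p q where "p \<in> layer F True" "q \<in> layer G (\<not> True)"
      using layer_nonempty[OF cosetD(2)[OF F]] layer_nonempty[OF cosetD(2)[OF G]] by blast
    then have "p \<union> q \<in> par F G" by (rule parI)
    then show ?thesis by blast
  qed
  fix x y z assume x: "x \<in> par F G" and y: "y \<in> par F G" and z: "z \<in> par F G"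
  have "x \<triangle> y \<in> layer (par F G) False" using x y by (simp add: symdiffsI)
  then obtain p q a b where xy: "x \<triangle> y = p \<union> q" "p \<in> layer F a" "q \<in> layer G b" "(a \<noteq> b) = False"
    unfolding layer_par[OF F G disj] by blast
  obtain p' q' c where zz: "z = p' \<union> q'" "p' \<in> layer F c" "q' \<in> layer G (\<not> c)"
    using z by (rule parE)
  have "x \<triangle> y \<triangle> z = (p \<triangle> p') \<union> (q \<triangle> q')"
    unfolding xy zz(1)
    by (rule symdiff_Un[OF sub(1)[OF xy(2)] sub(1)[OF zz(2)] sub(2)[OF xy(3)] sub(2)[OF zz(3)] disj])
  moreover have "p \<triangle> p' \<in> layer F (a \<noteq> c)" by (rule symdiff_layer[OF F xy(2) zz(2)])
  moreover have "q \<triangle> q' \<in> layer G (\<not> (a \<noteq> c))"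
    using symdiff_layer[OF G xy(3) zz(3)] xy(4) by simp
  ultimately show "x \<triangle> y \<triangle> z \<in> par F G" by (simp only: parI)
qed

lemma net_coset: "net A F \<Longrightarrow> coset A F"
proof (induction rule: net.induct)
  case (single a)
  then show ?case by (simp add: coset_def)
qed (blast intro: coset_ser coset_par)+

lemma net_subset: "net A F \<Longrightarrow> p \<in> F \<Longrightarrow> p \<subseteq> A"
  using cosetD(1)[OF net_coset] by blast

lemma net_layer_subset: "net A F \<Longrightarrow> p \<in> layer F b \<Longrightarrow> p \<subseteq> A"
  using layer_subset[OF cosetD(1)[OF net_coset]] .

lemma net_nonempty: "net A F \<Longrightarrow> F \<noteq> {}"
  using cosetD(2)[OF net_coset] .

lemma net_ground: "net A F \<Longrightarrow> finite A \<and> A \<noteq> {}"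
  by (induction rule: net.induct) auto

text \<open>The terminals stay distinct. Consequently no set lies in both layers, and the parity of
  a member is well defined (\<open>layers_disjoint\<close>).\<close>

lemma net_empty_notin: "net A F \<Longrightarrow> {} \<notin> F"
proof (induction rule: net.induct)
  case (parallel A F B G)
  show ?case
  proof
    assume "{} \<in> par F G"
    then obtain p q b where *: "p \<in> layer F b" "q \<in> layer G (\<not> b)" "{} = p \<union> q" by (rule parE)
    then have "p = {}" "q = {}" by simp_all
    then show False using * parallel.IH by (cases b) auto
  qed
qed (auto elim!: serE)

lemma layers_disjoint:
  assumes "net A F" "p \<in> layer F a" "p \<in> layer F b"
  shows "a = b"
proof (rule ccontr)
  assume "a \<noteq> b"
  then have "{} \<in> F" using symdiff_layer[OF net_coset[OF assms(1)] assms(2,3)] by simp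
  then show False using net_empty_notin assms(1) by blast
qed

lemma subst_elem_ser:
  assumes F': "net A' F'" and a: "a \<notin> A'"
  shows "subst_elem (ser F F') a G = ser (subst_elem F a G) F'"
proof (intro subset_antisym subsetI)
  fix r assume "r \<in> subst_elem (ser F F') a G"
  then obtain p p' q where *: "p \<in> F" "p' \<in> F'" "q \<in> layer G (a \<in> p \<union> p')" "r = (p \<union> p' - {a}) \<union> q"
    by (auto elim!: subst_elemE serE)
  have "a \<notin> p'" using a net_subset[OF F' *(2)] by blast
  then have "r = (p - {a} \<union> q) \<union> p'" and q: "q \<in> layer G (a \<in> p)" using *(3,4) by auto
  then show "r \<in> ser (subst_elem F a G) F'" using serI[OF subst_elemI[OF *(1) q] *(2)] by simp
next
  fix r assume "r \<in> ser (subst_elem F a G) F'"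
  then obtain p p' q where *: "p \<in> F" "p' \<in> F'" "q \<in> layer G (a \<in> p)" "r = (p - {a} \<union> q) \<union> p'"
    by (auto elim!: subst_elemE serE)
  have "a \<notin> p'" using a net_subset[OF F' *(2)] by blast
  then have "r = (p \<union> p' - {a}) \<union> q" and q: "q \<in> layer G (a \<in> p \<union> p')" using *(3,4) by auto
  then show "r \<in> subst_elem (ser F F') a G" using subst_elemI[OF serI[OF *(1,2)] q] by simp
qed

lemma subst_elem_par:
  assumes F: "net A F" and F': "net A' F'" and a: "a \<notin> A'" and G: "net B G"
    and disj: "(A - {a}) \<inter> B = {}"
  shows "subst_elem (par F F') a G = par (subst_elem F a G) F'"
proof (intro subset_antisym subsetI)
  have layer: "layer (subst_elem F a G) b = subst_elem (layer F b) a G" for b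
    by (rule layer_subst_elem[OF cosetD(1)[OF net_coset[OF F]] net_coset[OF G] disj])
  {
    fix r assume "r \<in> subst_elem (par F F') a G"
    then obtain p p' q b where *: "p \<in> layer F b" "p' \<in> layer F' (\<not> b)"
      "q \<in> layer G (a \<in> p \<union> p')" "r = (p \<union> p' - {a}) \<union> q"
      by (auto elim!: subst_elemE parE)
    have "a \<notin> p'" using a net_layer_subset[OF F' *(2)] by blast
    then have r: "r = (p - {a} \<union> q) \<union> p'" and q: "q \<in> layer G (a \<in> p)" using *(3,4) by auto
    have "p - {a} \<union> q \<in> layer (subst_elem F a G) b" unfolding layer by (rule subst_elemI[OF *(1) q])
    then show "r \<in> par (subst_elem F a G) F'" unfolding r using *(2) by (rule parI)
  next
    fix r assume "r \<in> par (subst_elem F a G) F'"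
    then obtain s p' b where s: "s \<in> subst_elem (layer F b) a G" "p' \<in> layer F' (\<not> b)" "r = s \<union> p'"
      unfolding layer[symmetric] by (rule parE)
    obtain p q where "p \<in> layer F b" "q \<in> layer G (a \<in> p)" "s = p - {a} \<union> q"
      using s(1) by (rule subst_elemE)
    note * = this(1) s(2) this(2) s(3)[unfolded this(3)]
    have "a \<notin> p'" using a net_layer_subset[OF F' *(2)] by blast
    then have "r = (p \<union> p' - {a}) \<union> q" and q: "q \<in> layer G (a \<in> p \<union> p')" using *(3,4) by auto
    then show "r \<in> subst_elem (par F F') a G" using subst_elemI[OF parI[OF *(1,2)] q] by simp
  }
qed

text \<open>Induction on the outer network: by disjointness only the part containing
  \<open>a\<close> changes, and commutativity brings that part to the front.\<close>

lemma net_subst_elem: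
  assumes "net A F" "net B G" "a \<in> A" "(A - {a}) \<inter> B = {}"
  shows "net (A - {a} \<union> B) (subst_elem F a G)"
  using assms(1,3,4)
proof (induction rule: net.induct)
  case (single c)
  have "subst_elem {{a}} a G = G"
    unfolding subst_elem_def by simp
  with single assms(2) show ?case by simp
next
  case (series A1 F1 A2 F2)
  have d: "(A1 - {a}) \<inter> B = {}" "(A2 - {a}) \<inter> B = {}" using series.prems(2) by blast+
  show ?case
  proof (cases "a \<in> A1")
    case True
    then have a: "a \<notin> A2" using series.hyps(3) by blast
    have "(A1 - {a} \<union> B) \<inter> A2 = {}" using series.prems(2) series.hyps(3) a by auto
    moreover have "(A1 - {a} \<union> B) \<union> A2 = A1 \<union> A2 - {a} \<union> B" using a by blast
    ultimately show ?thesis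
      using net.series[OF series.IH(1)[OF True d(1)] series.hyps(2)] subst_elem_ser[OF series.hyps(2) a] by simp
  next
    case False
    then have a: "a \<in> A2" using series.prems(1) by simp
    have "(A2 - {a} \<union> B) \<inter> A1 = {}" using series.prems(2) series.hyps(3) False by auto
    moreover have "(A2 - {a} \<union> B) \<union> A1 = A1 \<union> A2 - {a} \<union> B" using False by blast
    ultimately show ?thesis
      using net.series[OF series.IH(2)[OF a d(2)] series.hyps(1)] subst_elem_ser[OF series.hyps(1) False]
      unfolding ser_commute[of F1 F2] by simp
  qed
next
  case (parallel A1 F1 A2 F2)
  have d: "(A1 - {a}) \<inter> B = {}" "(A2 - {a}) \<inter> B = {}" using parallel.prems(2) by blast+
  show ?case
  proof (cases "a \<in> A1")
    case True
    then have a: "a \<notin> A2" using parallel.hyps(3) by blast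
    have "(A1 - {a} \<union> B) \<inter> A2 = {}" using parallel.prems(2) parallel.hyps(3) a by auto
    moreover have "(A1 - {a} \<union> B) \<union> A2 = A1 \<union> A2 - {a} \<union> B" using a by blast
    ultimately show ?thesis
      using net.parallel[OF parallel.IH(1)[OF True d(1)] parallel.hyps(2)] subst_elem_par[OF parallel.hyps(1,2) a assms(2) d(1)] by simp
  next
    case False
    then have a: "a \<in> A2" using parallel.prems(1) by simp
    have "(A2 - {a} \<union> B) \<inter> A1 = {}" using parallel.prems(2) parallel.hyps(3) False by auto
    moreover have "(A2 - {a} \<union> B) \<union> A1 = A1 \<union> A2 - {a} \<union> B" using False by blast
    ultimately show ?thesis
      using net.parallel[OF parallel.IH(2)[OF a d(2)] parallel.hyps(1)] subst_elem_par[OF parallel.hyps(2,1) False assms(2) d(2)]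
      unfolding par_commute[of F1 F2] by simp
  qed
qed

text \<open>Cycle-space form of the generation of series-parallel graphs: subdividing
  \<open>e\<close> substitutes the series pair \<open>{{e, f}}\<close>, doubling \<open>e\<close>
  substitutes the parallel pair \<open>{{e}, {f}}\<close>. The one-element matroids are treated
  separately.\<close>

inductive sp_space :: "'a set \<Rightarrow> 'a set set \<Rightarrow> bool" where
  base: "e \<noteq> f \<Longrightarrow> sp_space {e, f} {{}, {e, f}}"
| series: "sp_space E Z \<Longrightarrow> e \<in> E \<Longrightarrow> f \<notin> E \<Longrightarrow> sp_space (insert f E) (subst_elem Z e {{e, f}})"
| parallel: "sp_space E Z \<Longrightarrow> e \<in> E \<Longrightarrow> f \<notin> E \<Longrightarrow> sp_space (insert f E) (subst_elem Z e {{e}, {f}})"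

text \<open>For a graph these are the sets joining the two ends of \<open>e\<close> after its
  deletion; \<open>rooted\<close> reverses this by joining the terminals with an edge
  \<open>e\<close>.\<close>

definition link :: "'a set set \<Rightarrow> 'a \<Rightarrow> 'a set set" where
  "link Z e = {D - {e} |D. D \<in> Z \<and> e \<in> D}"

definition rooted :: "'a \<Rightarrow> 'a set set \<Rightarrow> 'a set set" where
  "rooted e F = symdiffs F \<union> insert e ` F"

lemma linkI: "D \<in> Z \<Longrightarrow> e \<in> D \<Longrightarrow> D - {e} \<in> link Z e"
  unfolding link_def by blast

lemma linkE: "p \<in> link Z e \<Longrightarrow> (\<And>D. D \<in> Z \<Longrightarrow> e \<in> D \<Longrightarrow> p = D - {e} \<Longrightarrow> P) \<Longrightarrow> P"
  unfolding link_def by blast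

lemma symdiffs_single [simp]: "symdiffs {p} = {{}}"
  unfolding symdiffs_def by simp

lemma symdiffs_two_singles: "e \<noteq> f \<Longrightarrow> symdiffs {{e}, {f}} = {{}, {e, f}}"
proof (intro subset_antisym subsetI)
  assume "e \<noteq> f"
  then have "{e} \<triangle> {f} = {e, f}" by auto
  moreover fix p assume "p \<in> {{}, {e, f}}"
  ultimately show "p \<in> symdiffs {{e}, {f}}"
    using symdiffsI[of "{e}" "{{e}, {f}}" "{f}"] symdiffsI[of "{e}" "{{e}, {f}}" "{e}"] by auto
qed (auto elim!: symdiffsE)

lemma net_ext: "e \<noteq> f \<Longrightarrow> net {e, f} {{e, f}}" "e \<noteq> f \<Longrightarrow> net {e, f} {{e}, {f}}"
proof -
  assume "e \<noteq> f"
  then have d: "{e} \<inter> {f} = {}" by simp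
  have "ser {{e}} {{f}} = {{e, f}}" unfolding ser_def by auto
  with net.series[OF single single d] show "net {e, f} {{e, f}}" by (simp add: insert_commute)
  have "par {{e}} {{f}} = {{e}, {f}}" unfolding par_def by (auto simp: ex_bool_eq)
  with net.parallel[OF single single d] show "net {e, f} {{e}, {f}}" by (simp add: insert_commute)
qed

text \<open>Substituting a two-part network factors through a gadget \<open>W\<close> on the two
  elements \<open>a\<close> and \<open>f\<close>, which are then replaced by \<open>F\<close> and
  \<open>G\<close>. The relation \<open>R\<close> tells which parities \<open>b\<close>,
  \<open>c\<close> of the parts give parity \<open>d\<close> of the whole, so that series and
  parallel are treated at once. The label \<open>a\<close> is reused inside \<open>F\<close>, hence
  \<open>E \<inter> (A \<union> B) = {a}\<close>.\<close>

lemma subst_elem_twice: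
  assumes Z: "Z \<subseteq> Pow E" and F: "F \<subseteq> Pow A"
    and disj: "A \<inter> B = {}" "E \<inter> (A \<union> B) = {a}" "a \<in> A" "f \<in> B"
    and K: "\<And>d. layer K d = {q \<union> r |q r. \<exists>b c. q \<in> layer F b \<and> r \<in> layer G c \<and> R b c d}"
    and W: "\<And>d. layer W d = {(if b then {a} else {}) \<union> (if c then {f} else {}) |b c. R b c d}"
  shows "subst_elem Z a K = subst_elem (subst_elem (subst_elem Z a W) a F) f G"
proof -
  have ab: "a \<noteq> f" "f \<notin> E" "a \<notin> B" "f \<notin> A" using disj by auto
  define w where "w b c = (if b then {a} else {}) \<union> (if c then {f} else {})" for b c
  have *: "((p - {a} \<union> w b c) - {a} \<union> q - {f}) \<union> r = (p - {a}) \<union> (q \<union> r)"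
    "f \<in> (p - {a} \<union> w b c) - {a} \<union> q \<longleftrightarrow> c"
    "a \<in> p - {a} \<union> w b c \<longleftrightarrow> b"
    if "p \<subseteq> E" "q \<subseteq> A" for p q r b c
    using that ab by (auto simp: w_def)
  show ?thesis
  proof (intro subset_antisym subsetI)
    fix x assume "x \<in> subst_elem Z a K"
    then obtain p t where p: "p \<in> Z" "t \<in> layer K (a \<in> p)" "x = p - {a} \<union> t"
      by (rule subst_elemE)
    obtain q r b c where qr: "q \<in> layer F b" "r \<in> layer G c" "t = q \<union> r" and bc: "R b c (a \<in> p)"
      using p(2) unfolding K by blast
    have sub: "p \<subseteq> E" "q \<subseteq> A" using p(1) Z layer_subset[OF F qr(1)] by auto
    let ?p1 = "p - {a} \<union> w b c"
    have "w b c \<in> layer W (a \<in> p)" unfolding W w_def using bc by blast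
    with p(1) have 1: "?p1 \<in> subst_elem Z a W" by (rule subst_elemI)
    have 2: "?p1 - {a} \<union> q \<in> subst_elem (subst_elem Z a W) a F"
      using qr(1) by (intro subst_elemI 1) (simp only: *(3)[OF sub])
    have "?p1 - {a} \<union> q - {f} \<union> r \<in> subst_elem (subst_elem (subst_elem Z a W) a F) f G"
      using qr(2) by (intro subst_elemI 2) (simp only: *(2)[OF sub])
    then show "x \<in> subst_elem (subst_elem (subst_elem Z a W) a F) f G"
      unfolding *(1)[OF sub] p(3) qr(3) .
  next
    fix x assume "x \<in> subst_elem (subst_elem (subst_elem Z a W) a F) f G"
    then obtain y r where y: "y \<in> subst_elem (subst_elem Z a W) a F" "r \<in> layer G (f \<in> y)"
      "x = y - {f} \<union> r" by (rule subst_elemE)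
    obtain z q where z: "z \<in> subst_elem Z a W" "q \<in> layer F (a \<in> z)" "y = z - {a} \<union> q"
      using y(1) by (rule subst_elemE)
    obtain p v where pv: "p \<in> Z" "v \<in> layer W (a \<in> p)" "z = p - {a} \<union> v"
      using z(1) by (rule subst_elemE)
    obtain b c where bc: "v = w b c" "R b c (a \<in> p)" using pv(2) unfolding W w_def by blast
    note p = pv(1) pv(3)[unfolded bc(1)]
    have sub: "p \<subseteq> E" "q \<subseteq> A" using p(1) Z layer_subset[OF F z(2)] by auto
    have q: "q \<in> layer F b" using z(2) unfolding p(2) *(3)[OF sub] .
    have r: "r \<in> layer G c" using y(2) unfolding z(3) p(2) *(2)[OF sub] .
    have "q \<union> r \<in> layer K (a \<in> p)" unfolding K using q r bc(2) by blast
    with p(1) have "p - {a} \<union> (q \<union> r) \<in> subst_elem Z a K" by (rule subst_elemI)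
    then show "x \<in> subst_elem Z a K" unfolding y(3) z(3) p(2) *(1)[OF sub] .
  qed
qed

lemma subst_elem_twice_series:
  assumes Z: "Z \<subseteq> Pow E" and F: "F \<subseteq> Pow A" and G: "G \<subseteq> Pow B"
    and disj: "A \<inter> B = {}" "E \<inter> (A \<union> B) = {a}" "a \<in> A" "f \<in> B"
  shows "subst_elem Z a (ser F G) = subst_elem (subst_elem (subst_elem Z a {{a, f}}) a F) f G"
proof (rule subst_elem_twice[OF Z F disj, where R = "\<lambda>b c d. b = d \<and> c = d"])
  show "layer (ser F G) d = {q \<union> r |q r. \<exists>b c. q \<in> layer F b \<and> r \<in> layer G c \<and> b = d \<and> c = d}" for d
    unfolding layer_ser[OF F G disj(1)] unfolding ser_def by simp
  show "layer {{a, f}} d = {(if b then {a} else {}) \<union> (if c then {f} else {}) |b c. b = d \<and> c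
    = d}" for d
    by (cases d) auto
qed

lemma subst_elem_twice_parallel:
  assumes Z: "Z \<subseteq> Pow E" and F: "coset A F" and G: "coset B G"
    and disj: "A \<inter> B = {}" "E \<inter> (A \<union> B) = {a}" "a \<in> A" "f \<in> B"
  shows "subst_elem Z a (par F G) = subst_elem (subst_elem (subst_elem Z a {{a}, {f}}) a F) f G"
proof (rule subst_elem_twice[OF Z cosetD(1)[OF F] disj layer_par[OF F G disj(1)]])
  have "a \<noteq> f" using disj by auto
  then show "layer {{a}, {f}} d = {(if b then {a} else {}) \<union> (if c then {f} else {}) |b c. (b \<noteq> c)
    = d}" for d
    by (cases d) (auto simp: ex_bool_eq symdiffs_two_singles)
qed

lemma cycle_space_subst_elem:
  assumes Z: "cycle_space E Z" and G: "coset B G" and "finite B" and disj: "(E - {a}) \<inter> B = {}"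
  shows "cycle_space (E - {a} \<union> B) (subst_elem Z a G)"
  unfolding cycle_space_def
proof (intro conjI ballI)
  note sub = layer_subset[OF cosetD(1)[OF G]]
  show "finite (E - {a} \<union> B)" using cycle_space_ground[OF Z] assms(3) by simp
  show "subst_elem Z a G \<subseteq> Pow (E - {a} \<union> B)"
  proof (intro subsetI)
    fix x assume "x \<in> subst_elem Z a G"
    then obtain p q where "p \<in> Z" "q \<in> layer G (a \<in> p)" "x = p - {a} \<union> q" by (rule subst_elemE)
    then show "x \<in> Pow (E - {a} \<union> B)" using cycle_space_subset[OF Z, of p] sub[of q] by auto
  qed
  have "{} \<in> layer G False" using empty_in_symdiffs[OF cosetD(2)[OF G]] by simp
  then show "{} \<in> subst_elem Z a G"
    using subst_elemI[OF cycle_space_empty[OF Z], of "{}" G a] by simp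
  fix x y assume "x \<in> subst_elem Z a G" "y \<in> subst_elem Z a G"
  then obtain p q p' q' where *: "p \<in> Z" "q \<in> layer G (a \<in> p)" "x = p - {a} \<union> q"
     "p' \<in> Z" "q' \<in> layer G (a \<in> p')" "y = p' - {a} \<union> q'"
    by (elim subst_elemE)
  have "x \<triangle> y = ((p \<triangle> p') - {a}) \<union> (q \<triangle> q')"
    unfolding *(3,6)
    by (rule symdiff_subst_elem[OF cycle_space_subset[OF Z *(1)] cycle_space_subset[OF Z *(4)]
          sub[OF *(2)] sub[OF *(5)] disj])
  moreover have "q \<triangle> q' \<in> layer G (a \<in> p \<triangle> p')" using symdiff_layer[OF G *(2,5)] by simp
  ultimately show "x \<triangle> y \<in> subst_elem Z a G"
    using subst_elemI[OF cycle_space_symdiff[OF Z *(1,4)]] by simp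
qed

lemma sp_space_cycle_space: "sp_space E Z \<Longrightarrow> cycle_space E Z"
proof (induction rule: sp_space.induct)
  case (base e f)
  have "{e, f} \<triangle> {e, f} = {}" by simp
  then show ?case by (auto simp: cycle_space_def)
next
  case (series E Z e f)
  then have "e \<noteq> f" "(E - {e}) \<inter> {e, f} = {}" "E - {e} \<union> {e, f} = insert f E" by auto
  with cycle_space_subst_elem[OF series.IH net_coset[OF net_ext(1)], of e f e] show ?case by simp
next
  case (parallel E Z e f)
  then have "e \<noteq> f" "(E - {e}) \<inter> {e, f} = {}" "E - {e} \<union> {e, f} = insert f E" by auto
  with cycle_space_subst_elem[OF parallel.IH net_coset[OF net_ext(2)], of e f e] show ?case by simp
qed

text \<open>Common induction step for both compositions: one extension by an element
  \<open>f\<close> of \<open>B\<close>, then the induction hypotheses at \<open>a\<close> and at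
  \<open>f\<close>. Since \<open>E\<close> meets \<open>A \<union> B\<close> only in
  \<open>a\<close>, and \<open>a\<close> is not in \<open>B\<close>, the element \<open>f\<close> is
  new.\<close>

lemma sp_space_subst_elem_twice:
  assumes nets: "net B G" and disj: "A \<inter> B = {}" "E \<inter> (A \<union> B) = {a}" "a \<in> A"
    and IH1: "\<And>a E Z. a \<in> A \<Longrightarrow> sp_space E Z \<Longrightarrow> E \<inter> A = {a} \<Longrightarrow> sp_space (E \<union> A) (subst_elem Z a F)"
    and IH2: "\<And>a E Z. a \<in> B \<Longrightarrow> sp_space E Z \<Longrightarrow> E \<inter> B = {a} \<Longrightarrow> sp_space (E \<union> B) (subst_elem Z a G)"
    and ext: "\<And>f. f \<notin> E \<Longrightarrow> sp_space (insert f E) (Z' f)"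
    and K: "\<And>f. f \<in> B \<Longrightarrow> subst_elem Z a K = subst_elem (subst_elem (Z' f) a F) f G"
  shows "sp_space (E \<union> (A \<union> B)) (subst_elem Z a K)"
proof -
  obtain f where f: "f \<in> B" using net_ground[OF nets] by blast
  have "f \<notin> E" using disj f by auto
  moreover have "insert f E \<inter> A = {a}" using disj f by auto
  ultimately have "sp_space (insert f E \<union> A) (subst_elem (Z' f) a F)"
    using IH1[OF disj(3) ext] by blast
  moreover have "(insert f E \<union> A) \<inter> B = {f}" using disj f by auto
  ultimately have "sp_space (insert f E \<union> A \<union> B) (subst_elem (subst_elem (Z' f) a F) f G)"
    using IH2 f by blast
  moreover have "insert f E \<union> A \<union> B = E \<union> (A \<union> B)" using f by auto
  ultimately show ?thesis using K[OF f] by simp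
qed

text \<open>Each composition in the construction of the network costs one extension, so substitution
  never leaves the series-parallel spaces. The space is generalised because it grows between the two
  uses of the induction hypothesis.\<close>

lemma sp_space_subst_elem:
  assumes "net A F" "a \<in> A" "sp_space E Z" "E \<inter> A = {a}"
  shows "sp_space (E \<union> A) (subst_elem Z a F)"
  using assms
proof (induction arbitrary: a E Z rule: net.induct)
  case (single c)
  then have c: "c = a" by simp
  have "subst_elem Z a {{a}} = Z"
  proof (intro subset_antisym subsetI)
    fix x assume "x \<in> subst_elem Z a {{a}}"
    then obtain p q where *: "p \<in> Z" "q \<in> layer {{a}} (a \<in> p)" "x = p - {a} \<union> q"
      by (rule subst_elemE)
    then have "x = p" by (cases "a \<in> p") auto
    then show "x \<in> Z" using * by simp
  next
    fix x assume x: "x \<in> Z"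
    have "x - {a} \<union> (if a \<in> x then {a} else {}) \<in> subst_elem Z a {{a}}"
      using x by (intro subst_elemI) (simp_all add: layer_def)
    moreover have "x - {a} \<union> (if a \<in> x then {a} else {}) = x" by auto
    ultimately show "x \<in> subst_elem Z a {{a}}" by simp
  qed
  moreover have "E \<union> {a} = E" using single by auto
  ultimately show ?case using single c by simp
next
  case (series A1 F1 A2 F2)
  have a: "a \<in> E" and Z: "Z \<subseteq> Pow E"
    using series.prems(3) sp_space_cycle_space[OF series.prems(2)] by (auto simp: cycle_space_def)
  note nets = series.hyps(1,2)
  note ext = sp_space.series[OF series.prems(2) a]
  show ?case
  proof (cases "a \<in> A1")
    case True
    show ?thesis
      by (rule sp_space_subst_elem_twice[OF nets(2) series.hyps(3) series.prems(3) True series.IH ext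
            subst_elem_twice_series[OF Z cosetD(1)[OF net_coset[OF nets(1)]] cosetD(1)[OF net_coset[OF nets(2)]] series.hyps(3) series.prems(3) True]])
  next
    case False
    \<comment> \<open>The extension keeps the label \<open>a\<close> for the first part, so the two
      parts are exchanged by commutativity.\<close>
    then have a: "a \<in> A2" using series.prems by simp
    have d: "A2 \<inter> A1 = {}" "E \<inter> (A2 \<union> A1) = {a}" using series.hyps series.prems by auto
    have "sp_space (E \<union> (A2 \<union> A1)) (subst_elem Z a (ser F2 F1))"
      by (rule sp_space_subst_elem_twice[OF nets(1) d a series.IH(2,1) ext
            subst_elem_twice_series[OF Z cosetD(1)[OF net_coset[OF nets(2)]] cosetD(1)[OF net_coset[OF nets(1)]] d a]])
    then show ?thesis unfolding ser_commute[of F2 F1] Un_commute[of A2 A1] .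
  qed
next
  case (parallel A1 F1 A2 F2)
  have a: "a \<in> E" and Z: "Z \<subseteq> Pow E"
    using parallel.prems(3) sp_space_cycle_space[OF parallel.prems(2)]
      by (auto simp: cycle_space_def)
  note nets = parallel.hyps(1,2)
  note ext = sp_space.parallel[OF parallel.prems(2) a]
  show ?case
  proof (cases "a \<in> A1")
    case True
    show ?thesis
      by (rule sp_space_subst_elem_twice[OF nets(2) parallel.hyps(3) parallel.prems(3) True parallel.IH ext
            subst_elem_twice_parallel[OF Z net_coset[OF nets(1)] net_coset[OF nets(2)] parallel.hyps(3) parallel.prems(3) True]])
  next
    case False
    then have a: "a \<in> A2" using parallel.prems by simp
    have d: "A2 \<inter> A1 = {}" "E \<inter> (A2 \<union> A1) = {a}" using parallel.hyps parallel.prems by auto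
    have "sp_space (E \<union> (A2 \<union> A1)) (subst_elem Z a (par F2 F1))"
      by (rule sp_space_subst_elem_twice[OF nets(1) d a parallel.IH(2,1) ext
            subst_elem_twice_parallel[OF Z net_coset[OF nets(2)] net_coset[OF nets(1)] d a]])
    then show ?thesis unfolding par_commute[of F2 F1] Un_commute[of A2 A1] .
  qed
qed

text \<open>The network replaces one of two parallel edges; any \<open>a \<in> A\<close> can serve
  as the label of that edge.\<close>

lemma sp_space_rooted:
  assumes F: "net A F" and e: "e \<notin> A"
  shows "sp_space (insert e A) (rooted e F)"
proof -
  obtain a where a: "a \<in> A" using net_ground[OF F] by blast
  have ea: "e \<noteq> a" using a e by auto
  have "{e, a} \<inter> A = {a}" using a e by auto
  with sp_space_subst_elem[OF F a base[OF ea]]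
  have "sp_space ({e, a} \<union> A) (subst_elem {{}, {e, a}} a F)" by simp
  moreover have "{e, a} \<union> A = insert e A" using a by auto
  moreover have "subst_elem {{}, {e, a}} a F = rooted e F"
  proof (intro subset_antisym subsetI)
    fix x assume "x \<in> subst_elem {{}, {e, a}} a F"
    then obtain p q where p: "p \<in> {{}, {e, a}}" and q: "q \<in> layer F (a \<in> p)" "x = p - {a} \<union> q"
      by (rule subst_elemE)
    have "{e, a} - {a} = {e}" using ea by auto
    from p consider "p = {}" | "p = {e, a}" by blast
    then show "x \<in> rooted e F"
      using q \<open>{e, a} - {a} = {e}\<close> by cases (simp_all add: rooted_def)
  next
    fix x assume "x \<in> rooted e F"
    then consider "x \<in> symdiffs F" | q where "q \<in> F" "x = insert e q" by (auto simp: rooted_def)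
    then show "x \<in> subst_elem {{}, {e, a}} a F"
    proof cases
      case 1
      then show ?thesis using subst_elemI[of "{}" "{{}, {e, a}}" x F a] by simp
    next
      case 2
      have "{e, a} - {a} = {e}" using ea by auto
      with 2 show ?thesis using subst_elemI[of "{e, a}" "{{}, {e, a}}" q F a] by simp
    qed
  qed
  ultimately show ?thesis by simp
qed

text \<open>Once some member \<open>D\<close> passes through \<open>e\<close>, each member
  \<open>x\<close> avoiding \<open>e\<close> is the sum of \<open>x \<triangle> D\<close> and
  \<open>D\<close>, both through \<open>e\<close>. For graphs the assumption says that
  \<open>e\<close> is not a bridge.\<close>

lemma symdiffs_link:
  assumes Z: "cycle_space E Z" and ne: "link Z e \<noteq> {}"
  shows "symdiffs (link Z e) = {D \<in> Z. e \<notin> D}"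
proof (intro subset_antisym subsetI)
  fix x assume "x \<in> symdiffs (link Z e)"
  then obtain C D where *: "C \<in> Z" "e \<in> C" "D \<in> Z" "e \<in> D" "x = (C - {e}) \<triangle> (D - {e})"
    by (elim symdiffsE linkE) blast
  then have "x = C \<triangle> D" by auto
  then show "x \<in> {D \<in> Z. e \<notin> D}" using * cycle_space_symdiff[OF Z *(1,3)] by simp
next
  fix x assume x: "x \<in> {D \<in> Z. e \<notin> D}"
  obtain D where D: "D \<in> Z" "e \<in> D" using ne unfolding link_def by blast
  have "x \<triangle> D \<in> Z" using cycle_space_symdiff[OF Z] x D by simp
  then have "(x \<triangle> D) - {e} \<in> link Z e" using x D by (intro linkI) simp_all
  moreover have "D - {e} \<in> link Z e" using D by (rule linkI)
  moreover have "x = ((x \<triangle> D) - {e}) \<triangle> (D - {e})" using x by auto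
  ultimately show "x \<in> symdiffs (link Z e)" by (metis symdiffsI)
qed

lemma rooted_link:
  assumes Z: "cycle_space E Z" and ne: "link Z e \<noteq> {}"
  shows "rooted e (link Z e) = Z"
proof -
  have "insert e ` link Z e = {D \<in> Z. e \<in> D}"
    by (auto simp: insert_absorb elim!: linkE intro!: image_eqI[OF _ linkI])
  then show ?thesis unfolding rooted_def symdiffs_link[OF assms] by blast
qed

lemma link_rooted:
  assumes "F \<subseteq> Pow A" "e \<notin> A"
  shows "link (rooted e F) e = F"
proof (intro subset_antisym subsetI)
  fix p assume "p \<in> link (rooted e F) e"
  then obtain D where D: "D \<in> rooted e F" "e \<in> D" "p = D - {e}" by (rule linkE)
  have "D \<notin> symdiffs F" using D(2) assms layer_subset[OF assms(1), of D False] by auto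
  then obtain q where q: "q \<in> F" "D = insert e q" using D(1) by (auto simp: rooted_def)
  then have "e \<notin> q" using assms by auto
  then show "p \<in> F" using D(3) q by simp
next
  fix p assume p: "p \<in> F"
  then have "insert e p - {e} \<in> link (rooted e F) e" by (intro linkI) (auto simp: rooted_def)
  moreover have "insert e p - {e} = p" using p assms by auto
  ultimately show "p \<in> link (rooted e F) e" by simp
qed

lemma link_subst_elem:
  assumes G: "G \<subseteq> Pow B" and "x \<noteq> a" "x \<notin> B"
  shows "link (subst_elem Z a G) x = subst_elem (link Z x) a G"
proof (intro subset_antisym subsetI)
  fix y assume "y \<in> link (subst_elem Z a G) x"
  then obtain p q where *: "p \<in> Z" "q \<in> layer G (a \<in> p)" "x \<in> p - {a} \<union> q" "y = (p - {a} \<union> q) - {x}"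
    by (elim linkE subst_elemE) blast
  have "x \<notin> q" using layer_subset[OF G *(2)] assms by auto
  then have "x \<in> p" "y = (p - {x}) - {a} \<union> q" using * by auto
  moreover have "q \<in> layer G (a \<in> p - {x})" using * assms by simp
  ultimately show "y \<in> subst_elem (link Z x) a G" using subst_elemI[OF linkI[OF *(1)]] by simp
next
  fix y assume "y \<in> subst_elem (link Z x) a G"
  then obtain p q where *: "p \<in> Z" "x \<in> p" "q \<in> layer G (a \<in> p - {x})" "y = ((p - {x}) - {a}) \<union> q"
    by (elim linkE subst_elemE) blast
  have "x \<notin> q" using layer_subset[OF G *(3)] assms by auto
  then have "y = (p - {a} \<union> q) - {x}" using * by auto
  moreover have "q \<in> layer G (a \<in> p)" using * assms by simp
  ultimately show "y \<in> link (subst_elem Z a G) x"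
    using linkI[OF subst_elemI[OF *(1)], of q G a x] * assms by simp
qed

section \<open>Links under a single extension\<close>

lemma subst_elem_series_pair:
  assumes "e \<noteq> f"
  shows "subst_elem Z e {{e, f}} = {p \<in> Z. e \<notin> p} \<union> insert f ` {p \<in> Z. e \<in> p}" (is "?L = ?R")
proof (intro subset_antisym subsetI)
  fix x assume "x \<in> ?L"
  then obtain p q where "p \<in> Z" "q \<in> layer {{e, f}} (e \<in> p)" "x = p - {e} \<union> q" by (rule subst_elemE)
  then show "x \<in> ?R" by (cases "e \<in> p") auto
next
  fix x assume "x \<in> ?R"
  then consider "x \<in> Z" "e \<notin> x" | p where "p \<in> Z" "e \<in> p" "x = insert f p" by auto
  then show "x \<in> ?L"
  proof cases
    case 1
    then show ?thesis using subst_elemI[of x Z "{}" "{{e, f}}" e] by simp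
  next
    case 2
    then have "x = p - {e} \<union> {e, f}" by auto
    then show ?thesis using 2 subst_elemI[of p Z "{e, f}" "{{e, f}}" e] by simp
  qed
qed

lemma subst_elem_parallel_pair:
  assumes "e \<noteq> f"
  shows "subst_elem Z e {{e}, {f}} = Z \<union> (\<lambda>p. insert f (p - {e})) ` {p \<in> Z. e \<in> p}
     \<union> (\<lambda>p. p \<union> {e, f}) ` {p \<in> Z. e \<notin> p}" (is "?L = ?R")
proof (intro subset_antisym subsetI)
  fix x assume "x \<in> ?L"
  then obtain p q where p: "p \<in> Z" "q \<in> layer {{e}, {f}} (e \<in> p)" "x = p - {e} \<union> q"
    by (rule subst_elemE)
  then consider "e \<in> p" "q = {e}" | "e \<in> p" "q = {f}" | "e \<notin> p" "q = {}" | "e \<notin> p" "q = {e, f}"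
    by (cases "e \<in> p") (simp_all add: symdiffs_two_singles assms, blast+)
  then show "x \<in> ?R"
  proof cases
    case 1 then show ?thesis using p by (simp add: insert_absorb)
  next
    case 2 then show ?thesis using p by simp
  next
    case 3 then show ?thesis using p by simp
  next
    case 4 then show ?thesis using p by simp
  qed
next
  fix x assume "x \<in> ?R"
  then consider "x \<in> Z" "e \<notin> x" | "x \<in> Z" "e \<in> x" | p where "p \<in> Z" "e \<in> p" "x = insert f (p - {e})"
    | p where "p \<in> Z" "e \<notin> p" "x = p \<union> {e, f}" by auto
  then show "x \<in> ?L"
  proof cases
    case 1
    then show ?thesis using subst_elemI[of x Z "{}" "{{e}, {f}}" e]
      by (simp add: symdiffs_two_singles assms)
  next
    case 2
    then show ?thesis using subst_elemI[of x Z "{e}" "{{e}, {f}}" e] by (simp add: insert_absorb)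
  next
    case 3
    then show ?thesis using subst_elemI[of p Z "{f}" "{{e}, {f}}" e] by simp
  next
    case 4
    then show ?thesis using subst_elemI[of p Z "{e, f}" "{{e}, {f}}" e]
      by (simp add: symdiffs_two_singles assms)
  qed
qed

text \<open>Rooting at either half of a subdivided edge leaves the other half in series with the old
  network.\<close>

lemma link_subst_elem_series:
  assumes Z: "cycle_space E Z" and ef: "e \<in> E" "f \<notin> E"
  shows "link (subst_elem Z e {{e, f}}) e = ser (link Z e) {{f}}"
    and "link (subst_elem Z e {{e, f}}) f = ser (link Z e) {{e}}"
proof -
  have "e \<noteq> f" using ef by auto
  note S = subst_elem_series_pair[OF \<open>e \<noteq> f\<close>, of Z]
  have ser: "ser F {{c}} = insert c ` F" for F :: "'a set set" and c unfolding ser_def by auto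
  have L: "link Z e = (\<lambda>p. p - {e}) ` {p \<in> Z. e \<in> p}" unfolding link_def by auto
  have nf: "f \<notin> p" if "p \<in> Z" for p using cycle_space_subset[OF Z that] ef by auto
  have "link (subst_elem Z e {{e, f}}) e = (\<lambda>p. p - {e}) ` insert f ` {p \<in> Z. e \<in> p}"
    unfolding S link_def using \<open>e \<noteq> f\<close> by auto
  then show "link (subst_elem Z e {{e, f}}) e = ser (link Z e) {{f}}"
    unfolding ser L image_image using \<open>e \<noteq> f\<close> by (simp add: insert_Diff_if)
  have "link (subst_elem Z e {{e, f}}) f = (\<lambda>p. p - {f}) ` insert f ` {p \<in> Z. e \<in> p}"
    unfolding S link_def using nf by auto
  then show "link (subst_elem Z e {{e, f}}) f = ser (link Z e) {{e}}"
    unfolding ser L image_image using nf by (auto simp: insert_absorb)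
qed

text \<open>The dual situation, with the other copy now in parallel. By \<open>ne\<close> the even
  layer of the link consists of the members avoiding \<open>e\<close>, which are the sets that the
  new one-element path completes.\<close>

lemma link_subst_elem_parallel:
  assumes Z: "cycle_space E Z" and ef: "e \<in> E" "f \<notin> E" and ne: "link Z e \<noteq> {}"
  shows "link (subst_elem Z e {{e}, {f}}) e = par (link Z e) {{f}}"
    and "link (subst_elem Z e {{e}, {f}}) f = par (link Z e) {{e}}"
proof -
  have "e \<noteq> f" using ef by auto
  note S = subst_elem_parallel_pair[OF \<open>e \<noteq> f\<close>, of Z]
  have par: "par (link Z e) {{c}} = link Z e \<union> insert c ` {p \<in> Z. e \<notin> p}" for c
    unfolding par_def by (auto simp: ex_bool_eq symdiffs_link[OF Z ne])
  have L: "link Z e = (\<lambda>p. p - {e}) ` {p \<in> Z. e \<in> p}" unfolding link_def by auto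
  have nf: "f \<notin> p" if "p \<in> Z" for p using cycle_space_subset[OF Z that] ef by auto
  have U: "link (subst_elem Z e {{e}, {f}}) x
    = link Z x \<union> (\<lambda>p. insert f (p - {e}) - {x}) ` {p \<in> Z. e \<in> p \<and> x \<in> insert f (p - {e})}
      \<union> (\<lambda>p. p \<union> {e, f} - {x}) ` {p \<in> Z. e \<notin> p \<and> x \<in> p \<union> {e, f}}" for x
    unfolding S link_def by blast
  have none: "{p \<in> Z. e \<in> p \<and> e \<in> insert f (p - {e})} = {}" "link Z f = {}"
    using \<open>e \<noteq> f\<close> nf unfolding link_def by auto
  have "(\<lambda>p. p \<union> {e, f} - {e}) ` {p \<in> Z. e \<notin> p \<and> e \<in> p \<union> {e, f}} = insert f ` {p \<in> Z. e \<notin> p}"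
    using \<open>e \<noteq> f\<close> by (intro image_cong) auto
  then show "link (subst_elem Z e {{e}, {f}}) e = par (link Z e) {{f}}" unfolding par U none by simp
  have "(\<lambda>p. insert f (p - {e}) - {f}) ` {p \<in> Z. e \<in> p \<and> f \<in> insert f (p - {e})} = link Z e"
    unfolding L using nf by (intro image_cong) auto
  moreover have "(\<lambda>p. p \<union> {e, f} - {f}) ` {p \<in> Z. e \<notin> p \<and> f \<in> p \<union> {e, f}}
    = insert e ` {p \<in> Z. e \<notin> p}"
    using \<open>e \<noteq> f\<close> nf by (intro image_cong) auto
  ultimately show "link (subst_elem Z e {{e}, {f}}) f = par (link Z e) {{e}}" unfolding par U none
    by simp
qed

text \<open>The root is arbitrary in the induction. If \<open>x\<close> is one of the two elements
  of the last extension, the hypothesis at \<open>e\<close> is combined with the other element;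
  otherwise the extension happens inside the network, and \<open>net_subst_elem\<close>
  applies.\<close>

lemma net_link: "sp_space E Z \<Longrightarrow> x \<in> E \<Longrightarrow> net (E - {x}) (link Z x)"
proof (induction arbitrary: x rule: sp_space.induct)
  case (base e f)
  have "link {{}, {e, f}} x = {{e, f} - {x}}" using base unfolding link_def by auto
  moreover have "{e, f} - {x} = {if x = e then f else e}" using base by auto
  ultimately show ?case using net.single by metis
next
  case (series E Z e f)
  have ef: "e \<noteq> f" using series by auto
  have Z: "cycle_space E Z" using series.hyps(1) by (rule sp_space_cycle_space)
  have sing: "net (E - {e} \<union> {c}) (ser (link Z e) {{c}})" if "c \<in> {e, f}" for c
    using series.IH[OF series.hyps(2)] net.single
      by (rule net.series) (use that series.hyps in auto)
  consider "x = e" | "x = f" | "x \<in> E" "x \<noteq> e" "x \<noteq> f" using series.prems by auto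
  then show ?case
  proof cases
    case 1
    then have "insert f E - {x} = E - {e} \<union> {f}" using ef by auto
    with 1 sing[of f] show ?thesis by (simp add: link_subst_elem_series[OF Z series.hyps(2,3)])
  next
    case 2
    then have "insert f E - {x} = E - {e} \<union> {e}" using ef series.hyps by auto
    with 2 sing[of e] show ?thesis by (simp add: link_subst_elem_series[OF Z series.hyps(2,3)])
  next
    case 3
    have "insert f E - {x} = (E - {x}) - {e} \<union> {e, f}" using 3 series.hyps by auto
    moreover have "net ((E - {x}) - {e} \<union> {e, f}) (subst_elem (link Z x) e {{e, f}})"
      using 3 series.hyps by (intro net_subst_elem[OF series.IH net_ext(1)] ef) auto
    moreover have "link (subst_elem Z e {{e, f}}) x = subst_elem (link Z x) e {{e, f}}"
      using 3 by (intro link_subst_elem[of _ "{e, f}"]) auto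
    ultimately show ?thesis by simp
  qed
next
  case (parallel E Z e f)
  have ef: "e \<noteq> f" using parallel by auto
  have Z: "cycle_space E Z" using parallel.hyps(1) by (rule sp_space_cycle_space)
  have ne: "link Z e \<noteq> {}" using net_nonempty[OF parallel.IH[OF parallel.hyps(2)]] .
  have sing: "net (E - {e} \<union> {c}) (par (link Z e) {{c}})" if "c \<in> {e, f}" for c
    using parallel.IH[OF parallel.hyps(2)] net.single
      by (rule net.parallel) (use that parallel.hyps in auto)
  consider "x = e" | "x = f" | "x \<in> E" "x \<noteq> e" "x \<noteq> f" using parallel.prems by auto
  then show ?case
  proof cases
    case 1
    then have "insert f E - {x} = E - {e} \<union> {f}" using ef by auto
    with 1 sing[of f] show ?thesis
      by (simp add: link_subst_elem_parallel[OF Z parallel.hyps(2,3) ne])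
  next
    case 2
    then have "insert f E - {x} = E - {e} \<union> {e}" using ef parallel.hyps by auto
    with 2 sing[of e] show ?thesis
      by (simp add: link_subst_elem_parallel[OF Z parallel.hyps(2,3) ne])
  next
    case 3
    have "insert f E - {x} = (E - {x}) - {e} \<union> {e, f}" using 3 parallel.hyps by auto
    moreover have "net ((E - {x}) - {e} \<union> {e, f}) (subst_elem (link Z x) e {{e}, {f}})"
      using 3 parallel.hyps by (intro net_subst_elem[OF parallel.IH net_ext(2)] ef) auto
    moreover have "link (subst_elem Z e {{e}, {f}}) x = subst_elem (link Z x) e {{e}, {f}}"
      using 3 by (intro link_subst_elem[of _ "{e, f}"]) auto
    ultimately show ?thesis by simp
  qed
qed

section \<open>Cycle spaces of series-parallel graphs\<close>

text \<open>Extensions of a 2-cycle never create loops, and two distinct ends per edge make the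
  degree parity a plain count of incident edges; a loop would be counted only once.\<close>

definition loopless_graph :: "('v, 'e) multigraph \<Rightarrow> bool" where
  "loopless_graph G \<longleftrightarrow> finite (verts G) \<and> finite (edges G) \<and>
     (\<forall>e\<in>edges G. ends G e \<subseteq> verts G \<and> card (ends G e) = 2)"

lemma loopless_graphD:
  "loopless_graph G \<Longrightarrow> finite (verts G)" "loopless_graph G \<Longrightarrow> finite (edges G)"
  "loopless_graph G \<Longrightarrow> e \<in> edges G \<Longrightarrow> ends G e \<subseteq> verts G"
  "loopless_graph G \<Longrightarrow> e \<in> edges G \<Longrightarrow> card (ends G e) = 2"
  unfolding loopless_graph_def by blast+

definition cycle_sets :: "('v, 'e) multigraph \<Rightarrow> 'e set set" where
  "cycle_sets G = {D. D \<subseteq> edges G \<and> (\<forall>v. even (card {e \<in> D. v \<in> ends G e}))}"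

lemma sum_Suc_mod: "(\<Sum>i<n. f (Suc i mod n)) = (\<Sum>i<n. f i :: nat)"
proof (cases n)
  case (Suc m)
  have "(\<Sum>i<Suc m. f (Suc i mod Suc m)) = (\<Sum>i<m. f (Suc i)) + f 0"
    by simp
  also have "\<dots> = (\<Sum>i<Suc m. f i)" by (subst sum.lessThan_Suc_shift) simp
  finally show ?thesis using Suc by simp
qed simp

text \<open>Around a cycle each vertex is the start of one edge and the end of one edge, so every
  degree is twice a vertex count. \<open>sum_Suc_mod\<close> performs the cyclic shift between
  starts and ends.\<close>

lemma cycle_edges_in_cycle_sets:
  assumes G: "loopless_graph G" and C: "cycle_edges G C"
  shows "C \<in> cycle_sets G" "C \<noteq> {}"
proof -
  obtain vs es where *: "es \<noteq> []" "length vs = length es" "distinct vs" "distinct es"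
     "set es \<subseteq> edges G" "C = set es"
     "\<And>i. i < length es \<Longrightarrow> ends G (es ! i) = {vs ! i, vs ! (Suc i mod length es)}"
    using C unfolding cycle_edges_def by blast
  let ?n = "length es"
  show "C \<noteq> {}" using * by simp
  have "even (card {e \<in> C. v \<in> ends G e})" for v
  proof -
    have "card {e \<in> C. v \<in> ends G e} = (\<Sum>e\<in>set es. of_bool (v \<in> ends G e))"
      using *(6) by (simp add: sum_of_bool_eq Collect_conj_eq)
    also have "\<dots> = (\<Sum>i<?n. of_bool (v \<in> ends G (es ! i)))"
      using bij_betw_nth[OF *(4) refl refl] by (rule sum.reindex_bij_betw[symmetric])
    also have "\<dots> = (\<Sum>i<?n. of_bool (v = vs ! i) + of_bool (v = vs ! (Suc i mod ?n)))"
    proof (rule sum.cong[OF refl])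
      fix i assume "i \<in> {..<?n}"
      then have i: "i < ?n" by simp
      then have "es ! i \<in> edges G" using *(5) nth_mem by blast
      then have "card {vs ! i, vs ! (Suc i mod ?n)} = 2"
        using loopless_graphD(4)[OF G, of "es ! i"] *(7)[OF i] by simp
      then have "vs ! i \<noteq> vs ! (Suc i mod ?n)" by auto
      then show "of_bool (v \<in> ends G (es ! i)) = (of_bool (v = vs ! i) + of_bool (v
        = vs ! (Suc i mod ?n)) :: nat)"
        using *(7)[OF i] by auto
    qed
    also have "\<dots> = 2 * (\<Sum>i<?n. of_bool (v = vs ! i))"
      using sum_Suc_mod[of "\<lambda>i. of_bool (v = vs ! i)" ?n] by (simp add: sum.distrib)
    finally show ?thesis by simp
  qed
  then show "C \<in> cycle_sets G" using *(5,6) by (simp add: cycle_sets_def)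
qed

definition edge_path :: "('v, 'e) multigraph \<Rightarrow> 'e set \<Rightarrow> 'v list \<Rightarrow> 'e list \<Rightarrow> bool" where
  "edge_path G D vs es \<longleftrightarrow> length vs = Suc (length es) \<and> distinct vs \<and>
     (\<forall>i<length es. es ! i \<in> D \<and> ends G (es ! i) = {vs ! i, vs ! Suc i})"

lemma edge_path_verts:
  assumes G: "loopless_graph G" and D: "D \<subseteq> edges G" and P: "edge_path G D vs es" and ne: "es \<noteq> []"
  shows "set vs \<subseteq> verts G"
proof
  fix v assume "v \<in> set vs"
  then obtain i where i: "i < length vs" "v = vs ! i" by (metis in_set_conv_nth)
  have len: "length vs = Suc (length es)" using P by (simp add: edge_path_def)
  have sub: "{vs ! j, vs ! Suc j} \<subseteq> verts G" if "j < length es" for j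
  proof -
    have "es ! j \<in> edges G" "ends G (es ! j) = {vs ! j, vs ! Suc j}"
      using P D that unfolding edge_path_def by blast+
    then show ?thesis using loopless_graphD(3)[OF G, of "es ! j"] by simp
  qed
  show "v \<in> verts G"
  proof (cases "i < length es")
    case True
    then show ?thesis using sub[OF True] i by simp
  next
    case False
    then obtain j where j: "i = Suc j" "j < length es" using i len ne by (cases i) auto
    then show ?thesis using sub[OF j(2)] i by simp
  qed
qed

lemma edge_path_distinct:
  assumes "edge_path G D vs es"
  shows "distinct es"
  unfolding distinct_conv_nth
proof (intro allI impI notI)
  fix a b assume ab: "a < length es" "b < length es" "a \<noteq> b" and eq: "es ! a = es ! b"
  have len: "length vs = Suc (length es)" and dist: "distinct vs" using assms
    by (simp_all add: edge_path_def)
  have "{vs ! a, vs ! Suc a} = {vs ! b, vs ! Suc b}" using assms ab eq unfolding edge_path_def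
    by metis
  then have "vs ! a = vs ! b \<or> vs ! a = vs ! Suc b \<and> vs ! Suc a = vs ! b"
    by (auto simp: doubleton_eq_iff)
  then show False using dist len ab by (auto simp: nth_eq_iff_index_eq)
qed

text \<open>Longest path argument: the first vertex of a longest path inside \<open>D\<close> has
  even degree, hence a second edge in \<open>D\<close>; maximality forces the other end of that edge
  onto the path, and a cycle closes.\<close>

lemma cycle_sets_contain_cycle:
  assumes G: "loopless_graph G" and D: "D \<in> cycle_sets G" and "D \<noteq> {}"
  shows "\<exists>C\<subseteq>D. cycle_edges G C"
proof -
  have DE: "D \<subseteq> edges G" and ev: "\<And>v. even (card {e \<in> D. v \<in> ends G e})"
    using D by (simp_all add: cycle_sets_def)
  have two: "card (ends G e) = 2" if "e \<in> D" for e using loopless_graphD(4)[OF G] that DE by blast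
  define L where "L = {n. \<exists>vs es. edge_path G D vs es \<and> length es = n \<and> es \<noteq> []}"
  have bound: "n \<le> card (verts G)" if n: "n \<in> L" for n
  proof -
    obtain vs es where P: "edge_path G D vs es" "length es = n" "es \<noteq> []" using n
      by (auto simp: L_def)
    have "card (set vs) \<le> card (verts G)"
      using edge_path_verts[OF G DE P(1,3)] G
        by (intro card_mono) (simp_all add: loopless_graph_def)
    moreover have "card (set vs) = Suc n" using P by (simp add: edge_path_def distinct_card)
    ultimately show ?thesis by simp
  qed
  then have finL: "finite L" by (meson finite_nat_set_iff_bounded_le)
  obtain e0 where e0: "e0 \<in> D" using \<open>D \<noteq> {}\<close> by blast
  obtain u v where uv: "ends G e0 = {u, v}" "u \<noteq> v" using two[OF e0] by (meson card_2_iff)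
  have "edge_path G D [u, v] [e0]" using e0 uv by (simp add: edge_path_def)
  then have "1 \<in> L" unfolding L_def by (intro CollectI exI[of _ "[u, v]"] exI[of _ "[e0]"]) simp
  then have "Max L \<in> L" using finL by (intro Max_in) auto
  then obtain vs es where P: "edge_path G D vs es" "length es = Max L" "es \<noteq> []"
    by (auto simp: L_def)
  have len: "length vs = Suc (length es)" and dist: "distinct vs"
    and step: "\<And>i. i < length es \<Longrightarrow> es ! i \<in> D \<and> ends G (es ! i) = {vs ! i, vs ! Suc i}"
    using P(1) by (simp_all add: edge_path_def)
  define v0 where "v0 = vs ! 0"
  have len0: "0 < length es" using P(3) by simp
  have first: "es ! 0 \<in> {e \<in> D. v0 \<in> ends G e}" using step[OF len0] by (simp add: v0_def)
  have "{e \<in> D. v0 \<in> ends G e} \<noteq> {es ! 0}" using ev[of v0] by auto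
  then obtain e' where e': "e' \<in> D" "v0 \<in> ends G e'" "e' \<noteq> es ! 0" using first by blast
  obtain x y where xy: "ends G e' = {x, y}" "x \<noteq> y" using two[OF e'(1)] by (meson card_2_iff)
  define w where "w = (if v0 = x then y else x)"
  have w: "ends G e' = {v0, w}" "w \<noteq> v0" using xy e'(2) by (auto simp: w_def)
  have "w \<in> set vs"
  proof (rule ccontr)
    assume nw: "w \<notin> set vs"
    have "edge_path G D (w # vs) (e' # es)"
      unfolding edge_path_def
    proof (intro conjI allI impI)
      show "length (w # vs) = Suc (length (e' # es))" using len by simp
      show "distinct (w # vs)" using dist nw by simp
      fix i assume i: "i < length (e' # es)"
      show "(e' # es) ! i \<in> D" using e'(1) step i by (cases i) simp_all
      show "ends G ((e' # es) ! i) = {(w # vs) ! i, (w # vs) ! Suc i}"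
        using w step i by (cases i) (auto simp: v0_def)
    qed
    then have "length (e' # es) \<in> L" unfolding L_def
      by (intro CollectI exI[of _ "w # vs"] exI[of _ "e' # es"]) simp
    then have "length (e' # es) \<le> Max L" by (rule Max_ge[OF finL])
    then show False using P(2) by simp
  qed
  then obtain j where j: "j < length vs" "w = vs ! j" by (metis in_set_conv_nth)
  have jl: "j \<le> length es" using j(1) len by simp
  \<comment> \<open>The cycle is the initial segment of the path up to \<open>w = vs ! j\<close>,
    closed by \<open>e'\<close>.\<close>
  let ?vs = "take (Suc j) vs" and ?es = "take j es @ [e']"
  have lens: "length ?vs = Suc j" "length ?es = Suc j" using j jl by simp_all
  have "e' \<notin> set (take j es)"
  proof
    assume "e' \<in> set (take j es)"
    then obtain i where i: "i < j" "i < length es" "e' = es ! i" by (auto simp: in_set_conv_nth)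
    \<comment> \<open>Apart from its first edge, no edge of the path meets \<open>v0\<close>,
      because the vertices are distinct; so \<open>e'\<close> does not occur on the path.\<close>
    then have "i \<noteq> 0" using e'(3) by (intro notI) simp
    have "v0 \<in> {vs ! i, vs ! Suc i}" using e'(2) step[OF i(2)] i(3) by simp
    then show False using \<open>i \<noteq> 0\<close> dist len i(2) by (auto simp: v0_def nth_eq_iff_index_eq)
  qed
  then have dist_es: "distinct ?es" using edge_path_distinct[OF P(1)] by simp
  have sub: "set ?es \<subseteq> D"
  proof
    fix e assume "e \<in> set ?es"
    then consider "e = e'" | i where "i < length es" "e = es ! i" by (auto simp: in_set_conv_nth)
    then show "e \<in> D" using e'(1) step by cases simp_all
  qed
  have "cycle_edges G (set ?es)"
    unfolding cycle_edges_def
  proof (intro exI[of _ ?vs] exI[of _ ?es] conjI allI impI)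
    show "?es \<noteq> []" by simp
    show "length ?vs = length ?es" using lens by simp
    show "distinct ?vs" using dist by simp
    show "distinct ?es" by (rule dist_es)
    show "set ?vs \<subseteq> verts G" using edge_path_verts[OF G DE P(1,3)] set_take_subset
      by (rule subset_trans[rotated])
    show "set ?es \<subseteq> edges G" using sub DE by (rule subset_trans)
    show "set ?es = set ?es" by (rule refl)
    fix i assume "i < length ?es"
    then consider "i < j" | "i = j" using lens(2) by linarith
    then show "ends G (?es ! i) = {?vs ! i, ?vs ! (Suc i mod length ?es)}"
    proof cases
      case 1
      then have "Suc i mod length ?es = Suc i" using lens(2) by simp
      moreover have "?es ! i = es ! i" using 1 jl by (simp add: nth_append)
      ultimately show ?thesis using step[of i] 1 jl by simp
    next
      case 2
      then have "Suc i mod length ?es = 0" using lens(2) by simp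
      moreover have "?es ! i = e'" using 2 jl by (simp add: nth_append)
      ultimately show ?thesis using w(1) j 2 by (simp add: v0_def insert_commute)
    qed
  qed
  then show ?thesis using sub by blast
qed

lemma cycle_matroid_binary:
  assumes G: "loopless_graph G"
  shows "cycle_matroid G = binary_matroid (edges G) (cycle_sets G)"
proof -
  have "(\<nexists>C. C \<subseteq> I \<and> cycle_edges G C) \<longleftrightarrow> (\<nexists>D. D \<in> cycle_sets G \<and> D \<noteq> {} \<and> D \<subseteq> I)" for I
  proof
    assume no: "\<nexists>C. C \<subseteq> I \<and> cycle_edges G C"
    show "\<nexists>D. D \<in> cycle_sets G \<and> D \<noteq> {} \<and> D \<subseteq> I"
    proof
      assume "\<exists>D. D \<in> cycle_sets G \<and> D \<noteq> {} \<and> D \<subseteq> I"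
      then obtain D where D: "D \<in> cycle_sets G" "D \<noteq> {}" "D \<subseteq> I" by blast
      obtain C where "C \<subseteq> D" "cycle_edges G C" using cycle_sets_contain_cycle[OF G D(1,2)] by blast
      then show False using no D(3) by blast
    qed
  next
    assume "\<nexists>D. D \<in> cycle_sets G \<and> D \<noteq> {} \<and> D \<subseteq> I"
    then show "\<nexists>C. C \<subseteq> I \<and> cycle_edges G C" using cycle_edges_in_cycle_sets[OF G] by blast
  qed
  then show ?thesis unfolding cycle_matroid_def binary_matroid_def by simp
qed

section \<open>Graph extensions on the level of even edge sets\<close>

lemma card_filter_pair:
  assumes "finite D" "e \<noteq> f"
  shows "card {g \<in> D. P g} = card {g \<in> D - {e, f}. P g} + of_bool (e \<in> D \<and> P e) + of_bool (f \<in> D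
    \<and> P f)"
proof -
  let ?A = "{g \<in> D - {e, f}. P g}"
  have fin: "finite ?A" using assms(1) by simp
  have notin: "e \<notin> ?A" "f \<notin> ?A" by simp_all
  consider "e \<in> D \<and> P e" "f \<in> D \<and> P f" | "e \<in> D \<and> P e" "\<not> (f \<in> D \<and> P f)"
    | "\<not> (e \<in> D \<and> P e)" "f \<in> D \<and> P f" | "\<not> (e \<in> D \<and> P e)" "\<not> (f \<in> D \<and> P f)" by blast
  then show ?thesis
  proof cases
    case 1
    then have eq: "{g \<in> D. P g} = insert e (insert f ?A)" by auto
    show ?thesis unfolding eq using 1 fin notin assms(2) by simp
  next
    case 2
    then have eq: "{g \<in> D. P g} = insert e ?A" by auto
    show ?thesis unfolding eq using 2 fin notin by simp
  next
    case 3
    then have eq: "{g \<in> D. P g} = insert f ?A" by auto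
    show ?thesis unfolding eq using 3 fin notin by simp
  next
    case 4
    then have eq: "{g \<in> D. P g} = ?A" by auto
    show ?thesis unfolding eq using 4 by simp
  qed
qed

text \<open>Only \<open>e\<close> and \<open>f\<close> meet the new vertex \<open>w\<close>, so
  evenness there says that both halves are used or neither. Under this condition all other degrees
  are those of \<open>D - {f}\<close> in \<open>G\<close>.\<close>

lemma loopless_series_extension:
  assumes G: "loopless_graph G" and e: "e \<in> edges G" "ends G e = {u, v}" and w: "w \<notin> verts G"
    and f: "f \<notin> edges G"
    and HG: "H = \<lparr>verts = insert w (verts G), edges = insert f (edges G), ends
      = (ends G)(e := {u, w}, f := {w, v})\<rparr>"
  shows "loopless_graph H" "cycle_sets H = subst_elem (cycle_sets G) e {{e, f}}"
proof -
  have ef: "e \<noteq> f" using e f by auto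
  have endsG: "ends G g \<subseteq> verts G" "card (ends G g) = 2" if "g \<in> edges G" for g
    using loopless_graphD(3,4)[OF G that] .
  have uv: "u \<noteq> v" "u \<in> verts G" "v \<in> verts G" using endsG[OF e(1)] e(2) by auto
  then have uvw: "u \<noteq> w" "v \<noteq> w" using w by auto
  have wG: "w \<notin> ends G g" if "g \<in> edges G" for g using endsG(1)[OF that] w by blast
  have finE: "finite (edges G)" "finite (verts G)" using G by (simp_all add: loopless_graph_def)
  have endsH: "ends H e = {u, w}" "ends H f = {w, v}" "\<And>g. g \<noteq> e \<Longrightarrow> g \<noteq> f \<Longrightarrow> ends H g = ends G g"
    using HG ef by simp_all
  show "loopless_graph H"
    unfolding loopless_graph_def
  proof (intro conjI ballI)
    show "finite (verts H)" "finite (edges H)" using finE HG by simp_all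
    have vH: "verts H = insert w (verts G)" using HG by simp
    fix g assume "g \<in> edges H"
    then consider "g = e" | "g = f" | "g \<noteq> e" "g \<noteq> f" "g \<in> edges G" using HG by auto
    then have "ends H g \<subseteq> verts H \<and> card (ends H g) = 2"
    proof cases
      case 1 then show ?thesis using endsH(1) uv uvw vH by simp
    next
      case 2 then show ?thesis using endsH(2) uv uvw vH by simp
    next
      case 3 then show ?thesis using endsH(3)[OF 3(1,2)] endsG[OF 3(3)] vH by auto
    qed
    then show "ends H g \<subseteq> verts H" "card (ends H g) = 2" by simp_all
  qed
  \<comment> \<open>At \<open>w\<close> the equivalence of \<open>e \<in> D\<close> and
    \<open>f \<in> D\<close> is derived, at all other vertices it is assumed; so the same statement
    serves both directions of \<open>mem\<close>.\<close>
  have parity: "even (card {g \<in> D. x \<in> ends H g}) \<longleftrightarrow>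
      (if x = w then (e \<in> D \<longleftrightarrow> f \<in> D) else even (card {g \<in> D - {f}. x \<in> ends G g}))"
    if D: "D \<subseteq> insert f (edges G)" and iff: "x \<noteq> w \<Longrightarrow> (e \<in> D \<longleftrightarrow> f \<in> D)" for D x
  proof -
    have finD: "finite D" using finite_subset[OF D] finE by simp
    have R: "{g \<in> D - {e, f}. x \<in> ends H g} = {g \<in> D - {e, f}. x \<in> ends G g}" using endsH(3) by auto
    have H: "card {g \<in> D. x \<in> ends H g} = card {g \<in> D - {e, f}. x \<in> ends G g} +
       of_bool (e \<in> D \<and> x \<in> {u, w}) + of_bool (f \<in> D \<and> x \<in> {w, v})"
      using card_filter_pair[OF finD ef, of "\<lambda>g. x \<in> ends H g"] unfolding R endsH(1,2) .
    show ?thesis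
    proof (cases "x = w")
      case True
      have none: "{g \<in> D - {e, f}. x \<in> ends G g} = {}" using True wG D by auto
      show ?thesis using H unfolding none using True by simp
    next
      case False
      have "D - {f} - {e, f} = D - {e, f}" by blast
      then have "card {g \<in> D - {f}. x \<in> ends G g}
        = card {g \<in> D - {e, f}. x \<in> ends G g} + of_bool (e \<in> D \<and> x \<in> {u, v})"
        using card_filter_pair[of "D - {f}" e f "\<lambda>g. x \<in> ends G g"] finD ef e(2) by simp
      note G = this
      have iff': "f \<in> D \<longleftrightarrow> e \<in> D" using iff[OF False] by simp
      have "of_bool (e \<in> D \<and> x \<in> {u, w}) + of_bool (f \<in> D \<and> x \<in> {w, v}) = (of_bool (e \<in> D
        \<and> x \<in> {u, v}) :: nat)"
        using False uv(1) by (auto simp: iff')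
      then have "card {g \<in> D. x \<in> ends H g} = card {g \<in> D - {f}. x \<in> ends G g}"
        unfolding H G by (simp only: add.assoc)
      then show ?thesis using False by simp
    qed
  qed
  have mem: "D \<in> cycle_sets H \<longleftrightarrow> D \<subseteq> insert f (edges G) \<and> (e \<in> D \<longleftrightarrow> f \<in> D) \<and> D - {f} \<in> cycle_sets G"
    for D
  proof
    assume D: "D \<in> cycle_sets H"
    then have sub: "D \<subseteq> insert f (edges G)" and ev: "\<And>x. even (card {g \<in> D. x \<in> ends H g})"
      using HG by (simp_all add: cycle_sets_def)
    have iff: "e \<in> D \<longleftrightarrow> f \<in> D" using parity[OF sub, of w] ev[of w] by simp
    have "even (card {g \<in> D - {f}. x \<in> ends G g})" for x
    proof (cases "x = w")
      case True
      have none: "{g \<in> D - {f}. x \<in> ends G g} = {}" using True wG sub by auto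
      show ?thesis unfolding none by simp
    next
      case False
      then show ?thesis using parity[OF sub iff, of x] ev[of x] by simp
    qed
    then show "D \<subseteq> insert f (edges G) \<and> (e \<in> D \<longleftrightarrow> f \<in> D) \<and> D - {f} \<in> cycle_sets G"
      using sub iff by (auto simp: cycle_sets_def)
  next
    assume r: "D \<subseteq> insert f (edges G) \<and> (e \<in> D \<longleftrightarrow> f \<in> D) \<and> D - {f} \<in> cycle_sets G"
    then have sub: "D \<subseteq> insert f (edges G)" and iff: "e \<in> D \<longleftrightarrow> f \<in> D" by simp_all
    have "even (card {g \<in> D. x \<in> ends H g})" for x
      using parity[OF sub iff, of x] r by (cases "x = w") (simp_all add: cycle_sets_def)
    then show "D \<in> cycle_sets H" using sub HG by (simp add: cycle_sets_def)
  qed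
  show "cycle_sets H = subst_elem (cycle_sets G) e {{e, f}}"
    unfolding subst_elem_series_pair[OF ef]
  proof (intro subset_antisym subsetI)
    fix D assume "D \<in> cycle_sets H"
    then have D: "e \<in> D \<longleftrightarrow> f \<in> D" "D - {f} \<in> cycle_sets G" using mem by blast+
    show "D \<in> {p \<in> cycle_sets G. e \<notin> p} \<union> insert f ` {p \<in> cycle_sets G. e \<in> p}"
    proof (cases "f \<in> D")
      case True
      then have "D = insert f (D - {f})" "e \<in> D - {f}" using D(1) ef by auto
      then show ?thesis using D(2) by blast
    next
      case False
      then show ?thesis using D by simp
    qed
  next
    fix D assume "D \<in> {p \<in> cycle_sets G. e \<notin> p} \<union> insert f ` {p \<in> cycle_sets G. e \<in> p}"
    then consider "D \<in> cycle_sets G" "e \<notin> D" | p where "p \<in> cycle_sets G" "e \<in> p" "D = insert f p"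
      by blast
    then show "D \<in> cycle_sets H"
    proof cases
      case 1
      then have "f \<notin> D" "D \<subseteq> edges G" using f by (auto simp: cycle_sets_def)
      then show ?thesis unfolding mem using 1 by auto
    next
      case 2
      then have "f \<notin> p" "p \<subseteq> edges G" using f by (auto simp: cycle_sets_def)
      then show ?thesis unfolding mem using 2 by auto
    qed
  qed
qed

text \<open>Since \<open>e\<close> and \<open>f\<close> have the same ends, degree parities survive
  the replacement of \<open>f\<close> by \<open>e\<close> modulo 2, where \<open>f\<close> cancels
  an \<open>e\<close> already present. The result \<open>D'\<close> is an edge set of
  \<open>G\<close>.\<close>

lemma loopless_parallel_extension:
  assumes G: "loopless_graph G" and e: "e \<in> edges G" and f: "f \<notin> edges G"
    and HG: "H = \<lparr>verts = verts G, edges = insert f (edges G), ends = (ends G)(f := ends G e)\<rparr>"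
  shows "loopless_graph H" "cycle_sets H = subst_elem (cycle_sets G) e {{e}, {f}}"
proof -
  have ef: "e \<noteq> f" using e f by auto
  have finE: "finite (edges G)" using G by (simp add: loopless_graph_def)
  have endsH: "ends H f = ends G e" "\<And>g. g \<noteq> f \<Longrightarrow> ends H g = ends G g" using HG by simp_all
  show "loopless_graph H"
    using G e HG by (auto simp: loopless_graph_def)
  have mem: "D \<in> cycle_sets H \<longleftrightarrow> D \<subseteq> insert f (edges G) \<and>
     (if f \<in> D then (if e \<in> D then D - {e, f} else insert e (D - {f})) else D) \<in> cycle_sets G" for D
  proof (cases "D \<subseteq> insert f (edges G)")
    case True
    define D' where "D' = (if f \<in> D then (if e \<in> D then D - {e, f} else insert e (D - {f})) else D)"
    have finD: "finite D" "finite D'" using finite_subset[OF True] finE by (simp_all add: D'_def)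
    have "even (card {g \<in> D. x \<in> ends H g}) \<longleftrightarrow> even (card {g \<in> D'. x \<in> ends G g})" for x
    proof -
      have R: "{g \<in> D - {e, f}. x \<in> ends H g} = {g \<in> D - {e, f}. x \<in> ends G g}" using endsH(2)
        by auto
      have "card {g \<in> D. x \<in> ends H g} = card {g \<in> D - {e, f}. x \<in> ends G g} +
         of_bool (e \<in> D \<and> x \<in> ends G e) + of_bool (f \<in> D \<and> x \<in> ends G e)"
        using card_filter_pair[OF finD(1) ef, of "\<lambda>g. x \<in> ends H g"] endsH(2)[OF ef]
          unfolding R endsH(1) by simp
      moreover have "D' - {e, f} = D - {e, f}" "e \<in> D' \<longleftrightarrow> (e \<in> D) \<noteq> (f \<in> D)" "f \<notin> D'"
        unfolding D'_def using ef by auto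
      then have "card {g \<in> D'. x \<in> ends G g} = card {g \<in> D - {e, f}. x \<in> ends G g} +
         of_bool ((e \<in> D) \<noteq> (f \<in> D) \<and> x \<in> ends G e)"
        using card_filter_pair[OF finD(2) ef, of "\<lambda>g. x \<in> ends G g"] by simp
      ultimately show ?thesis by (cases "e \<in> D"; cases "f \<in> D"; cases "x \<in> ends G e") simp_all
    qed
    moreover have "D' \<subseteq> edges G" using True e by (auto simp: D'_def)
    ultimately have "D \<in> cycle_sets H \<longleftrightarrow> D' \<in> cycle_sets G" using True HG
      by (simp add: cycle_sets_def)
    then show ?thesis using True unfolding D'_def by simp
  next
    case False
    then show ?thesis using HG by (simp add: cycle_sets_def)
  qed
  have sub: "p \<subseteq> edges G" "f \<notin> p" if "p \<in> cycle_sets G" for p using that f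
    by (auto simp: cycle_sets_def)
  show "cycle_sets H = subst_elem (cycle_sets G) e {{e}, {f}}"
    unfolding subst_elem_parallel_pair[OF ef]
  proof (intro subset_antisym subsetI)
    fix D assume "D \<in> cycle_sets H"
    then have D: "(if f \<in> D then (if e \<in> D then D - {e, f} else insert e (D - {f})) else D)
      \<in> cycle_sets G"
      using mem by blast
    consider "f \<notin> D" | "f \<in> D" "e \<in> D" | "f \<in> D" "e \<notin> D" by blast
    then show "D \<in> cycle_sets G \<union> (\<lambda>p. insert f (p - {e})) ` {p \<in> cycle_sets G. e \<in> p} \<union>
        (\<lambda>p. p \<union> {e, f}) ` {p \<in> cycle_sets G. e \<notin> p}"
    proof cases
      case 1
      then show ?thesis using D by simp
    next
      case 2
      then have "D = (D - {e, f}) \<union> {e, f}" "D - {e, f} \<in> {p \<in> cycle_sets G. e \<notin> p}" using D by auto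
      then show ?thesis by (intro UnI2) (rule rev_image_eqI)
    next
      case 3
      then have "D = insert f (insert e (D - {f}) - {e})" "insert e (D - {f}) \<in> {p
        \<in> cycle_sets G. e \<in> p}"
        using D ef by auto
      then show ?thesis by (intro UnI1[OF UnI2]) (rule rev_image_eqI)
    qed
  next
    fix D assume "D \<in> cycle_sets G \<union> (\<lambda>p. insert f (p - {e})) ` {p \<in> cycle_sets G. e \<in> p} \<union>
        (\<lambda>p. p \<union> {e, f}) ` {p \<in> cycle_sets G. e \<notin> p}"
    then consider "D \<in> cycle_sets G" | p where "p \<in> cycle_sets G" "e \<in> p" "D = insert f (p - {e})"
      | p where "p \<in> cycle_sets G" "e \<notin> p" "D = p \<union> {e, f}" by blast
    then show "D \<in> cycle_sets H"
    proof cases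
      case 1
      then show ?thesis unfolding mem using sub[OF 1] by auto
    next
      case 2
      have "f \<in> D" "e \<notin> D" "insert e (D - {f}) = p" "D \<subseteq> insert f (edges G)"
        using 2 sub[OF 2(1)] ef by auto
      then show ?thesis unfolding mem using 2(1) by simp
    next
      case 3
      have "f \<in> D" "e \<in> D" "D - {e, f} = p" "D \<subseteq> insert f (edges G)"
        using 3 sub[OF 3(1)] ef e by auto
      then show ?thesis unfolding mem using 3(1) by simp
    qed
  qed
qed

abbreviation sp_step :: "('v, 'e) multigraph \<Rightarrow> ('v, 'e) multigraph \<Rightarrow> bool" where
  "sp_step A B \<equiv> series_extension A B \<or> parallel_extension A B"

lemma two_cycle_cycle_sets:
  assumes "two_cycle G"
  shows "loopless_graph G" "cycle_sets G = {{}, edges G}"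
proof -
  obtain u v e f where uv: "u \<noteq> v" and ef: "e \<noteq> f" and G: "verts G = {u, v}" "edges G = {e, f}"
    "ends G e = {u, v}" "ends G f = {u, v}" using assms unfolding two_cycle_def by blast
  show "loopless_graph G" using uv G by (auto simp: loopless_graph_def)
  have "D \<in> cycle_sets G \<longleftrightarrow> D \<in> {{}, {e, f}}" for D
  proof
    assume D: "D \<in> cycle_sets G"
    then have sub: "D \<subseteq> {e, f}" and ev: "even (card {g \<in> D. u \<in> ends G g})" using G
      by (simp_all add: cycle_sets_def)
    have "{g \<in> D. u \<in> ends G g} = D" using sub G by auto
    then have evD: "even (card D)" using ev by simp
    have "D \<noteq> {e}" "D \<noteq> {f}" using evD by auto
    then show "D \<in> {{}, {e, f}}" using sub by auto
  next
    assume "D \<in> {{}, {e, f}}"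
    then have D: "D = {} \<or> D = {e, f}" by simp
    have "{g \<in> {e, f}. x \<in> ends G g} = (if x \<in> {u, v} then {e, f} else {})" for x using G by auto
    then have "even (card {g \<in> {e, f}. x \<in> ends G g})" for x using ef by simp
    then show "D \<in> cycle_sets G" using D G by (auto simp: cycle_sets_def)
  qed
  then show "cycle_sets G = {{}, edges G}" using G(2) by blast
qed

lemma two_cycle_sp_space:
  assumes "two_cycle G"
  shows "loopless_graph G \<and> sp_space (edges G) (cycle_sets G)"
proof -
  obtain e f where "e \<noteq> f" "edges G = {e, f}" using assms unfolding two_cycle_def by blast
  then show ?thesis using two_cycle_cycle_sets[OF assms] sp_space.base[of e f] by simp
qed

lemma sp_graph_sp_space:
  assumes "sp_step\<^sup>*\<^sup>* C G" "two_cycle C"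
  shows "loopless_graph G \<and> sp_space (edges G) (cycle_sets G)"
  using assms
proof (induction rule: rtranclp_induct)
  case base
  then show ?case by (rule two_cycle_sp_space)
next
  case (step G H)
  then have G: "loopless_graph G" "sp_space (edges G) (cycle_sets G)" by simp_all
  from step.hyps(2) show ?case
  proof
    assume "series_extension G H"
    then obtain e u v w f where e: "e \<in> edges G" "ends G e = {u, v}" "w \<notin> verts G"
      and f: "f \<notin> edges G"
      and HG: "H = \<lparr>verts = insert w (verts G), edges = insert f (edges G), ends
        = (ends G)(e := {u, w}, f := {w, v})\<rparr>"
      unfolding series_extension_def by blast
    have "edges H = insert f (edges G)" using HG by simp
    then show ?thesis
      using loopless_series_extension[OF G(1) e f HG] sp_space.series[OF G(2) e(1) f] by simp
  next
    assume "parallel_extension G H"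
    then obtain e f where e: "e \<in> edges G" and f: "f \<notin> edges G"
      and HG: "H = \<lparr>verts = verts G, edges = insert f (edges G), ends = (ends G)(f := ends G e)\<rparr>"
      unfolding parallel_extension_def by blast
    have "edges H = insert f (edges G)" using HG by simp
    then show ?thesis
      using loopless_parallel_extension[OF G(1) e f HG] sp_space.parallel[OF G(2) e f] by simp
  qed
qed

text \<open>The derivation of the space is replayed on graphs; vertices are natural numbers, so a
  subdivision always finds a fresh vertex \<open>w\<close>.\<close>

lemma sp_space_sp_graph:
  assumes "sp_space E Z"
  shows "\<exists>(C :: (nat, 'e) multigraph) G. two_cycle C \<and> sp_step\<^sup>*\<^sup>* C G \<and> edges G = E
    \<and> cycle_sets G = Z"
  using assms
proof (induction rule: sp_space.induct)
  case (base e f)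
  define G :: "(nat, 'e) multigraph"
    where "G = \<lparr>verts = {0, 1}, edges = {e, f}, ends = (\<lambda>_. {0, 1})\<rparr>"
  have "two_cycle G" unfolding two_cycle_def
    by (intro exI[of _ 0] exI[of _ 1] exI[of _ e] exI[of _ f]) (simp add: G_def base)
  then show ?case
    using two_cycle_cycle_sets[of G] by (intro exI[of _ G] exI[of _ G] conjI) (simp_all add: G_def)
next
  case (series E Z e f)
  obtain C G :: "(nat, 'e) multigraph"
    where G: "two_cycle C" "sp_step\<^sup>*\<^sup>* C G" "edges G = E" "cycle_sets G = Z"
    using series.IH by blast
  have loopless: "loopless_graph G" using sp_graph_sp_space[OF G(2,1)] by simp
  have e: "e \<in> edges G" and f: "f \<notin> edges G" using series.hyps G(3) by simp_all
  obtain u v where uv: "ends G e = {u, v}"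
    using loopless_graphD(4)[OF loopless e] by (meson card_2_iff)
  obtain w where w: "w \<notin> verts G" using loopless_graphD(1)[OF loopless]
    by (metis ex_new_if_finite infinite_UNIV_nat)
  define H where "H = \<lparr>verts = insert w (verts G), edges = insert f (edges G), ends = (ends G)(e := {u, w}, f := {w, v})\<rparr>"
  have "series_extension G H" unfolding series_extension_def using uv w e f H_def by blast
  then have "sp_step\<^sup>*\<^sup>* C H" using G(2) by (simp add: rtranclp.rtrancl_into_rtrancl)
  moreover have "edges H = insert f E" using G(3) by (simp add: H_def)
  moreover have "cycle_sets H = subst_elem Z e {{e, f}}"
    using loopless_series_extension(2)[OF loopless e uv w f H_def] G(4) by simp
  ultimately show ?case using G(1) by blast
next
  case (parallel E Z e f)
  obtain C G :: "(nat, 'e) multigraph"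
    where G: "two_cycle C" "sp_step\<^sup>*\<^sup>* C G" "edges G = E" "cycle_sets G = Z"
    using parallel.IH by blast
  have loopless: "loopless_graph G" using sp_graph_sp_space[OF G(2,1)] by simp
  have e: "e \<in> edges G" and f: "f \<notin> edges G" using parallel.hyps G(3) by simp_all
  define H where "H = \<lparr>verts = verts G, edges = insert f (edges G), ends = (ends G)(f := ends G e)\<rparr>"
  have "parallel_extension G H" unfolding parallel_extension_def using e f H_def by blast
  then have "sp_step\<^sup>*\<^sup>* C H" using G(2) by (simp add: rtranclp.rtrancl_into_rtrancl)
  moreover have "edges H = insert f E" using G(3) by (simp add: H_def)
  moreover have "cycle_sets H = subst_elem Z e {{e}, {f}}"
    using loopless_parallel_extension(2)[OF loopless e f H_def] G(4) by simp
  ultimately show ?case using G(1) by blast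
qed

section \<open>Unique series and parallel decompositions\<close>

text \<open>In a network these are the edge sets of the simple paths between the terminals.\<close>

definition minimals :: "'a set set \<Rightarrow> 'a set set" where
  "minimals F = {p \<in> F. \<forall>q\<in>F. q \<subseteq> p \<longrightarrow> q = p}"

definition adj :: "'a set set \<Rightarrow> 'a \<Rightarrow> 'a \<Rightarrow> bool" where
  "adj F a b \<longleftrightarrow> (\<exists>p\<in>minimals F. a \<in> p \<and> b \<in> p)"

definition series_net :: "'a set \<Rightarrow> 'a set set \<Rightarrow> bool" where
  "series_net A F \<longleftrightarrow> (\<exists>B C G H. net B G \<and> net C H \<and> B \<inter> C = {} \<and> A = B \<union> C \<and> F = ser G H)"

definition parallel_net :: "'a set \<Rightarrow> 'a set set \<Rightarrow> bool" where
  "parallel_net A F \<longleftrightarrow> (\<exists>B C G H. net B G \<and> net C H \<and> B \<inter> C = {} \<and> A = B \<union> C \<and> F = par G H)"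

lemma adjI: "p \<in> minimals F \<Longrightarrow> a \<in> p \<Longrightarrow> b \<in> p \<Longrightarrow> adj F a b"
  unfolding adj_def by blast

lemma series_net_net: "series_net A F \<Longrightarrow> net A F"
  unfolding series_net_def by (blast intro: net.series)

lemma parallel_net_net: "parallel_net A F \<Longrightarrow> net A F"
  unfolding parallel_net_def by (blast intro: net.parallel)

lemma series_netE:
  assumes "series_net A F"
  obtains B C G H where "net B G" "net C H" "B \<inter> C = {}" "A = B \<union> C" "F = ser G H"
  using assms unfolding series_net_def by blast

lemma parallel_netE:
  assumes "parallel_net A F"
  obtains B C G H where "net B G" "net C H" "B \<inter> C = {}" "A = B \<union> C" "F = par G H"
  using assms unfolding parallel_net_def by blast

lemma net_cases:
  assumes "net A F"
  obtains (single) a where "A = {a}" "F = {{a}}" | (series) "series_net A F" | (parallel) "parallel_net A F"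
  using assms unfolding series_net_def parallel_net_def by cases blast+

section \<open>Minimal paths and the relation \<open>adj\<close>\<close>

lemma ser_Un_eq:
  assumes "p \<subseteq> A" "p' \<subseteq> A" "q \<subseteq> B" "q' \<subseteq> B" "A \<inter> B = {}" "p \<union> q = p' \<union> q'"
  shows "p = p'" "q = q'"
  using assms by blast+

lemma minimals_ser:
  assumes F: "net A F" and G: "net B G" and disj: "A \<inter> B = {}"
  shows "minimals (ser F G) = ser (minimals F) (minimals G)"
proof (intro subset_antisym subsetI)
  note sub = net_subset[OF F] net_subset[OF G]
  fix r assume r: "r \<in> minimals (ser F G)"
  then have "r \<in> ser F G" by (simp add: minimals_def)
  then obtain p q where pq: "p \<in> F" "q \<in> G" "r = p \<union> q" by (rule serE)
  have min: "s = r" if "s \<in> ser F G" "s \<subseteq> r" for s using r that unfolding minimals_def by blast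
  have "p' = p" if "p' \<in> F" "p' \<subseteq> p" for p'
  proof -
    have "p' \<union> q = p \<union> q" using min[OF serI[OF that(1) pq(2)]] that(2) pq(3) by blast
    then show ?thesis
      by (rule ser_Un_eq(1)[OF sub(1)[OF that(1)] sub(1)[OF pq(1)] sub(2)[OF pq(2)] sub(2)[OF pq(2)] disj])
  qed
  moreover have "q' = q" if "q' \<in> G" "q' \<subseteq> q" for q'
  proof -
    have "p \<union> q' = p \<union> q" using min[OF serI[OF pq(1) that(1)]] that(2) pq(3) by blast
    then show ?thesis
      by (rule ser_Un_eq(2)[OF sub(1)[OF pq(1)] sub(1)[OF pq(1)] sub(2)[OF that(1)] sub(2)[OF pq(2)] disj])
  qed
  ultimately have "p \<in> minimals F" "q \<in> minimals G" using pq by (simp_all add: minimals_def)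
  then show "r \<in> ser (minimals F) (minimals G)" unfolding pq(3) by (rule serI)
next
  note sub = net_subset[OF F] net_subset[OF G]
  fix r assume "r \<in> ser (minimals F) (minimals G)"
  then obtain p q where pq: "p \<in> minimals F" "q \<in> minimals G" "r = p \<union> q" by (rule serE)
  then have pF: "p \<in> F" "q \<in> G" by (simp_all add: minimals_def)
  have "s = r" if s: "s \<in> ser F G" and le: "s \<subseteq> r" for s
  proof -
    obtain p' q' where *: "p' \<in> F" "q' \<in> G" "s = p' \<union> q'" using s by (rule serE)
    have "p' \<subseteq> p" "q' \<subseteq> q"
      using le pq(3) *(3) sub(1)[OF *(1)] sub(1)[OF pF(1)] sub(2)[OF *(2)] sub(2)[OF pF(2)] disj
        by blast+
    then have "p' = p" "q' = q" using pq(1,2) *(1,2) unfolding minimals_def by blast+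
    then show ?thesis using * pq by simp
  qed
  then show "r \<in> minimals (ser F G)" using serI[OF pF] pq(3) by (simp add: minimals_def)
qed

lemma par_left: "net B G \<Longrightarrow> p \<in> F \<Longrightarrow> p \<in> par F G"
  using parI[of p F True "{}" G] empty_in_symdiffs[OF net_nonempty[of B G]] by simp

lemma par_right: "net A F \<Longrightarrow> q \<in> G \<Longrightarrow> q \<in> par F G"
  using par_left[of A F q G] by (simp add: par_commute)

text \<open>A member supported on \<open>A\<close> has empty part on \<open>B\<close>. The empty set
  is even by \<open>net_empty_notin\<close>, so the part on \<open>A\<close> is the odd one.\<close>

lemma par_below_left:
  assumes F: "net A F" and G: "net B G" and disj: "A \<inter> B = {}"
  shows "r \<in> par F G \<Longrightarrow> r \<subseteq> A \<Longrightarrow> r \<in> F"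
proof -
  assume "r \<in> par F G" "r \<subseteq> A"
  then obtain p q b where *: "p \<in> layer F b" "q \<in> layer G (\<not> b)" "r = p \<union> q" by (elim parE)
  have q: "q = {}" using *(3) \<open>r \<subseteq> A\<close> net_layer_subset[OF G *(2)] disj by auto
  then have b using *(2) net_empty_notin[OF G] by (cases b) auto
  then show "r \<in> F" using * q by simp
qed

lemma minimals_par_subset:
  assumes F: "net A F" and G: "net B G" and disj: "A \<inter> B = {}"
  shows "minimals F \<subseteq> minimals (par F G)"
proof
  fix p assume p: "p \<in> minimals F"
  then have pF: "p \<in> F" by (simp add: minimals_def)
  have "r = p" if "r \<in> par F G" "r \<subseteq> p" for r
    using par_below_left[OF F G disj that(1)] that(2) net_subset[OF F pF] p
    unfolding minimals_def by blast
  then show "p \<in> minimals (par F G)" using par_left[OF G pF] by (simp add: minimals_def)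
qed

lemma minimals_par:
  assumes F: "net A F" and G: "net B G" and disj: "A \<inter> B = {}"
  shows "minimals (par F G) = minimals F \<union> minimals G"
proof (intro subset_antisym subsetI)
  fix r assume r: "r \<in> minimals (par F G)"
  then have "r \<in> par F G" by (simp add: minimals_def)
  then obtain p q b where *: "p \<in> layer F b" "q \<in> layer G (\<not> b)" "r = p \<union> q" by (rule parE)
  have min: "s = r" if "s \<in> par F G" "s \<subseteq> r" for s using r that unfolding minimals_def by blast
  show "r \<in> minimals F \<union> minimals G"
  proof (cases b)
    case True
    then have "p \<in> F" using * by simp
    then have "p = r" using min[OF par_left[OF G \<open>p \<in> F\<close>]] *(3) by blast
    then show ?thesis using \<open>p \<in> F\<close> min par_left[OF G] by (simp add: minimals_def)
  next
    case False
    then have "q \<in> G" using * by simp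
    then have "q = r" using min[OF par_right[OF F \<open>q \<in> G\<close>]] *(3) by blast
    then show ?thesis using \<open>q \<in> G\<close> min par_right[OF F] by (simp add: minimals_def)
  qed
next
  fix r assume "r \<in> minimals F \<union> minimals G"
  then show "r \<in> minimals (par F G)"
    using minimals_par_subset[OF F G disj] minimals_par_subset[OF G F] disj
    by (auto simp: par_commute[of G F] Int_commute)
qed

lemma minimals_subset: "net A F \<Longrightarrow> p \<in> minimals F \<Longrightarrow> p \<subseteq> A"
  unfolding minimals_def using net_subset by blast

text \<open>A network has no dead ends: every element lies on a minimal path. This is what supplies
  the paths to be joined in \<open>adj_ser_cross\<close>.\<close>

lemma adj_self: "net A F \<Longrightarrow> a \<in> A \<Longrightarrow> adj F a a"
proof (induction arbitrary: a rule: net.induct)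
  case (single c)
  have "{c} \<in> minimals {{c}}" by (simp add: minimals_def)
  then show ?case using single adjI[of "{c}" "{{c}}" a a] by simp
next
  case (series A F B G)
  have ex: "\<exists>p\<in>minimals F. c \<in> p" if "c \<in> A" for c
    using series.IH(1)[OF that] unfolding adj_def by blast
  have ex': "\<exists>q\<in>minimals G. c \<in> q" if "c \<in> B" for c
    using series.IH(2)[OF that] unfolding adj_def by blast
  have "\<exists>p\<in>minimals F. \<exists>q\<in>minimals G. a \<in> p \<union> q"
  proof (cases "a \<in> A")
    case True
    obtain c where "c \<in> B" using net_ground[OF series.hyps(2)] by blast
    then show ?thesis using ex[OF True] ex' by blast
  next
    case False
    obtain c where "c \<in> A" using net_ground[OF series.hyps(1)] by blast
    moreover have "a \<in> B" using False series.prems by simp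
    ultimately show ?thesis using ex ex' by blast
  qed
  then obtain p q where "p \<in> minimals F" "q \<in> minimals G" "a \<in> p \<union> q" by blast
  then have "p \<union> q \<in> minimals (ser F G)" "a \<in> p \<union> q"
    unfolding minimals_ser[OF series.hyps] by (simp_all only: serI)
  then show ?case by (intro adjI)
next
  case (parallel A F B G)
  have "adj F a a \<or> adj G a a" using parallel.IH parallel.prems by (cases "a \<in> A") simp_all
  then show ?case unfolding adj_def minimals_par[OF parallel.hyps] by blast
qed

lemma adj_ser_cross:
  assumes "net A F" "net B G" "A \<inter> B = {}" "a \<in> A" "b \<in> B"
  shows "adj (ser F G) a b" "adj (ser F G) b a"
proof -
  obtain p q where *: "p \<in> minimals F" "a \<in> p" "q \<in> minimals G" "b \<in> q"
    using adj_self[OF assms(1,4)] adj_self[OF assms(2,5)] unfolding adj_def by blast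
  then have "p \<union> q \<in> minimals (ser F G)" unfolding minimals_ser[OF assms(1-3)] by (intro serI)
  then show "adj (ser F G) a b" "adj (ser F G) b a" using *(2,4) by (auto intro: adjI)
qed

lemma adj_ser_left:
  assumes "net A F" "net B G" "A \<inter> B = {}" "a \<in> A" "b \<in> A"
  shows "adj (ser F G) a b \<longleftrightarrow> adj F a b"
proof
  assume "adj (ser F G) a b"
  then obtain r where r: "r \<in> ser (minimals F) (minimals G)" "a \<in> r" "b \<in> r"
    unfolding adj_def minimals_ser[OF assms(1-3)] by blast
  then obtain p q where pq: "p \<in> minimals F" "q \<in> minimals G" "r = p \<union> q" by (elim serE)
  have "a \<notin> q" "b \<notin> q" using minimals_subset[OF assms(2) pq(2)] assms(3-5) by blast+
  then have "a \<in> p" "b \<in> p" using r(2,3) pq(3) by simp_all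
  with pq(1) show "adj F a b" by (rule adjI)
next
  assume "adj F a b"
  then obtain p where p: "p \<in> minimals F" "a \<in> p" "b \<in> p" unfolding adj_def by blast
  obtain c where "c \<in> B" using net_ground[OF assms(2)] by blast
  then obtain q where "q \<in> minimals G" using adj_self[OF assms(2)] unfolding adj_def by blast
  with p(1) have "p \<union> q \<in> minimals (ser F G)" unfolding minimals_ser[OF assms(1-3)] by (rule serI)
  then show "adj (ser F G) a b" using p(2,3) by (auto intro: adjI)
qed

lemma adj_par_cross:
  assumes "net A F" "net B G" "A \<inter> B = {}" "a \<in> A" "b \<in> B"
  shows "\<not> adj (par F G) a b" "\<not> adj (par F G) b a"
proof -
  have "p \<subseteq> A \<or> p \<subseteq> B" if "p \<in> minimals (par F G)" for p
    using that minimals_subset[OF assms(1)] minimals_subset[OF assms(2)]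
    unfolding minimals_par[OF assms(1-3)] by blast
  then show "\<not> adj (par F G) a b" "\<not> adj (par F G) b a"
    using assms(3-5) unfolding adj_def by blast+
qed

lemma adj_par_left:
  assumes "net A F" "net B G" "A \<inter> B = {}" "a \<in> A"
  shows "adj (par F G) a b \<longleftrightarrow> adj F a b"
proof -
  have "a \<notin> p" if "p \<in> minimals G" for p
    using minimals_subset[OF assms(2) that] assms(3,4) by blast
  then show ?thesis unfolding adj_def minimals_par[OF assms(1-3)] by blast
qed

text \<open>All pairs across a series composition are adjacent, so two elements of one part have a
  common neighbour in the other; for elements of different parts \<open>c = b\<close> works by
  reflexivity.\<close>

lemma series_net_adj:
  assumes "series_net A F" "a \<in> A" "b \<in> A"
  shows "\<exists>c\<in>A. adj F a c \<and> adj F c b"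
proof -
  obtain B C G H where *: "net B G" "net C H" "B \<inter> C = {}" "A = B \<union> C" "F = ser G H"
    using assms(1) by (rule series_netE)
  note cross = adj_ser_cross[OF *(1-3), folded *(5)]
  note self = adj_self[OF series_net_net[OF assms(1)]]
  obtain b' c' where bc: "b' \<in> B" "c' \<in> C" using net_ground[OF *(1)] net_ground[OF *(2)] by blast
  have "a \<in> B \<or> a \<in> C" "b \<in> B \<or> b \<in> C" using assms(2,3) *(4) by blast+
  then consider "a \<in> B" "b \<in> B" | "a \<in> B" "b \<in> C" | "a \<in> C" "b \<in> B" | "a \<in> C" "b \<in> C" by blast
  then show ?thesis
  proof cases
    case 1
    then show ?thesis using cross(1)[OF 1(1) bc(2)] cross(2)[OF 1(2) bc(2)] bc(2) *(4) by blast
  next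
    case 2
    then show ?thesis using cross(1)[OF 2] self[OF assms(3)] assms(3) by blast
  next
    case 3
    then show ?thesis using cross(2)[OF 3(2,1)] self[OF assms(3)] assms(3) by blast
  next
    case 4
    then show ?thesis using cross(2)[OF bc(1) 4(1)] cross(1)[OF bc(1) 4(2)] bc(1) *(4) by blast
  qed
qed

text \<open>The complementary statement: what is not a series composition is a single element or a
  parallel composition, and there non-adjacency connects any two elements in at most two
  steps.\<close>

lemma nonseries_net_adj:
  assumes "net A F" "\<not> series_net A F" "a \<in> A" "b \<in> A"
  shows "\<exists>c\<in>A. (c = a \<or> \<not> adj F a c) \<and> (c = b \<or> \<not> adj F c b)"
  using assms(1)
proof (cases rule: net_cases)
  case (single c)
  then show ?thesis using assms by auto
next
  case series
  then show ?thesis using assms by simp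
next
  case parallel
  then obtain B C G H where *: "net B G" "net C H" "B \<inter> C = {}" "A = B \<union> C" "F = par G H"
    by (rule parallel_netE)
  note cross = adj_par_cross[OF *(1-3), folded *(5)]
  obtain b' c' where "b' \<in> B" "c' \<in> C" using net_ground *(1,2) by blast
  then show ?thesis using assms(3,4) cross *(4) by blast
qed

text \<open>A common neighbour of elements from different parallel parts would be adjacent across
  the parts.\<close>

lemma series_not_parallel: "series_net A F \<Longrightarrow> \<not> parallel_net A F"
proof
  assume s: "series_net A F" and "parallel_net A F"
  then obtain B C G H where *: "net B G" "net C H" "B \<inter> C = {}" "A = B \<union> C" "F = par G H"
    by (elim parallel_netE)
  note cross = adj_par_cross[OF *(1-3), folded *(5)]
  obtain b c where bc: "b \<in> B" "c \<in> C" using net_ground *(1,2) by blast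
  then obtain d where "d \<in> A" "adj F b d" "adj F d c" using series_net_adj[OF s, of b c] *(4)
    by blast
  then show False using cross bc *(4) by blast
qed

lemma ser_restrict:
  assumes F: "net A F" and G: "net B G" and disj: "A \<inter> B = {}"
  shows "F = (\<lambda>r. r \<inter> A) ` ser F G" "G = (\<lambda>r. r \<inter> B) ` ser F G"
proof -
  note sub = net_subset[OF F] net_subset[OF G]
  have eq: "(p \<union> q) \<inter> A = p" "(p \<union> q) \<inter> B = q" if "p \<in> F" "q \<in> G" for p q
    using sub(1)[OF that(1)] sub(2)[OF that(2)] disj by blast+
  obtain p0 q0 where 0: "p0 \<in> F" "q0 \<in> G" using net_nonempty F G by blast
  show "F = (\<lambda>r. r \<inter> A) ` ser F G"
  proof (intro subset_antisym subsetI)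
    fix p assume "p \<in> F"
    then show "p \<in> (\<lambda>r. r \<inter> A) ` ser F G"
      using eq(1)[of p q0] 0 serI[of p F q0 G] by (intro image_eqI[of _ _ "p \<union> q0"]) simp_all
  next
    fix p assume "p \<in> (\<lambda>r. r \<inter> A) ` ser F G"
    then obtain r where r: "r \<in> ser F G" "p = r \<inter> A" by blast
    from r(1) obtain p' q' where "p' \<in> F" "q' \<in> G" "r = p' \<union> q'" by (rule serE)
    then show "p \<in> F" using eq(1) r(2) by simp
  qed
  show "G = (\<lambda>r. r \<inter> B) ` ser F G"
  proof (intro subset_antisym subsetI)
    fix q assume "q \<in> G"
    then show "q \<in> (\<lambda>r. r \<inter> B) ` ser F G"
      using eq(2)[of p0 q] 0 serI[of p0 F q G] by (intro image_eqI[of _ _ "p0 \<union> q"]) simp_all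
  next
    fix q assume "q \<in> (\<lambda>r. r \<inter> B) ` ser F G"
    then obtain r where r: "r \<in> ser F G" "q = r \<inter> B" by blast
    from r(1) obtain p' q' where "p' \<in> F" "q' \<in> G" "r = p' \<union> q'" by (rule serE)
    then show "q \<in> G" using eq(2) r(2) by simp
  qed
qed

text \<open>Intersecting with \<open>A\<close>, as in the series case, would mix the two layers;
  instead the members of \<open>F\<close> are those supported on \<open>A\<close>.\<close>

lemma par_restrict:
  assumes F: "net A F" and G: "net B G" and disj: "A \<inter> B = {}"
  shows "F = {r \<in> par F G. r \<subseteq> A}" "G = {r \<in> par F G. r \<subseteq> B}"
proof -
  show "F = {r \<in> par F G. r \<subseteq> A}"
    using par_left[OF G] net_subset[OF F] par_below_left[OF F G disj] by blast
  have "B \<inter> A = {}" using disj by blast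
  then show "G = {r \<in> par F G. r \<subseteq> B}"
    using par_right[OF F] net_subset[OF G] par_below_left[OF G F] unfolding par_commute[of G F]
      by blast
qed

text \<open>In \<open>X\<close> any two elements are connected by at most two non-adjacent steps,
  while in the second decomposition every element of \<open>X'\<close> is adjacent to all of
  \<open>A - X'\<close>. Starting from the common \<open>a\<close>, such steps never leave
  \<open>X'\<close>. By symmetry the grounds agree, and \<open>ser_restrict\<close> recovers the
  factors.\<close>

lemma ser_unique:
  assumes nets: "net X F" "net (A - X) G" "net X' F'" "net (A - X') G'"
    and sub: "X \<subseteq> A" "X' \<subseteq> A" and a: "a \<in> X" "a \<in> X'"
    and ns: "\<not> series_net X F" "\<not> series_net X' F'" and eq: "ser F G = ser F' G'"
  shows "X = X' \<and> F = F' \<and> G = G'"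
proof -
  have le: "X \<subseteq> X'"
    if nets: "net X F" "net (A - X) G" "net X' F'" "net (A - X') G'"
    and sub: "X \<subseteq> A" and a: "a \<in> X" "a \<in> X'"
    and ns: "\<not> series_net X F" and eq: "ser F G = ser F' G'" for X X' F F' G G'
  proof
    fix b assume b: "b \<in> X"
    then obtain c where c: "c \<in> X" "c = a \<or> \<not> adj F a c" "c = b \<or> \<not> adj F c b"
      using nonseries_net_adj[OF nets(1) ns a(1)] by blast
    have step: "y \<in> X'" if "x \<in> X" "y \<in> X" "x \<in> X'" "\<not> adj F x y" for x y
    proof (rule ccontr)
      assume "y \<notin> X'"
      then have "adj (ser F' G') x y" using that sub by (intro adj_ser_cross[OF nets(3,4)]) auto
      then show False using that adj_ser_left[OF nets(1,2)] eq by auto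
    qed
    have "c \<in> X'" using c step[OF a(1) _ a(2)] a by blast
    then show "b \<in> X'" using c step[OF c(1) b] by blast
  qed
  have "X = X'" using le[OF nets sub(1) a ns(1) eq] le[OF nets(3,4,1,2) sub(2) a(2,1) ns(2) eq[symmetric]] by blast
  have disj: "X \<inter> (A - X) = {}" "X' \<inter> (A - X') = {}" by blast+
  have "F = F'"
    by (subst ser_restrict(1)[OF nets(1,2) disj(1)], subst ser_restrict(1)[OF nets(3,4) disj(2)])
      (simp only: \<open>X = X'\<close> eq)
  moreover have "G = G'"
    by (subst ser_restrict(2)[OF nets(1,2) disj(1)], subst ser_restrict(2)[OF nets(3,4) disj(2)])
      (simp only: \<open>X = X'\<close> eq)
  ultimately show ?thesis using \<open>X = X'\<close> by simp
qed

text \<open>The same argument with adjacency and non-adjacency exchanged;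
  \<open>series_net_adj\<close> provides the connectedness of \<open>X\<close>.\<close>

lemma par_unique:
  assumes nets: "series_net X F" "net (A - X) G" "series_net X' F'" "net (A - X') G'"
    and sub: "X \<subseteq> A" "X' \<subseteq> A" and a: "a \<in> X" "a \<in> X'" and eq: "par F G = par F' G'"
  shows "X = X' \<and> F = F' \<and> G = G'"
proof -
  have le: "X \<subseteq> X'"
    if nets: "series_net X F" "net (A - X) G" "series_net X' F'" "net (A - X') G'"
    and sub: "X \<subseteq> A" and a: "a \<in> X" "a \<in> X'" and eq: "par F G = par F' G'" for X X' F F' G G'
  proof
    note nets' = series_net_net[OF nets(1)] series_net_net[OF nets(3)]
    fix b assume b: "b \<in> X"
    then obtain c where c: "c \<in> X" "adj F a c" "adj F c b"
      using series_net_adj[OF nets(1) a(1)] by blast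
    have step: "y \<in> X'" if "x \<in> X" "y \<in> X" "x \<in> X'" "adj F x y" for x y
    proof (rule ccontr)
      assume "y \<notin> X'"
      then have "\<not> adj (par F' G') x y" using that sub
        by (intro adj_par_cross[OF nets'(2) nets(4)]) auto
      then show False using that adj_par_left[OF nets'(1) nets(2)] eq by auto
    qed
    have "c \<in> X'" using c step[OF a(1) _ a(2)] a by blast
    then show "b \<in> X'" using c step[OF c(1) b] by blast
  qed
  have "X = X'" using le[OF nets sub(1) a eq] le[OF nets(3,4,1,2) sub(2) a(2,1) eq[symmetric]]
    by blast
  have disj: "X \<inter> (A - X) = {}" "X' \<inter> (A - X') = {}" by blast+
  note nets' = series_net_net[OF nets(1)] series_net_net[OF nets(3)]
  have "F = F'"
    by (subst par_restrict(1)[OF nets'(1) nets(2) disj(1)], subst par_restrict(1)[OF nets'(2) nets(4) disj(2)])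
      (simp only: \<open>X = X'\<close> eq)
  moreover have "G = G'"
    by (subst par_restrict(2)[OF nets'(1) nets(2) disj(1)], subst par_restrict(2)[OF nets'(2) nets(4) disj(2)])
      (simp only: \<open>X = X'\<close> eq)
  ultimately show ?thesis using \<open>X = X'\<close> by simp
qed

section \<open>Existence of the decompositions\<close>

lemma ser_assoc: "ser (ser F G) H = ser F (ser G H)"
proof (intro subset_antisym subsetI)
  fix r assume "r \<in> ser (ser F G) H"
  then obtain p q s where "p \<in> F" "q \<in> G" "s \<in> H" "r = (p \<union> q) \<union> s" by (elim serE) simp
  then show "r \<in> ser F (ser G H)" using serI[of p F "q \<union> s"] serI[of q G s H]
    by (simp add: Un_assoc)
next
  fix r assume "r \<in> ser F (ser G H)"
  then obtain p q s where "p \<in> F" "q \<in> G" "s \<in> H" "r = p \<union> (q \<union> s)" by (elim serE) simp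
  then show "r \<in> ser (ser F G) H" using serI[of "p \<union> q" "ser F G" s] serI[of p F q G]
    by (simp add: Un_assoc)
qed

lemma par_assoc:
  assumes F: "net A F" and G: "net B G" and H: "net C H"
    and disj: "A \<inter> B = {}" "A \<inter> C = {}" "B \<inter> C = {}"
  shows "par (par F G) H = par F (par G H)"
proof (intro subset_antisym subsetI)
  note lay = layer_par[OF net_coset[OF F] net_coset[OF G] disj(1)]
    layer_par[OF net_coset[OF G] net_coset[OF H] disj(3)]
  {
    fix r assume "r \<in> par (par F G) H"
    then obtain x s c where x: "x \<in> layer (par F G) c" "s \<in> layer H (\<not> c)" "r = x \<union> s"
      by (rule parE)
    obtain p q a b where pq: "p \<in> layer F a" "q \<in> layer G b" "x = p \<union> q" "(a \<noteq> b) = c"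
      using x(1) unfolding lay by blast
    have "q \<union> s \<in> layer (par G H) (\<not> a)"
      unfolding lay using pq(2,4) x(2)
        by (intro CollectI exI[of _ q] exI[of _ s] exI[of _ b] exI[of _ "\<not> c"] conjI) auto
    then have "p \<union> (q \<union> s) \<in> par F (par G H)" using pq(1) by (intro parI)
    then show "r \<in> par F (par G H)" using x(3) pq(3) by (simp add: Un_assoc)
  next
    fix r assume "r \<in> par F (par G H)"
    then obtain p x c where x: "p \<in> layer F c" "x \<in> layer (par G H) (\<not> c)" "r = p \<union> x"
      by (rule parE)
    obtain q s a b where pq: "q \<in> layer G a" "s \<in> layer H b" "x = q \<union> s" "(a \<noteq> b) = (\<not> c)"
      using x(2) unfolding lay by blast
    have "p \<union> q \<in> layer (par F G) (\<not> b)"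
      unfolding lay using pq(1,4) x(1)
        by (intro CollectI exI[of _ p] exI[of _ q] exI[of _ c] exI[of _ a] conjI) auto
    then have "(p \<union> q) \<union> s \<in> par (par F G) H" using parI[of "p \<union> q" "par F G" "\<not> b" s H] pq(2)
      by simp
    then show "r \<in> par (par F G) H" using x(3) pq(3) by (simp add: Un_assoc)
  }
qed

text \<open>The part containing \<open>a\<close> is split further until it is no longer a series
  composition; associativity collects everything split off into one factor.\<close>

lemma series_net_decomp:
  assumes "series_net A F" "a \<in> A"
  shows "\<exists>X G H. a \<in> X \<and> X \<subseteq> A \<and> net X G \<and> \<not> series_net X G \<and> net (A - X) H \<and> F = ser G H"
  using assms
proof (induction "card A" arbitrary: A F rule: less_induct)
  case less
  obtain B C G H where *: "net B G" "net C H" "B \<inter> C = {}" "A = B \<union> C" "F = ser G H" "a \<in> B"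
  proof -
    obtain B C G H where *: "net B G" "net C H" "B \<inter> C = {}" "A = B \<union> C" "F = ser G H"
      using less.prems(1) by (rule series_netE)
    show ?thesis
    proof (cases "a \<in> B")
      case True then show ?thesis using * that by blast
    next
      case False
      then have "a \<in> C" "C \<inter> B = {}" "A = C \<union> B" using * less.prems(2) by auto
      then show ?thesis using that[OF *(2,1)] *(5) ser_commute[of G H] by simp
    qed
  qed
  have C: "A - B = C" using *(3,4) by auto
  show ?case
  proof (cases "series_net B G")
    case False
    then show ?thesis using * C by (intro exI[of _ B] exI[of _ G] exI[of _ H] conjI) simp_all
  next
    case True
    have "finite A" "C \<noteq> {}" using net_ground *(1,2,4) by auto
    then have "card B < card A" using *(3,4) by (intro psubset_card_mono) auto
    from less.hyps[OF this True *(6)] obtain X G1 G2 where X: "a \<in> X" "X \<subseteq> B" "net X G1"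
      "\<not> series_net X G1" "net (B - X) G2" "G = ser G1 G2" by blast
    have "net ((B - X) \<union> C) (ser G2 H)" using *(3) by (intro net.series[OF X(5) *(2)]) auto
    moreover have "(B - X) \<union> C = A - X" using X(2) *(3,4) by auto
    moreover have "F = ser G1 (ser G2 H)" using *(5) X(6) by (simp add: ser_assoc)
    moreover have "X \<subseteq> A" using X(2) *(4) by blast
    ultimately show ?thesis using X(1,3,4)
      by (intro exI[of _ X] exI[of _ G1] exI[of _ "ser G2 H"] conjI) simp_all
  qed
qed

lemma parallel_netE':
  assumes "parallel_net A F" "a \<in> A"
  obtains B C G H where "net B G" "net C H" "B \<inter> C = {}" "A = B \<union> C" "F = par G H" "a \<in> B"
proof -
  obtain B C G H where *: "net B G" "net C H" "B \<inter> C = {}" "A = B \<union> C" "F = par G H"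
    using assms(1) by (rule parallel_netE)
  show ?thesis
  proof (cases "a \<in> B")
    case True then show ?thesis using * that by blast
  next
    case False
    then have "a \<in> C" "C \<inter> B = {}" "A = C \<union> B" using * assms(2) by auto
    then show ?thesis using that[OF *(2,1)] *(5) par_commute[of G H] by simp
  qed
qed

text \<open>Repeated splitting ends in a series composition or in the single element
  \<open>a\<close>, and \<open>{a} \<notin> F\<close> excludes the latter.\<close>

lemma parallel_net_decomp:
  assumes "parallel_net A F" "a \<in> A" "{a} \<notin> F"
  shows "\<exists>X G H. a \<in> X \<and> X \<subseteq> A \<and> series_net X G \<and> net (A - X) H \<and> F = par G H"
  using assms
proof (induction "card A" arbitrary: A F rule: less_induct)
  case less
  obtain B C G H where *: "net B G" "net C H" "B \<inter> C = {}" "A = B \<union> C" "F = par G H" "a \<in> B"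
    using less.prems(1,2) by (rule parallel_netE')
  have C: "A - B = C" using *(3,4) by auto
  have G: "{a} \<notin> G" using less.prems(3) *(5) par_left[OF *(2)] by blast
  from *(1) show ?case
  proof (cases rule: net_cases)
    case (single c)
    then show ?thesis using G *(6) by auto
  next
    case series
    then show ?thesis using * C by (intro exI[of _ B] exI[of _ G] exI[of _ H] conjI) simp_all
  next
    case parallel
    have "finite A" "C \<noteq> {}" using net_ground *(1,2,4) by auto
    then have "card B < card A" using *(3,4) by (intro psubset_card_mono) auto
    from less.hyps[OF this parallel *(6) G] obtain X G1 G2
      where X: "a \<in> X" "X \<subseteq> B" "series_net X G1"
      "net (B - X) G2" "G = par G1 G2" by blast
    have "net ((B - X) \<union> C) (par G2 H)" using *(3) by (intro net.parallel[OF X(4) *(2)]) auto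
    moreover have "(B - X) \<union> C = A - X" using X(2) *(3,4) by auto
    moreover have "F = par G1 (par G2 H)" unfolding *(5) X(5)
      using X(2) *(3) by (intro par_assoc[OF series_net_net[OF X(3)] X(4) *(2)]) auto
    moreover have "X \<subseteq> A" using X(2) *(4) by blast
    ultimately show ?thesis using X(1,3)
      by (intro exI[of _ X] exI[of _ G1] exI[of _ "par G2 H"] conjI) simp_all
  qed
qed

lemma ser_singleton_notin:
  assumes "net A F" "net B G" "A \<inter> B = {}"
  shows "{a} \<notin> ser F G"
proof
  assume "{a} \<in> ser F G"
  then obtain p q where *: "p \<in> F" "q \<in> G" "{a} = p \<union> q" by (rule serE)
  then have "p \<noteq> {}" "q \<noteq> {}" using net_empty_notin assms by blast+
  moreover have "p \<subseteq> {a}" "q \<subseteq> {a}" using *(3) by blast+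
  ultimately have "p = {a}" "q = {a}" by blast+
  then show False using net_subset[OF assms(1) *(1)] net_subset[OF assms(2) *(2)] assms(3) by auto
qed

text \<open>The case excluded from \<open>parallel_net_decomp\<close>: a one-element path is a
  parallel part of its own, unless it is the whole network.\<close>

lemma net_singleton_decomp:
  assumes "net A F" "{a} \<in> F"
  shows "A = {a} \<and> F = {{a}} \<or> (\<exists>G. net (A - {a}) G \<and> F = par {{a}} G)"
  using assms
proof (induction "card A" arbitrary: A F rule: less_induct)
  case less
  from less.prems(1) show ?case
  proof (cases rule: net_cases)
    case (single c)
    then show ?thesis using less.prems by auto
  next
    case series
    then obtain B C G H where "net B G" "net C H" "B \<inter> C = {}" "F = ser G H" by (elim series_netE)
    then show ?thesis using less.prems(2) ser_singleton_notin[of B G C H a] by simp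
  next
    case parallel
    have "a \<in> A" using net_subset[OF less.prems] by simp
    with parallel obtain B C G H
      where *: "net B G" "net C H" "B \<inter> C = {}" "A = B \<union> C" "F = par G H" "a \<in> B"
      by (rule parallel_netE')
    have G: "{a} \<in> G" using par_below_left[OF *(1-3)] less.prems(2) *(5,6) by simp
    have "finite A" "C \<noteq> {}" using net_ground *(1,2,4) by auto
    then have "card B < card A" using *(3,4) by (intro psubset_card_mono) auto
    from less.hyps[OF this *(1) G] consider "B = {a}" "G = {{a}}"
      | G' where "net (B - {a}) G'" "G = par {{a}} G'" by blast
    then show ?thesis
    proof cases
      case 1
      then have "A - {a} = C" using * by auto
      then show ?thesis using 1 * by auto
    next
      case 2
      have "net ((B - {a}) \<union> C) (par G' H)" using *(3) by (intro net.parallel[OF 2(1) *(2)]) auto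
      moreover have "(B - {a}) \<union> C = A - {a}" using *(3,4,6) by auto
      moreover have "F = par {{a}} (par G' H)" unfolding *(5) 2(2)
        using *(3,6) by (intro par_assoc[OF net.single 2(1) *(2)]) auto
      ultimately show ?thesis by auto
    qed
  qed
qed

section \<open>Recurrences for simple networks\<close>

definition simple_net :: "'a set set \<Rightarrow> bool" where
  "simple_net F \<longleftrightarrow> (\<forall>c\<in>symdiffs F. c \<noteq> {} \<longrightarrow> 3 \<le> card c)"

text \<open>For a simple network this is the condition to remain simple when a root edge joins its
  terminals.\<close>

definition no_single :: "'a set set \<Rightarrow> bool" where
  "no_single F \<longleftrightarrow> (\<forall>p\<in>F. 2 \<le> card p)"

text \<open>The dimension of the affine family, which is also that of its cycle space;
  \<open>card_net\<close> shows that the exponent exists for networks.\<close>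

definition nullity :: "'a set set \<Rightarrow> nat" where
  "nullity F = (THE d. card F = 2 ^ d)"

section \<open>Simplicity and nullity under composition\<close>

lemma symdiffs_ser:
  assumes "net A F" "net B G" "A \<inter> B = {}"
  shows "symdiffs (ser F G) = ser (symdiffs F) (symdiffs G)"
  using layer_ser[OF cosetD(1)[OF net_coset[OF assms(1)]] cosetD(1)[OF net_coset[OF assms(2)]] assms(3),
      of False] by simp

lemma symdiffs_par:
  assumes "net A F" "net B G" "A \<inter> B = {}"
  shows "symdiffs (par F G) = ser F G \<union> ser (symdiffs F) (symdiffs G)"
proof -
  have "symdiffs (par F G) = {p \<union> q |p q. \<exists>a b. p \<in> layer F a \<and> q \<in> layer G b \<and> (a \<noteq> b) = False}"
    using layer_par[OF net_coset[OF assms(1)] net_coset[OF assms(2)] assms(3), of False] by simp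
  also have "\<dots> = ser F G \<union> ser (symdiffs F) (symdiffs G)"
    unfolding ser_def by (simp add: ex_bool_eq) blast
  finally show ?thesis .
qed

lemma net_finite_elem: "net A F \<Longrightarrow> p \<in> layer F b \<Longrightarrow> finite p"
  using net_layer_subset net_ground finite_subset by metis

lemma empty_in_symdiffs_net: "net A F \<Longrightarrow> {} \<in> symdiffs F"
  by (rule empty_in_symdiffs[OF net_nonempty])

lemma net_card_pos: "net A F \<Longrightarrow> p \<in> F \<Longrightarrow> 1 \<le> card p"
  using net_finite_elem[of A F p True] net_empty_notin[of A F]
    by (cases "p = {}") (auto simp: Suc_le_eq card_gt_0_iff)

lemma card_Un_elem:
  assumes "net A F" "net B G" "A \<inter> B = {}" "p \<in> layer F a" "q \<in> layer G b"
  shows "card (p \<union> q) = card p + card q"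
proof (rule card_Un_disjoint)
  show "finite p" "finite q" using assms net_finite_elem by blast+
  show "p \<inter> q = {}" using net_layer_subset[OF assms(1,4)] net_layer_subset[OF assms(2,5)] assms(3)
    by blast
qed

lemma simple_net_ser:
  assumes F: "net A F" and G: "net B G" and disj: "A \<inter> B = {}"
  shows "simple_net (ser F G) \<longleftrightarrow> simple_net F \<and> simple_net G"
proof
  assume s: "simple_net (ser F G)"
  have *: "3 \<le> card (c \<union> d)" if "c \<in> symdiffs F" "d \<in> symdiffs G" "c \<union> d \<noteq> {}" for c d
  proof -
    have "\<forall>x\<in>ser (symdiffs F) (symdiffs G). x \<noteq> {} \<longrightarrow> 3 \<le> card x"
      using s unfolding simple_net_def symdiffs_ser[OF assms] .
    from bspec[OF this serI[OF that(1,2)]] that(3) show ?thesis by simp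
  qed
  have "3 \<le> card c" if "c \<in> symdiffs F" "c \<noteq> {}" for c
    using *[OF that(1) empty_in_symdiffs_net[OF G]] that(2) by simp
  moreover have "3 \<le> card d" if "d \<in> symdiffs G" "d \<noteq> {}" for d
    using *[OF empty_in_symdiffs_net[OF F] that(1)] that(2) by simp
  ultimately show "simple_net F \<and> simple_net G" unfolding simple_net_def by simp
next
  assume s: "simple_net F \<and> simple_net G"
  show "simple_net (ser F G)"
    unfolding simple_net_def symdiffs_ser[OF assms]
  proof (intro ballI impI)
    fix x assume "x \<in> ser (symdiffs F) (symdiffs G)" "x \<noteq> {}"
    then obtain c d where cd: "c \<in> symdiffs F" "d \<in> symdiffs G" "x = c \<union> d" by (elim serE)
    have "card x = card c + card d" unfolding cd(3)
      by (rule card_Un_elem[OF assms, of _ False _ False]) (simp_all add: cd)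
    moreover have "c \<noteq> {} \<or> d \<noteq> {}" using \<open>x \<noteq> {}\<close> cd(3) by simp
    then have "3 \<le> card c \<or> 3 \<le> card d" using s cd(1,2) unfolding simple_net_def by blast
    ultimately show "3 \<le> card x" by linarith
  qed
qed

lemma no_single_ser:
  assumes F: "net A F" and G: "net B G" and disj: "A \<inter> B = {}"
  shows "no_single (ser F G)"
  unfolding no_single_def
proof
  fix x assume "x \<in> ser F G"
  then obtain p q where pq: "p \<in> F" "q \<in> G" "x = p \<union> q" by (rule serE)
  have "card x = card p + card q" unfolding pq(3)
    by (rule card_Un_elem[OF assms, of _ True _ True]) (simp_all add: pq)
  then show "2 \<le> card x" using net_card_pos[OF F pq(1)] net_card_pos[OF G pq(2)] by linarith
qed

lemma no_single_series: "series_net A F \<Longrightarrow> no_single F"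
  using no_single_ser by (elim series_netE) simp

lemma no_single_iff: "net A F \<Longrightarrow> no_single F \<longleftrightarrow> (\<forall>a. {a} \<notin> F)"
proof
  assume "no_single F"
  then show "\<forall>a. {a} \<notin> F" unfolding no_single_def by fastforce
next
  assume F: "net A F" and ns: "\<forall>a. {a} \<notin> F"
  show "no_single F"
    unfolding no_single_def
  proof
    fix p assume p: "p \<in> F"
    then have "card p \<noteq> 1" using ns by (metis card_1_singletonE)
    then show "2 \<le> card p" using net_card_pos[OF F p] by linarith
  qed
qed

lemma no_single_par:
  assumes F: "net A F" and G: "net B G" and disj: "A \<inter> B = {}"
  shows "no_single (par F G) \<longleftrightarrow> no_single F \<and> no_single G"
proof
  assume "no_single (par F G)"
  then show "no_single F \<and> no_single G"
    using par_left[OF G] par_right[OF F] unfolding no_single_def by simp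
next
  assume s: "no_single F \<and> no_single G"
  show "no_single (par F G)"
    unfolding no_single_def
  proof
    fix x assume "x \<in> par F G"
    then obtain p q b where pq: "p \<in> layer F b" "q \<in> layer G (\<not> b)" "x = p \<union> q" by (rule parE)
    have c: "card x = card p + card q" unfolding pq(3) by (rule card_Un_elem[OF assms pq(1,2)])
    have "2 \<le> card p \<or> 2 \<le> card q" using s pq(1,2) unfolding no_single_def by (cases b) simp_all
    then show "2 \<le> card x" using c by linarith
  qed
qed

text \<open>The new cycles of a parallel composition are unions of one terminal set from each part;
  such a union has fewer than three elements only if both sets are singletons.\<close>

lemma simple_net_par:
  assumes F: "net A F" and G: "net B G" and disj: "A \<inter> B = {}"
  shows "simple_net (par F G) \<longleftrightarrow> simple_net F \<and> simple_net G \<and> (no_single F \<or> no_single G)"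
proof -
  have "simple_net (par F G) \<longleftrightarrow> simple_net (ser F G) \<and> (\<forall>c\<in>ser F G. c \<noteq> {} \<longrightarrow> 3 \<le> card c)"
    unfolding simple_net_def symdiffs_par[OF assms] symdiffs_ser[OF assms] by blast
  moreover have "(\<forall>c\<in>ser F G. c \<noteq> {} \<longrightarrow> 3 \<le> card c) \<longleftrightarrow> no_single F \<or> no_single G"
  proof
    assume l: "\<forall>c\<in>ser F G. c \<noteq> {} \<longrightarrow> 3 \<le> card c"
    show "no_single F \<or> no_single G"
    proof (rule ccontr)
      assume "\<not> (no_single F \<or> no_single G)"
      then obtain p q where pq: "p \<in> F" "q \<in> G" "card p < 2" "card q < 2"
        unfolding no_single_def by (auto simp: not_le)
      have "card (p \<union> q) = card p + card q"
        by (rule card_Un_elem[OF assms, of _ True _ True]) (simp_all add: pq)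
      then have "card (p \<union> q) = 2" using net_card_pos[OF F pq(1)] net_card_pos[OF G pq(2)] pq(3,4)
        by linarith
      moreover from this have "p \<union> q \<noteq> {}" by auto
      ultimately show False using l serI[OF pq(1,2)] by fastforce
    qed
  next
    assume r: "no_single F \<or> no_single G"
    show "\<forall>c\<in>ser F G. c \<noteq> {} \<longrightarrow> 3 \<le> card c"
    proof (intro ballI impI)
      fix x assume "x \<in> ser F G"
      then obtain p q where pq: "p \<in> F" "q \<in> G" "x = p \<union> q" by (rule serE)
      have "card x = card p + card q" unfolding pq(3)
        by (rule card_Un_elem[OF assms, of _ True _ True]) (simp_all add: pq)
      moreover have "2 \<le> card p \<or> 2 \<le> card q" using r pq(1,2) unfolding no_single_def by blast
      ultimately show "3 \<le> card x" using net_card_pos[OF F pq(1)] net_card_pos[OF G pq(2)]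
        by linarith
    qed
  qed
  ultimately show ?thesis using simple_net_ser[OF assms] by blast
qed

lemma simple_net_single: "simple_net {{a}}"
  unfolding simple_net_def by simp

lemma not_no_single_single: "\<not> no_single {{a}}"
  unfolding no_single_def by simp

lemma net_finite: "net A F \<Longrightarrow> finite F"
  using cosetD(1)[OF net_coset, of A F] net_ground[of A F] by (auto intro: finite_subset)

lemma card_symdiffs: "net A F \<Longrightarrow> card (symdiffs F) = card F"
proof -
  assume F: "net A F"
  obtain p0 where p0: "p0 \<in> F" using net_nonempty[OF F] by blast
  have "bij_betw (\<lambda>p. p0 \<triangle> p) F (symdiffs F)"
    unfolding bij_betw_def
  proof
    show "inj_on (\<lambda>p. p0 \<triangle> p) F" by (rule inj_on_inverseI[of _ "\<lambda>p. p0 \<triangle> p"]) (rule symdiff_cancel)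
    show "(\<lambda>p. p0 \<triangle> p) ` F = symdiffs F"
    proof (intro subset_antisym subsetI)
      fix c assume c: "c \<in> symdiffs F"
      have "p0 \<triangle> c \<in> F" using symdiff_layer[OF net_coset[OF F], of p0 True c False] p0 c by simp
      then show "c \<in> (\<lambda>p. p0 \<triangle> p) ` F"
        by (intro image_eqI[of _ _ "p0 \<triangle> c"]) (simp_all add: symdiff_cancel)
    qed (use p0 in \<open>auto intro: symdiffsI\<close>)
  qed
  then show ?thesis by (metis bij_betw_same_card)
qed

lemma card_ser:
  assumes "F \<subseteq> Pow A" "G \<subseteq> Pow B" "A \<inter> B = {}"
  shows "card (ser F G) = card F * card G"
proof -
  have "bij_betw (\<lambda>(p, q). p \<union> q) (F \<times> G) (ser F G)"
    unfolding bij_betw_def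
  proof
    show "inj_on (\<lambda>(p, q). p \<union> q) (F \<times> G)"
    proof (rule inj_onI, clarify)
      fix p q p' q' assume *: "p \<in> F" "q \<in> G" "p' \<in> F" "q' \<in> G" and eq: "p \<union> q = p' \<union> q'"
      have "p \<subseteq> A" "p' \<subseteq> A" "q \<subseteq> B" "q' \<subseteq> B" using * assms by blast+
      from ser_Un_eq[OF this assms(3) eq] show "p = p' \<and> q = q'" by simp
    qed
    show "(\<lambda>(p, q). p \<union> q) ` (F \<times> G) = ser F G" unfolding ser_def by auto
  qed
  then have "card (F \<times> G) = card (ser F G)" by (rule bij_betw_same_card)
  then show ?thesis by (simp add: card_cartesian_product)
qed

lemma card_ser_net: "net A F \<Longrightarrow> net B G \<Longrightarrow> A \<inter> B = {} \<Longrightarrow> card (ser F G) = card F * card G"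
  by (rule card_ser[OF cosetD(1)[OF net_coset] cosetD(1)[OF net_coset]])

text \<open>Each of the two parities contributes \<open>card F * card G\<close> sets, and the
  contributions are disjoint because the layers of \<open>F\<close> are. The factor 2 accounts for
  the additional independent cycle through both parts.\<close>

lemma card_par_net:
  assumes "net A F" "net B G" "A \<inter> B = {}"
  shows "card (par F G) = 2 * (card F * card G)"
proof -
  note FG = cosetD(1)[OF net_coset[OF assms(1)]] cosetD(1)[OF net_coset[OF assms(2)]]
  have sub: "symdiffs F \<subseteq> Pow A" "symdiffs G \<subseteq> Pow B"
    using layer_subset[OF FG(1), of _ False] layer_subset[OF FG(2), of _ False] by auto
  have eq: "par F G = ser F (symdiffs G) \<union> ser (symdiffs F) G"
    unfolding par_def ser_def by (simp add: ex_bool_eq) blast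
  have "ser F (symdiffs G) \<inter> ser (symdiffs F) G = {}"
  proof (rule ccontr)
    assume "ser F (symdiffs G) \<inter> ser (symdiffs F) G \<noteq> {}"
    then obtain x where x: "x \<in> ser F (symdiffs G)" "x \<in> ser (symdiffs F) G" by blast
    obtain p q where pq: "p \<in> F" "q \<in> symdiffs G" "x = p \<union> q" using x(1) by (rule serE)
    obtain p' q' where pq': "p' \<in> symdiffs F" "q' \<in> G" "x = p' \<union> q'" using x(2) by (rule serE)
    have "p \<subseteq> A" "p' \<subseteq> A" "q \<subseteq> B" "q' \<subseteq> B" using pq pq' FG sub by blast+
    from ser_Un_eq[OF this assms(3)] have "p = p'" using pq pq' by blast
    then show False using layers_disjoint[OF assms(1), of p True False] pq(1) pq'(1) by simp
  qed
  moreover have "finite (ser F (symdiffs G))" "finite (ser (symdiffs F) G)"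
    using net_finite[OF net.parallel[OF assms]] unfolding eq by simp_all
  ultimately show ?thesis
    unfolding eq using card_ser[OF FG(1) sub(2) assms(3)] card_ser[OF sub(1) FG(2) assms(3)]
    by (simp add: card_Un_disjoint card_symdiffs[OF assms(1)] card_symdiffs[OF assms(2)])
qed

lemma nullity_eq: "card F = 2 ^ d \<Longrightarrow> nullity F = d"
  unfolding nullity_def by simp

lemma card_net: "net A F \<Longrightarrow> card F = 2 ^ nullity F"
proof -
  assume "net A F"
  then have "\<exists>d. card F = 2 ^ d"
  proof (induction rule: net.induct)
    case (single a)
    show ?case by (intro exI[of _ 0]) simp
  next
    case (series A F B G)
    then obtain d e where "card F = 2 ^ d" "card G = 2 ^ e" by blast
    then show ?case by (intro exI[of _ "d + e"]) (simp add: card_ser_net[OF series.hyps] power_add)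
  next
    case (parallel A F B G)
    then obtain d e where "card F = 2 ^ d" "card G = 2 ^ e" by blast
    then show ?case by (intro exI[of _ "Suc (d + e)"]) (simp add: card_par_net[OF parallel.hyps] power_add)
  qed
  then show ?thesis using nullity_eq by blast
qed

lemma nullity_single: "nullity {{a}} = 0"
  by (rule nullity_eq) simp

lemma nullity_ser:
  assumes "net A F" "net B G" "A \<inter> B = {}"
  shows "nullity (ser F G) = nullity F + nullity G"
  by (rule nullity_eq) (simp add: card_ser_net[OF assms] card_net[OF assms(1)] card_net[OF assms(2)] power_add)

lemma nullity_par:
  assumes "net A F" "net B G" "A \<inter> B = {}"
  shows "nullity (par F G) = Suc (nullity F + nullity G)"
  by (rule nullity_eq) (simp add: card_par_net[OF assms] card_net[OF assms(1)] card_net[OF assms(2)] power_add)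

section \<open>Weighted sums over simple networks\<close>

definition net_sum :: "'b::comm_ring_1 \<Rightarrow> ('a set \<Rightarrow> 'a set set \<Rightarrow> bool) \<Rightarrow> 'a set \<Rightarrow> 'b" where
  "net_sum z P A = (\<Sum>F | net A F \<and> simple_net F \<and> P A F. z ^ nullity F)"

abbreviation "all_sum z \<equiv> net_sum z (\<lambda>A F. True)"
abbreviation "series_sum z \<equiv> net_sum z series_net"
abbreviation "nonseries_sum z \<equiv> net_sum z (\<lambda>A F. \<not> series_net A F)"
abbreviation "no_single_sum z \<equiv> net_sum z (\<lambda>A F. no_single F)"

lemma finite_nets: "finite {F. net A F \<and> P F}"
proof (cases "finite A")
  case True
  have "{F. net A F \<and> P F} \<subseteq> Pow (Pow A)" using cosetD(1)[OF net_coset] by blast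
  then show ?thesis by (rule finite_subset) (simp add: True)
next
  case False
  then have "{F. net A F \<and> P F} = {}" using net_ground by blast
  then show ?thesis by (simp only: finite.emptyI)
qed

lemma net_sum_empty: "net_sum z P {} = 0"
proof -
  have "{F. net {} F \<and> simple_net F \<and> P {} F} = {}" using net_ground by blast
  then show ?thesis unfolding net_sum_def by (simp only: sum.empty)
qed

lemma nonseries_sum: "nonseries_sum z A = all_sum z A - series_sum z A"
proof -
  have "all_sum z A = (\<Sum>F\<in>{F. net A F \<and> simple_net F \<and> series_net A F} \<union>
      {F. net A F \<and> simple_net F \<and> \<not> series_net A F}. z ^ nullity F)"
    unfolding net_sum_def by (rule sum.cong) auto
  also have "\<dots> = series_sum z A + nonseries_sum z A"
    unfolding net_sum_def by (intro sum.union_disjoint finite_nets) auto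
  finally show ?thesis by simp
qed

text \<open>Abstract form of the two decompositions: \<open>X\<close> is the ground of the part
  containing \<open>a\<close>, \<open>f\<close> is the composition, and \<open>c\<close> its
  additional nullity, 0 for series and 1 for parallel.\<close>

lemma sum_factor:
  fixes z :: "'b::comm_ring_1"
  assumes fin: "finite A" "\<And>X. finite (P X)" "\<And>X. finite (Q X)"
    and bij: "bij_betw (\<lambda>(X, G, H). f G H) (SIGMA X:{X. a \<in> X \<and> X \<subseteq> A}. P X \<times> Q X) S"
    and nul: "\<And>X G H. a \<in> X \<Longrightarrow> X \<subseteq> A \<Longrightarrow> G \<in> P X \<Longrightarrow> H \<in> Q X \<Longrightarrow>
      nullity (f G H) = c + nullity G + nullity H"
  shows "(\<Sum>F\<in>S. z ^ nullity F) =
    (\<Sum>X | a \<in> X \<and> X \<subseteq> A. z ^ c * (\<Sum>G\<in>P X. z ^ nullity G) * (\<Sum>H\<in>Q X. z ^ nullity H))"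
proof -
  let ?I = "{X. a \<in> X \<and> X \<subseteq> A}"
  have finI: "finite ?I" by (rule finite_subset[of _ "Pow A"]) (use fin in auto)
  have "(\<Sum>F\<in>S. z ^ nullity F) = (\<Sum>t\<in>(SIGMA X:?I. P X \<times> Q X). z ^ nullity ((\<lambda>(X, G, H). f G H) t))"
    using bij by (rule sum.reindex_bij_betw[symmetric])
  also have "\<dots> = (\<Sum>(X, t)\<in>(SIGMA X:?I. P X \<times> Q X). z ^ nullity (f (fst t) (snd t)))"
    by (intro sum.cong refl) (simp add: case_prod_beta)
  also have "\<dots> = (\<Sum>X\<in>?I. \<Sum>t\<in>P X \<times> Q X. z ^ nullity (f (fst t) (snd t)))"
    using finI fin by (intro sum.Sigma[symmetric]) auto
  also have "\<dots> = (\<Sum>X\<in>?I. z ^ c * (\<Sum>G\<in>P X. z ^ nullity G) * (\<Sum>H\<in>Q X. z ^ nullity H))"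
  proof (rule sum.cong[OF refl])
    fix X assume X: "X \<in> ?I"
    have "(\<Sum>t\<in>P X \<times> Q X. z ^ nullity (f (fst t) (snd t))) =
        (\<Sum>(G, H)\<in>P X \<times> Q X. z ^ c * (z ^ nullity G * z ^ nullity H))"
      using X by (intro sum.cong refl) (auto simp: nul power_add mult.assoc)
    also have "\<dots> = z ^ c * (\<Sum>G\<in>P X. \<Sum>H\<in>Q X. z ^ nullity G * z ^ nullity H)"
      by (simp add: sum.cartesian_product sum_distrib_left case_prod_beta)
    finally show "(\<Sum>t\<in>P X \<times> Q X. z ^ nullity (f (fst t) (snd t))) =
        z ^ c * (\<Sum>G\<in>P X. z ^ nullity G) * (\<Sum>H\<in>Q X. z ^ nullity H)"
      by (simp add: sum_product mult.assoc)
  qed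
  finally show ?thesis .
qed

text \<open>The factor containing \<open>a\<close> exists and is non-series by
  \<open>series_net_decomp\<close>, and it is unique by \<open>ser_unique\<close>; the rest is an
  arbitrary simple network. The term \<open>X = A\<close> vanishes since networks have nonempty
  ground.\<close>

lemma series_sum_rec:
  fixes z :: "'b::comm_ring_1"
  assumes "finite A" "a \<in> A"
  shows "series_sum z A = (\<Sum>X | a \<in> X \<and> X \<subseteq> A. nonseries_sum z X * all_sum z (A - X))"
proof -
  let ?P = "\<lambda>X. {G. net X G \<and> simple_net G \<and> \<not> series_net X G}"
  let ?Q = "\<lambda>X. {H. net (A - X) H \<and> simple_net H \<and> True}"
  let ?S = "{F. net A F \<and> simple_net F \<and> series_net A F}"
  have disj: "X \<inter> (A - X) = {}" for X by blast
  have un: "X \<union> (A - X) = A" if "X \<subseteq> A" for X using that by blast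
  have "bij_betw (\<lambda>(X, G, H). ser G H) (SIGMA X:{X. a \<in> X \<and> X \<subseteq> A}. ?P X \<times> ?Q X) ?S"
    unfolding bij_betw_def
  proof
    show "inj_on (\<lambda>(X, G, H). ser G H) (SIGMA X:{X. a \<in> X \<and> X \<subseteq> A}. ?P X \<times> ?Q X)"
    proof (rule inj_onI)
      fix s t assume s: "s \<in> (SIGMA X:{X. a \<in> X \<and> X \<subseteq> A}. ?P X \<times> ?Q X)"
        and t: "t \<in> (SIGMA X:{X. a \<in> X \<and> X \<subseteq> A}. ?P X \<times> ?Q X)"
        and eq: "(case s of (X, G, H) \<Rightarrow> ser G H) = (case t of (X, G, H) \<Rightarrow> ser G H)"
      obtain X G H where s': "s = (X, G, H)" by (cases s)
      obtain X' G' H' where t': "t = (X', G', H')" by (cases t)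
      have *: "net X G" "net (A - X) H" "net X' G'" "net (A - X') H'" "X \<subseteq> A" "X' \<subseteq> A"
        "a \<in> X" "a \<in> X'" "\<not> series_net X G" "\<not> series_net X' G'" "ser G H = ser G' H'"
        using s t eq s' t' by simp_all
      from ser_unique[OF *] show "s = t" using s' t' by simp
    qed
    show "(\<lambda>(X, G, H). ser G H) ` (SIGMA X:{X. a \<in> X \<and> X \<subseteq> A}. ?P X \<times> ?Q X) = ?S"
    proof (intro subset_antisym subsetI)
      fix F assume "F \<in> (\<lambda>(X, G, H). ser G H) ` (SIGMA X:{X. a \<in> X \<and> X \<subseteq> A}. ?P X \<times> ?Q X)"
      then obtain X G H where *: "X \<subseteq> A" "net X G" "simple_net G" "net (A - X) H" "simple_net H" "F = ser G H"
        by auto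
      have "series_net A F" unfolding series_net_def
        using * disj[of X] un[of X]
          by (intro exI[of _ X] exI[of _ "A - X"] exI[of _ G] exI[of _ H]) simp
      then show "F \<in> ?S" using * simple_net_ser[OF *(2,4) disj] series_net_net by blast
    next
      fix F assume F: "F \<in> ?S"
      then have "series_net A F" "simple_net F" by simp_all
      from series_net_decomp[OF this(1) assms(2)] obtain X G H where *: "a \<in> X" "X \<subseteq> A" "net X G"
        "\<not> series_net X G" "net (A - X) H" "F = ser G H" by blast
      have "simple_net G" "simple_net H" using simple_net_ser[OF *(3,5) disj] *(6) \<open>simple_net F\<close>
        by simp_all
      then show "F \<in> (\<lambda>(X, G, H). ser G H) ` (SIGMA X:{X. a \<in> X \<and> X \<subseteq> A}. ?P X \<times> ?Q X)"
        using * by (intro image_eqI[of _ _ "(X, G, H)"]) simp_all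
    qed
  qed
  note bij = this
  have nul: "nullity (ser G H) = 0 + nullity G + nullity H"
    if "a \<in> X" "X \<subseteq> A" "G \<in> ?P X" "H \<in> ?Q X" for X G H
  proof -
    have "net X G" "net (A - X) H" using that by simp_all
    from nullity_ser[OF this disj] show ?thesis by simp
  qed
  have "(\<Sum>F\<in>?S. z ^ nullity F) =
    (\<Sum>X | a \<in> X \<and> X \<subseteq> A. z ^ 0 * (\<Sum>G\<in>?P X. z ^ nullity G) * (\<Sum>H\<in>?Q X. z ^ nullity H))"
    by (rule sum_factor[OF assms(1) finite_nets finite_nets bij nul])
  then show ?thesis unfolding net_sum_def by simp
qed

text \<open>The network is a series composition or a parallel one. In the latter case the part
  containing \<open>a\<close> is a series composition, and the rest again has no one-element path;
  so the simplicity condition of \<open>par\<close> holds by itself.\<close>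

lemma no_single_sum_rec:
  fixes z :: "'b::comm_ring_1"
  assumes "finite A" "a \<in> A"
  shows "no_single_sum z A = series_sum z A +
    (\<Sum>X | a \<in> X \<and> X \<subseteq> A. z * series_sum z X * no_single_sum z (A - X))"
proof -
  let ?P = "\<lambda>X. {G. net X G \<and> simple_net G \<and> series_net X G}"
  let ?Q = "\<lambda>X. {H. net (A - X) H \<and> simple_net H \<and> no_single H}"
  let ?S = "{F. net A F \<and> simple_net F \<and> no_single F \<and> parallel_net A F}"
  have disj: "X \<inter> (A - X) = {}" for X by blast
  have un: "X \<union> (A - X) = A" if "X \<subseteq> A" for X using that by blast
  have "bij_betw (\<lambda>(X, G, H). par G H) (SIGMA X:{X. a \<in> X \<and> X \<subseteq> A}. ?P X \<times> ?Q X) ?S"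
    unfolding bij_betw_def
  proof
    show "inj_on (\<lambda>(X, G, H). par G H) (SIGMA X:{X. a \<in> X \<and> X \<subseteq> A}. ?P X \<times> ?Q X)"
    proof (rule inj_onI)
      fix s t assume s: "s \<in> (SIGMA X:{X. a \<in> X \<and> X \<subseteq> A}. ?P X \<times> ?Q X)"
        and t: "t \<in> (SIGMA X:{X. a \<in> X \<and> X \<subseteq> A}. ?P X \<times> ?Q X)"
        and eq: "(case s of (X, G, H) \<Rightarrow> par G H) = (case t of (X, G, H) \<Rightarrow> par G H)"
      obtain X G H where s': "s = (X, G, H)" by (cases s)
      obtain X' G' H' where t': "t = (X', G', H')" by (cases t)
      have *: "series_net X G" "net (A - X) H" "series_net X' G'" "net (A - X') H'" "X \<subseteq> A" "X' \<subseteq> A"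
        "a \<in> X" "a \<in> X'" "par G H = par G' H'"
        using s t eq s' t' by simp_all
      from par_unique[OF *] show "s = t" using s' t' by simp
    qed
    show "(\<lambda>(X, G, H). par G H) ` (SIGMA X:{X. a \<in> X \<and> X \<subseteq> A}. ?P X \<times> ?Q X) = ?S"
    proof (intro subset_antisym subsetI)
      fix F assume "F \<in> (\<lambda>(X, G, H). par G H) ` (SIGMA X:{X. a \<in> X \<and> X \<subseteq> A}. ?P X \<times> ?Q X)"
      then obtain X G H where *: "X \<subseteq> A" "net X G" "simple_net G" "series_net X G"
        "net (A - X) H" "simple_net H" "no_single H" "F = par G H"
        by auto
      have "parallel_net A F" unfolding parallel_net_def
        using * disj[of X] un[of X]
          by (intro exI[of _ X] exI[of _ "A - X"] exI[of _ G] exI[of _ H]) simp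
      then show "F \<in> ?S"
        using * simple_net_par[OF *(2,5) disj] no_single_par[OF *(2,5) disj] no_single_series[OF *(4)]
          parallel_net_net[of A F] by simp
    next
      fix F assume F: "F \<in> ?S"
      then have F': "parallel_net A F" "simple_net F" "no_single F" by simp_all
      have "{a} \<notin> F" using F'(3) no_single_iff[OF parallel_net_net[OF F'(1)]] by blast
      from parallel_net_decomp[OF F'(1) assms(2) this] obtain X G H where *: "a \<in> X" "X \<subseteq> A"
        "series_net X G" "net (A - X) H" "F = par G H" by blast
      note G = series_net_net[OF *(3)]
      have "simple_net G" "simple_net H" using simple_net_par[OF G *(4) disj] *(5) F'(2) by simp_all
      moreover have "no_single H" using no_single_par[OF G *(4) disj] *(5) F'(3) by simp
      ultimately show "F \<in> (\<lambda>(X, G, H). par G H) ` (SIGMA X:{X. a \<in> X \<and> X \<subseteq> A}. ?P X \<times> ?Q X)"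
        using * G by (intro image_eqI[of _ _ "(X, G, H)"]) simp_all
    qed
  qed
  note bij = this
  have nul: "nullity (par G H) = 1 + nullity G + nullity H"
    if "a \<in> X" "X \<subseteq> A" "G \<in> ?P X" "H \<in> ?Q X" for X G H
  proof -
    have "net X G" "net (A - X) H" using that by simp_all
    from nullity_par[OF this disj] show ?thesis by simp
  qed
  have par: "(\<Sum>F\<in>?S. z ^ nullity F) =
    (\<Sum>X | a \<in> X \<and> X \<subseteq> A. z ^ 1 * (\<Sum>G\<in>?P X. z ^ nullity G) * (\<Sum>H\<in>?Q X. z ^ nullity H))"
    by (rule sum_factor[OF assms(1) finite_nets finite_nets bij nul])
  have "{F. net A F \<and> simple_net F \<and> no_single F} = {F. net A F \<and> simple_net F
    \<and> series_net A F} \<union> ?S"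
  proof (intro subset_antisym subsetI)
    fix F assume F: "F \<in> {F. net A F \<and> simple_net F \<and> no_single F}"
    then have "net A F" by simp
    then show "F \<in> {F. net A F \<and> simple_net F \<and> series_net A F} \<union> ?S"
      using F by (cases rule: net_cases) (auto simp: not_no_single_single)
  qed (auto intro: no_single_series)
  then have "no_single_sum z A = (\<Sum>F\<in>{F. net A F \<and> simple_net F
    \<and> series_net A F} \<union> ?S. z ^ nullity F)"
    unfolding net_sum_def by simp
  also have "\<dots> = series_sum z A + (\<Sum>F\<in>?S. z ^ nullity F)"
    unfolding net_sum_def using series_not_parallel by (intro sum.union_disjoint finite_nets) auto
  finally show ?thesis unfolding par unfolding net_sum_def by simp
qed

text \<open>A simple network has at most one path of the form \<open>{a}\<close>. That path is the
  whole network, or it is in parallel with a network free of one-element paths.\<close>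

lemma all_sum_rec:
  fixes z :: "'b::comm_ring_1" and A :: "'a set"
  assumes "finite A"
  shows "all_sum z A = no_single_sum z A + (\<Sum>a\<in>A. (if A
    = {a} then 1 else 0) + z * no_single_sum z (A - {a}))"
proof -
  let ?N = "{F. net A F \<and> simple_net F}"
  let ?T = "\<lambda>a. {F. net A F \<and> simple_net F \<and> {a} \<in> F}"
  let ?Q = "\<lambda>a. {H. net (A - {a}) H \<and> simple_net H \<and> no_single H}"
  have T: "(\<Sum>F\<in>?T a. z ^ nullity F) = (if A = {a} then 1 else 0) + z * no_single_sum z (A - {a})"
    if a: "a \<in> A" for a
  proof -
    have disj: "{a} \<inter> (A - {a}) = {}" by blast
    have un: "{a} \<union> (A - {a}) = A" using a by blast
    let ?J = "if A = {a} then {{{a}}} else {}"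
    have eq: "?T a = ?J \<union> par {{a}} ` ?Q a"
    proof (intro subset_antisym subsetI)
      fix F assume F: "F \<in> ?T a"
      then have F': "net A F" "simple_net F" "{a} \<in> F" by simp_all
      from net_singleton_decomp[OF F'(1,3)] consider "A = {a}" "F = {{a}}"
        | H where "net (A - {a}) H" "F = par {{a}} H" by blast
      then show "F \<in> ?J \<union> par {{a}} ` ?Q a"
      proof cases
        case 1 then show ?thesis by simp
      next
        case 2
        have "simple_net H" "no_single H"
          using simple_net_par[OF net.single 2(1) disj] F'(2) 2(2) not_no_single_single[of a]
            by simp_all
        then show ?thesis using 2 by simp
      qed
    next
      fix F assume "F \<in> ?J \<union> par {{a}} ` ?Q a"
      then consider "A = {a}" "F = {{a}}" | H where "H \<in> ?Q a" "F = par {{a}} H"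
        by (auto split: if_splits)
      then show "F \<in> ?T a"
      proof cases
        case 1 then show ?thesis using net.single[of a] simple_net_single[of a] by simp
      next
        case 2
        then have H: "net (A - {a}) H" "simple_net H" "no_single H" by simp_all
        have "net A F" using net.parallel[OF net.single H(1) disj] 2(2) un by simp
        moreover have "simple_net F"
          using simple_net_par[OF net.single H(1) disj] H 2(2) simple_net_single[of a] by simp
        moreover have "{a} \<in> F" unfolding 2(2) by (rule par_left[OF H(1)]) simp
        ultimately show ?thesis by simp
      qed
    qed
    have "?Q a = {}" if "A = {a}" using that net_ground[of "{}"] by auto
    then have "?J \<inter> par {{a}} ` ?Q a = {}"
      by (cases "A = {a}") (simp_all only: image_empty Int_empty_right if_False Int_empty_left)
    then have "(\<Sum>F\<in>?T a. z ^ nullity F) = (\<Sum>F\<in>?J. z ^ nullity F) +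
      (\<Sum>F\<in>par {{a}} ` ?Q a. z ^ nullity F)"
      unfolding eq by (intro sum.union_disjoint finite_imageI finite_nets) simp
    also have "(\<Sum>F\<in>?J. z ^ nullity F) = (if A = {a} then 1 else 0)" by (simp add: nullity_single)
    also have "(\<Sum>F\<in>par {{a}} ` ?Q a. z ^ nullity F) = (\<Sum>H\<in>?Q a. z ^ nullity (par {{a}} H))"
    proof (rule sum.reindex[unfolded comp_def], rule inj_onI)
      fix H H' assume *: "H \<in> ?Q a" "H' \<in> ?Q a" "par {{a}} H = par {{a}} H'"
      then show "H = H'"
        using par_restrict(2)[OF net.single _ disj, of H] par_restrict(2)[OF net.single _ disj, of H'] by simp
    qed
    also have "\<dots> = (\<Sum>H\<in>?Q a. z * z ^ nullity H)"
      by (intro sum.cong refl) (simp add: nullity_par[OF net.single _ disj] nullity_single)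
    finally show ?thesis unfolding net_sum_def by (simp add: sum_distrib_left)
  qed
  have "?N = {F. net A F \<and> simple_net F \<and> no_single F} \<union> (\<Union>a\<in>A. ?T a)"
  proof (intro subset_antisym subsetI)
    fix F assume F: "F \<in> ?N"
    show "F \<in> {F. net A F \<and> simple_net F \<and> no_single F} \<union> (\<Union>a\<in>A. ?T a)"
    proof (cases "no_single F")
      case True then show ?thesis using F by simp
    next
      case False
      then obtain a where "{a} \<in> F" using F no_single_iff by blast
      moreover from this have "a \<in> A" using F net_subset by blast
      ultimately show ?thesis using F by blast
    qed
  qed auto
  then have "all_sum z A = (\<Sum>F\<in>{F. net A F \<and> simple_net F
    \<and> no_single F} \<union> (\<Union>a\<in>A. ?T a). z ^ nullity F)"
    unfolding net_sum_def by simp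
  also have "\<dots> = no_single_sum z A + (\<Sum>F\<in>(\<Union>a\<in>A. ?T a). z ^ nullity F)"
    unfolding net_sum_def
  proof (intro sum.union_disjoint finite_nets)
    show "finite (\<Union>a\<in>A. ?T a)" using assms by (intro finite_UN_I finite_nets)
    show "{F. net A F \<and> simple_net F \<and> no_single F} \<inter> (\<Union>a\<in>A. ?T a) = {}"
      using no_single_iff by blast
  qed
  also have "(\<Sum>F\<in>(\<Union>a\<in>A. ?T a). z ^ nullity F) = (\<Sum>a\<in>A. \<Sum>F\<in>?T a. z ^ nullity F)"
  proof (intro sum.UNION_disjoint assms ballI impI)
    show "finite (?T a)" for a by (rule finite_nets)
    fix a b :: 'a assume "a \<noteq> b"
    show "?T a \<inter> ?T b = {}"
    proof (rule ccontr)
      assume "?T a \<inter> ?T b \<noteq> {}"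
      \<comment> \<open>Two distinct one-element paths would form a cycle of length 2.\<close>
      then obtain F where F: "simple_net F" "{a} \<in> F" "{b} \<in> F" by blast
      have "{a} \<triangle> {b} \<in> symdiffs F" using F by (intro symdiffsI)
      moreover have "{a} \<triangle> {b} = {a, b}" using \<open>a \<noteq> b\<close> by auto
      ultimately have "3 \<le> card {a, b}" using F(1) unfolding simple_net_def by simp
      then show False by (simp add: card_insert_if split: if_splits)
    qed
  qed
  finally show ?thesis using T by simp
qed

section \<open>Lagrange inversion\<close>

unbundle fps_syntax

text \<open>\<open>fps_inv f\<close> is a left inverse of \<open>f\<close> and \<open>g\<close> is a
  right inverse, so they coincide.\<close>

lemma fps_compose_inverse_swap:
  fixes f g :: "'a::field fps"
  assumes "f $ 0 = 0" "g $ 0 = 0" and fg: "f oo g = fps_X"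
  shows "g oo f = fps_X"
proof -
  have "(f oo g) $ 1 = f $ 1 * g $ 1" by (simp add: fps_compose_nth assms(1))
  then have f1: "f $ 1 \<noteq> 0" using fg by auto
  have "g = (fps_inv f oo f) oo g" using fps_inv[OF assms(1) f1] assms(2) by simp
  also have "\<dots> = fps_inv f oo (f oo g)" by (rule fps_compose_assoc[symmetric, OF assms(2,1)])
  finally have "g = fps_inv f" using fg by simp
  then show ?thesis using fps_inv[OF assms(1) f1] by simp
qed

text \<open>With \<open>\<chi> = fps_X * \<psi>\<close> this coefficient is the residue of the
  derivative of \<open>\<chi> ^ i\<close> divided by \<open>\<chi> ^ m\<close>: for
  \<open>i \<noteq> m\<close> the quotient is itself a derivative, for \<open>i = m\<close> it is
  \<open>m\<close> times a logarithmic derivative. The argument is carried out in power series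
  only.\<close>

lemma lagrange_power_coeff:
  fixes \<psi> :: "'a::field_char_0 fps"
  assumes \<psi>: "\<psi> $ 0 \<noteq> 0" and i: "1 \<le> i" "i \<le> m"
  shows "(fps_deriv ((fps_X * \<psi>) ^ i) * inverse \<psi> ^ m) $ (m - 1) = (if i = m then of_nat m else 0)"
proof -
  define \<phi> where "\<phi> = inverse \<psi>"
  define s where "s = m - i"
  have m: "m = i + s" using i by (simp add: s_def)
  obtain i' where i': "i = Suc i'" using i by (cases i) auto
  have one: "\<psi> * \<phi> = 1" using \<psi> by (simp add: \<phi>_def inverse_mult_eq_1')
  have pow: "\<psi> ^ n * \<phi> ^ n = 1" for n by (simp add: one flip: power_mult_distrib)
  have 1: "\<psi> ^ i * \<phi> ^ m = \<phi> ^ s" using pow[of i] by (simp add: m power_add flip: mult.assoc)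
  have 2: "\<psi> ^ i' * \<phi> ^ m = \<phi> ^ Suc s"
    using pow[of i'] by (simp add: m i' power_add algebra_simps)
  have deriv: "fps_deriv ((fps_X * \<psi>) ^ i)
    = of_nat i * (\<psi> + fps_X * fps_deriv \<psi>) * (fps_X ^ i' * \<psi> ^ i')"
    by (subst fps_deriv_power') (simp add: i' power_mult_distrib algebra_simps)
  have "fps_deriv ((fps_X * \<psi>) ^ i) * \<phi> ^ m =
      of_nat i * (fps_X ^ i' * (\<psi> ^ i * \<phi> ^ m + fps_X * fps_deriv \<psi> * (\<psi> ^ i' * \<phi> ^ m)))"
    unfolding deriv by (simp add: i' algebra_simps)
  also have "\<dots> = of_nat i * (fps_X ^ i' * (\<phi> ^ s + fps_X * (fps_deriv \<psi> * \<phi> ^ Suc s)))"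
    unfolding 1 2 by (simp add: mult.assoc)
  finally have eq: "(fps_deriv ((fps_X * \<psi>) ^ i) * \<phi> ^ m) $ (m - 1) =
      of_nat i * (\<phi> ^ s + fps_X * (fps_deriv \<psi> * \<phi> ^ Suc s)) $ s"
    using m i' by (simp add: fps_X_power_mult_nth flip: fps_of_nat)
  show ?thesis
  proof (cases "s = 0")
    case True
    then show ?thesis using eq m by (simp flip: \<phi>_def)
  next
    case False
    \<comment> \<open>The second summand is \<open>- 1 / s\<close> times \<open>x\<close> times the
      derivative of \<open>\<phi> ^ s\<close>. Since \<open>x\<close> times a derivative multiplies
      the coefficient at \<open>s\<close> by \<open>s\<close>, the two summands cancel
      there.\<close>
    have "fps_deriv \<phi> = - fps_deriv \<psi> * \<phi>\<^sup>2" unfolding \<phi>_def using \<psi> by (rule fps_inverse_deriv)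
    moreover obtain t where t: "s = Suc t" using False by (cases s) auto
    moreover have "fps_deriv (\<phi> ^ s) = of_nat s * fps_deriv \<phi> * \<phi> ^ (s - 1)"
      by (rule fps_deriv_power')
    ultimately have "fps_deriv (\<phi> ^ s) = - (of_nat s * (fps_deriv \<psi> * \<phi> ^ Suc s))"
      by (simp add: power2_eq_square algebra_simps)
    then have "fps_X * fps_deriv (\<phi> ^ s)
      = - (fps_const (of_nat s) * (fps_X * (fps_deriv \<psi> * \<phi> ^ Suc s)))"
      by (simp only: fps_of_nat mult_minus_right mult.left_commute)
    then have L: "(fps_X * fps_deriv (\<phi> ^ s)) $ s
      = - (of_nat s * (fps_X * (fps_deriv \<psi> * \<phi> ^ Suc s)) $ s)"
      by (simp only: fps_neg_nth fps_mult_left_const_nth)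
    have R: "(fps_X * fps_deriv (\<phi> ^ s)) $ s = of_nat s * (\<phi> ^ s) $ s"
      by (simp only: fps_mult_fps_X_deriv_shift fps_nth_Abs_fps)
    have "of_nat s * ((\<phi> ^ s) $ s + (fps_X * (fps_deriv \<psi> * \<phi> ^ Suc s)) $ s) = 0"
      by (simp only: distrib_left trans[OF R[symmetric] L]) simp
    then have "(\<phi> ^ s + fps_X * (fps_deriv \<psi> * \<phi> ^ Suc s)) $ s = 0"
      using False by (simp only: fps_add_nth mult_eq_0_iff of_nat_eq_0_iff) simp
    then show ?thesis using eq m False by (simp flip: \<phi>_def)
  qed
qed

text \<open>With \<open>h = H oo f\<close> one has \<open>H = h oo \<chi>\<close>, so linearity in
  \<open>h\<close> reduces the claim to the powers of \<open>\<chi>\<close> up to \<open>m\<close>,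
  treated in \<open>lagrange_power_coeff\<close>.\<close>

theorem lagrange_inversion:
  fixes \<psi> f H :: "'a::field_char_0 fps"
  assumes \<psi>: "\<psi> $ 0 \<noteq> 0" and f: "f $ 0 = 0" and inv: "(fps_X * \<psi>) oo f = fps_X" and m: "1 \<le> m"
  shows "of_nat m * (H oo f) $ m = (fps_deriv H * inverse \<psi> ^ m) $ (m - 1)"
proof -
  define \<chi> where "\<chi> = fps_X * \<psi>"
  have \<chi>0: "\<chi> $ 0 = 0" by (simp add: \<chi>_def)
  have f\<chi>: "f oo \<chi> = fps_X"
    using fps_compose_inverse_swap[OF \<chi>0 f] inv by (simp add: \<chi>_def)
  define h where "h = H oo f"
  define r where "r = fps_shift (Suc m) h"
  have H: "H = h oo \<chi>" using f\<chi> by (simp add: h_def fps_compose_assoc[OF \<chi>0 f, symmetric])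
  \<comment> \<open>The tail is divisible by \<open>fps_X ^ Suc m\<close>; after composition and
    differentiation a factor \<open>fps_X ^ m\<close> survives, which does not reach the coefficient
    at \<open>m - 1\<close>.\<close>
  have "h = fps_X ^ Suc m * r + (\<Sum>i\<le>m. fps_const (h $ i) * fps_X ^ i)"
  proof (rule fps_ext)
    fix n
    have "(\<Sum>i\<le>m. fps_const (h $ i) * fps_X ^ i) $ n = (if n \<le> m then h $ n else 0)"
      by (auto simp: fps_sum_nth fps_X_power_iff if_distrib[of "\<lambda>x. _ * x"] sum.delta cong: if_cong)
    then show "h $ n = (fps_X ^ Suc m * r + (\<Sum>i\<le>m. fps_const (h $ i) * fps_X ^ i)) $ n"
      by (simp add: r_def fps_X_power_mult_nth del: power_Suc)
  qed
  then have "H = (fps_X ^ Suc m * r + (\<Sum>i\<le>m. fps_const (h $ i) * fps_X ^ i)) oo \<chi>" using H by simp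
  also have "\<dots> = \<chi> ^ Suc m * (r oo \<chi>) + (\<Sum>i\<le>m. fps_const (h $ i) * \<chi> ^ i)"
    by (simp add: fps_compose_add_distrib fps_compose_mult_distrib[OF \<chi>0] fps_compose_sum_distrib
        fps_compose_power[OF \<chi>0, symmetric] \<chi>0 del: power_Suc)
  finally have H': "H = \<chi> ^ Suc m * (r oo \<chi>) + (\<Sum>i\<le>m. fps_const (h $ i) * \<chi> ^ i)" .
  define R where "R = fps_const (of_nat (Suc m)) * fps_deriv \<chi> * \<psi> ^ m * (r oo \<chi>) + fps_X * \<psi> ^ Suc m * fps_deriv (r oo \<chi>)"
  have "fps_deriv (\<chi> ^ Suc m) = fps_const (of_nat (Suc m)) * fps_deriv \<chi> * \<chi> ^ m"
    by (simp only: fps_deriv_power diff_Suc_1)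
  moreover have "\<chi> ^ n = fps_X ^ n * \<psi> ^ n" for n by (simp add: \<chi>_def power_mult_distrib)
  ultimately have R: "fps_deriv (\<chi> ^ Suc m * (r oo \<chi>)) = fps_X ^ m * R"
    unfolding fps_deriv_mult R_def by (simp only:) (simp add: algebra_simps)
  have "fps_deriv H = fps_deriv (\<chi> ^ Suc m * (r oo \<chi>)) + fps_deriv (\<Sum>i\<le>m. fps_const (h $ i)
    * \<chi> ^ i)"
    by (subst H') (rule fps_deriv_add)
  also have "\<dots> = fps_X ^ m * R + (\<Sum>i\<le>m. fps_const (h $ i) * fps_deriv (\<chi> ^ i))"
    by (simp only: R fps_deriv_sum fps_deriv_mult_const_left)
  finally have "(fps_deriv H * inverse \<psi> ^ m) $ (m - 1) =
     (fps_X ^ m * (R * inverse \<psi> ^ m)) $ (m - 1) +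
     (\<Sum>i\<le>m. h $ i * (fps_deriv (\<chi> ^ i) * inverse \<psi> ^ m) $ (m - 1))"
    by (simp add: distrib_right sum_distrib_right fps_sum_nth mult.assoc)
  also have "(fps_X ^ m * (R * inverse \<psi> ^ m)) $ (m - 1) = 0"
    using m by (simp add: fps_X_power_mult_nth)
  also have "(\<Sum>i\<le>m. h $ i * (fps_deriv (\<chi> ^ i) * inverse \<psi> ^ m) $ (m - 1)) =
      (\<Sum>i\<le>m. if i = m then h $ m * of_nat m else 0)"
  proof (rule sum.cong[OF refl])
    fix i assume "i \<in> {..m}"
    then show "h $ i * (fps_deriv (\<chi> ^ i) * inverse \<psi> ^ m) $ (m - 1) = (if i
      = m then h $ m * of_nat m else 0)"
      using lagrange_power_coeff[OF \<psi>, of i m] m by (cases "i = 0") (auto simp: \<chi>_def)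
  qed
  finally show ?thesis by (simp add: h_def mult.commute)
qed

text \<open>Powers of \<open>\<kappa>\<close> above \<open>n\<close> have no coefficient at
  \<open>n\<close>, so the sum may stop at any \<open>K \<ge> n\<close>. The free bound is fixed
  only in the final theorem.\<close>

lemma fps_mult_compose_nth:
  fixes U a \<kappa> :: "'a::comm_ring_1 fps"
  assumes "\<kappa> $ 0 = 0" "n \<le> K"
  shows "(U * (a oo \<kappa>)) $ n = (\<Sum>i\<le>K. a $ i * (U * \<kappa> ^ i) $ n)"
proof -
  have c: "(a oo \<kappa>) $ l = (\<Sum>i\<le>K. a $ i * (\<kappa> ^ i) $ l)" if "l \<le> n" for l
  proof -
    have "(\<Sum>i\<le>K. a $ i * (\<kappa> ^ i) $ l) = (\<Sum>i\<in>{0..l}. a $ i * (\<kappa> ^ i) $ l)"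
      using that assms startsby_zero_power_prefix[OF assms(1)]
        by (intro sum.mono_neutral_right) auto
    then show ?thesis by (simp add: fps_compose_nth)
  qed
  have "(U * (a oo \<kappa>)) $ n = (\<Sum>l=0..n. U $ l * (\<Sum>i\<le>K. a $ i * (\<kappa> ^ i) $ (n - l)))"
    unfolding fps_mult_nth by (intro sum.cong refl) (simp add: c)
  also have "\<dots> = (\<Sum>l=0..n. \<Sum>i\<le>K. a $ i * (U $ l * (\<kappa> ^ i) $ (n - l)))"
    by (simp add: sum_distrib_left mult.left_commute)
  also have "\<dots> = (\<Sum>i\<le>K. \<Sum>l=0..n. a $ i * (U $ l * (\<kappa> ^ i) $ (n - l)))"
    by (rule sum.swap)
  finally show ?thesis by (simp add: fps_mult_nth sum_distrib_left)
qed

section \<open>The series \<open>\<theta>\<close> and the solution of the network equations\<close>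

definition \<sigma> :: "'a::field_char_0 fps" where
  "\<sigma> = fps_X - fps_ln 1"

definition \<theta> :: "'a::field_char_0 \<Rightarrow> 'a fps" where
  "\<theta> u = fps_exp u oo \<sigma>"

lemma sigma_0 [simp]: "\<sigma> $ 0 = 0"
  by (simp add: \<sigma>_def fps_ln_def)

lemma deriv_sigma: "(1 + fps_X) * fps_deriv \<sigma> = fps_X"
proof -
  have "(1 + fps_X) * inverse (1 + fps_X :: 'a fps) = 1" by (rule inverse_mult_eq_1') simp
  then show ?thesis by (simp add: \<sigma>_def fps_ln_deriv algebra_simps)
qed

lemma theta_0 [simp]: "\<theta> u $ 0 = 1"
  by (simp add: \<theta>_def)

lemma deriv_theta: "fps_deriv (\<theta> u) = fps_const u * \<theta> u * fps_deriv \<sigma>"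
  by (simp add: \<theta>_def fps_compose_deriv fps_compose_mult_distrib)

lemma theta_add: "\<theta> (u + v) = \<theta> u * \<theta> v"
  by (simp add: \<theta>_def fps_exp_add_mult fps_compose_mult_distrib)

lemma theta_zero: "\<theta> 0 = 1"
  by (simp add: \<theta>_def)

lemma theta_power: "\<theta> u ^ n = \<theta> (of_nat n * u)"
  by (induction n) (simp_all add: theta_zero theta_add distrib_right)

lemma theta_1: "\<theta> u $ 1 = 0"
proof -
  have "fps_deriv \<sigma> $ 0 = (0 :: 'a)"
    using arg_cong[OF deriv_sigma, of "\<lambda>f. f $ 0"] by simp
  then have "fps_deriv (\<theta> u) $ 0 = 0" unfolding deriv_theta by (simp only: fps_mult_nth_0) simp
  then show ?thesis by simp
qed

text \<open>Coefficients of \<open>(1 + x) * \<theta>' = u * x * \<theta>\<close>. Up to sign and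
  factorials this is the recurrence of derangements by number of cycles.\<close>

lemma theta_rec:
  "of_nat (Suc (Suc n)) * \<theta> u $ Suc (Suc n) + of_nat (Suc n) * \<theta> u $ Suc n = u * \<theta> u $ n"
proof -
  have "fps_deriv (\<theta> u) + fps_X * fps_deriv (\<theta> u) = (1 + fps_X) * fps_deriv (\<theta> u)"
    by (simp only: distrib_right mult_1_left)
  also have "\<dots> = fps_const u * \<theta> u * ((1 + fps_X) * fps_deriv \<sigma>)"
    by (simp only: deriv_theta mult.left_commute)
  also have "\<dots> = fps_X * (fps_const u * \<theta> u)" by (simp only: deriv_sigma) (rule mult.commute)
  finally have "fps_deriv (\<theta> u) + fps_X * fps_deriv (\<theta> u) = fps_X * (fps_const u * \<theta> u)" .
  from arg_cong[OF this, of "\<lambda>f. f $ Suc n"] show ?thesis by simp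
qed

text \<open>Both \<open>S\<close> and \<open>\<sigma> oo N\<close> have derivative
  \<open>N * N' / (1 + N)\<close> and no constant term, so they agree. Then \<open>1 + z * Q\<close>
  solves \<open>y' = z * S' * y\<close> and equals \<open>exp (z * S)\<close>. The third equation
  reads \<open>1 + z * N = (1 + z * x) * (1 + z * Q)\<close>.\<close>

lemma net_fps_solution:
  fixes z :: "'a::field_char_0" and N S Q :: "'a fps"
  assumes z: "z \<noteq> 0" and zero: "N $ 0 = 0" "S $ 0 = 0" "Q $ 0 = 0"
    and S: "fps_deriv S = (fps_deriv N - fps_deriv S) * N"
    and Q: "fps_deriv Q = fps_deriv S + fps_const z * fps_deriv S * Q"
    and N: "N = fps_X + Q + fps_const z * fps_X * Q"
  shows "1 + fps_const z * Q = \<theta> z oo N"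
    and "1 + fps_const z * N = (1 + fps_const z * fps_X) * (\<theta> z oo N)"
proof -
  have "fps_deriv (\<sigma> oo N) = (fps_deriv \<sigma> oo N) * fps_deriv N" using zero
    by (simp add: fps_compose_deriv)
  then have "(1 + N) * fps_deriv (\<sigma> oo N) = (((1 + fps_X) * fps_deriv \<sigma>) oo N) * fps_deriv N"
    using zero by (simp add: fps_compose_mult_distrib fps_compose_add_distrib)
  also have "\<dots> = N * fps_deriv N" using zero by (simp add: deriv_sigma)
  also have "\<dots> = (1 + N) * fps_deriv S" using S by (simp add: algebra_simps)
  finally have "(1 + N) * fps_deriv (\<sigma> oo N) = (1 + N) * fps_deriv S" .
  moreover have "1 + N \<noteq> 0" using zero(1)
    by (metis add_0_right fps_add_nth fps_one_nth fps_zero_nth zero_neq_one)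
  ultimately have "fps_deriv S = fps_deriv (\<sigma> oo N)" by simp
  then have S': "S = \<sigma> oo N" using zero by (simp only: fps_deriv_eq_iff) simp
  define y where "y = 1 + fps_const z * Q"
  have y: "fps_deriv y = fps_const z * fps_deriv S * y" unfolding y_def using Q
    by (simp add: algebra_simps)
  define e where "e = fps_exp (- z) oo S"
  have "fps_deriv e = fps_const (- z) * e * fps_deriv S"
    unfolding e_def using zero by (simp add: fps_compose_deriv fps_compose_mult_distrib)
  then have e: "fps_deriv e = - (fps_const z * e * fps_deriv S)"
    by (simp only: fps_const_neg[symmetric] mult_minus_left)
  have "fps_deriv (y * e) = 0" unfolding fps_deriv_mult y e by (simp add: algebra_simps)
  then have "y * e = fps_const ((y * e) $ 0)" by (simp only: fps_deriv_eq_0_iff)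
  also have "(y * e) $ 0 = 1" using zero by (simp add: y_def e_def)
  finally have "y * e = 1" by simp
  moreover have "e * (fps_exp z oo S) = 1"
    unfolding e_def using zero
      by (simp add: fps_compose_mult_distrib[symmetric] fps_exp_add_mult[symmetric])
  ultimately have "y = fps_exp z oo S" by (metis mult.assoc mult_1_left mult_1_right)
  also have "\<dots> = \<theta> z oo N" unfolding S' \<theta>_def using zero by (simp add: fps_compose_assoc)
  finally show y': "1 + fps_const z * Q = \<theta> z oo N" unfolding y_def .
  show "1 + fps_const z * N = (1 + fps_const z * fps_X) * (\<theta> z oo N)"
    unfolding y'[symmetric] by (subst N) (simp add: algebra_simps)
qed

text \<open>Lagrange inversion with \<open>H = \<theta> z\<close> leaves a power \<open>- m\<close>
  of \<open>1 - \<kappa>\<close>, expanded by the negative binomial series in \<open>d\<close>. The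
  binomial expansion of \<open>(\<theta> z - 1) ^ d\<close> in \<open>i\<close> then leaves only
  powers of \<open>\<theta> z\<close>, and these are again of the form
  \<open>\<theta> (j * z)\<close>.\<close>

theorem net_fps_coeff:
  fixes z :: "'a::field_char_0" and N S Q :: "'a fps"
  assumes z: "z \<noteq> 0" and zero: "N $ 0 = 0" "S $ 0 = 0" "Q $ 0 = 0"
    and S: "fps_deriv S = (fps_deriv N - fps_deriv S) * N"
    and Q: "fps_deriv Q = fps_deriv S + fps_const z * fps_deriv S * Q"
    and N: "N = fps_X + Q + fps_const z * fps_X * Q"
    and m: "1 \<le> m" "m \<le> K"
  shows "of_nat m * z * Q $ m = (\<Sum>d\<le>K. of_nat ((m + d - 1) choose d) / z ^ d *
    (\<Sum>i\<le>d. of_nat (d choose i) * (- 1) ^ i * of_nat (m + d) / of_nat (m + 1 + d - i) *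
       \<theta> (of_nat (m + 1 + d - i) * z) $ (m + d)))"
proof -
  note sol = net_fps_solution[OF z zero S Q N]
  \<comment> \<open>The quotient \<open>(\<theta> z - 1) / (z * x)\<close>; its constant term
    vanishes because \<open>\<theta> z\<close> has no linear term.\<close>
  define \<kappa> where "\<kappa> = fps_const (1 / z) * fps_shift 1 (\<theta> z - 1)"
  have \<kappa>0: "\<kappa> $ 0 = 0" using theta_1[of z] by (simp add: \<kappa>_def)
  have \<kappa>: "fps_const z * fps_X * \<kappa> = \<theta> z - 1"
  proof (rule fps_ext)
    fix n show "(fps_const z * fps_X * \<kappa>) $ n = (\<theta> z - 1) $ n"
      using z by (cases n) (simp_all add: \<kappa>_def mult.assoc)
  qed
  \<comment> \<open>Chosen to make \<open>x * \<psi>\<close> the inverse function of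
    \<open>N\<close>: the numerator \<open>1 + z * x - \<theta> z\<close> equals
    \<open>z * x * (1 - \<kappa>)\<close>.\<close>
  define \<psi> where "\<psi> = (1 - \<kappa>) * inverse (\<theta> z)"
  have inv\<theta>: "\<theta> z * inverse (\<theta> z) = 1" by (rule inverse_mult_eq_1') simp
  have \<psi>0: "\<psi> $ 0 \<noteq> 0" using \<kappa>0 by (simp add: \<psi>_def)
  have z\<chi>: "fps_const z * (fps_X * \<psi>) = (1 + fps_const z * fps_X) * inverse (\<theta> z) - 1"
  proof -
    have "fps_const z * (fps_X * \<psi>) = (fps_const z * fps_X - fps_const z * fps_X * \<kappa>) * inverse
      (\<theta> z)"
      by (simp add: \<psi>_def algebra_simps)
    also have "\<dots> = (1 + fps_const z * fps_X) * inverse (\<theta> z) - \<theta> z * inverse (\<theta> z)"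
      unfolding \<kappa> by (simp add: algebra_simps)
    finally show ?thesis by (simp add: inv\<theta>)
  qed
  have inv: "(fps_X * \<psi>) oo N = fps_X"
  proof -
    have i: "(inverse (\<theta> z) oo N) * (\<theta> z oo N) = 1"
      using inv\<theta> zero(1) by (simp add: fps_compose_mult_distrib[symmetric] mult.commute)
    have "fps_const z * ((fps_X * \<psi>) oo N) = (fps_const z * (fps_X * \<psi>)) oo N"
      using zero(1) by (simp add: fps_compose_mult_distrib)
    also have "\<dots> = (1 + fps_const z * N) * (inverse (\<theta> z) oo N) - 1"
      unfolding z\<chi> using zero(1)
      by (simp add: fps_compose_mult_distrib fps_compose_add_distrib fps_compose_sub_distrib)
    also have "\<dots> = (1 + fps_const z * fps_X) * ((inverse (\<theta> z) oo N) * (\<theta> z oo N)) - 1"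
      unfolding sol(2) by (simp add: algebra_simps)
    finally have "fps_const z * ((fps_X * \<psi>) oo N) = fps_const z * fps_X" unfolding i by simp
    moreover have "fps_const z \<noteq> 0" using z by simp
    ultimately show ?thesis by simp
  qed
  have "of_nat m * (\<theta> z oo N) $ m = (fps_deriv (\<theta> z) * inverse \<psi> ^ m) $ (m - 1)"
    by (rule lagrange_inversion[OF \<psi>0 zero(1) inv m(1)])
  moreover have "(\<theta> z oo N) $ m = z * Q $ m" using sol(1)[symmetric] m by simp
  ultimately have L: "of_nat m * z * Q $ m = (fps_deriv (\<theta> z) * inverse \<psi> ^ m) $ (m - 1)"
    by (simp add: mult.assoc)
  define a where "a = Abs_fps (\<lambda>k. of_nat ((m + k - 1) choose k) :: 'a)"
  have a: "inverse ((1 - fps_X) ^ m) = a"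
    using one_minus_const_fps_X_neg_power'[of m "1::'a"] m by (simp add: a_def)
  have "inverse \<psi> = \<theta> z * inverse (1 - \<kappa>)"
    unfolding \<psi>_def by (simp add: fps_inverse_mult fps_inverse_idempotent mult.commute)
  then have "inverse \<psi> ^ m = \<theta> z ^ m * inverse ((1 - \<kappa>) ^ m)"
    by (simp add: power_mult_distrib fps_inverse_power)
  also have "(1 - \<kappa>) ^ m = (1 - fps_X) ^ m oo \<kappa>"
    using \<kappa>0 by (simp add: fps_compose_power[symmetric] fps_compose_sub_distrib)
  also have "inverse ((1 - fps_X) ^ m oo \<kappa>) = a oo \<kappa>"
    unfolding a[symmetric] by (rule fps_inverse_compose[symmetric, OF \<kappa>0]) simp
  finally have \<psi>m: "inverse \<psi> ^ m = \<theta> z ^ m * (a oo \<kappa>)" .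
  define U where "U = fps_deriv (\<theta> z) * \<theta> z ^ m"
  have "of_nat m * z * Q $ m = (U * (a oo \<kappa>)) $ (m - 1)"
    unfolding L \<psi>m U_def by (simp add: mult.assoc)
  also have "\<dots> = (\<Sum>d\<le>K. a $ d * (U * \<kappa> ^ d) $ (m - 1))"
    using m by (intro fps_mult_compose_nth[OF \<kappa>0]) simp
  also have "\<dots> = (\<Sum>d\<le>K. of_nat ((m + d - 1) choose d) / z ^ d *
    (\<Sum>i\<le>d. of_nat (d choose i) * (- 1) ^ i * of_nat (m + d) / of_nat (m + 1 + d - i) *
       \<theta> (of_nat (m + 1 + d - i) * z) $ (m + d)))"
  proof (rule sum.cong[OF refl])
    fix d
    \<comment> \<open>Multiplication by \<open>(z * x) ^ d\<close> turns \<open>\<kappa> ^ d\<close>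
      into \<open>(\<theta> z - 1) ^ d\<close> and moves the coefficient from \<open>m - 1\<close>
      to \<open>m - 1 + d\<close>.\<close>
    have "fps_const (z ^ d) * (fps_X ^ d * (U * \<kappa> ^ d)) = U * (fps_const z * fps_X * \<kappa>) ^ d"
      by (simp add: power_mult_distrib fps_const_power algebra_simps)
    also have "\<dots> = U * (\<Sum>i\<le>d. of_nat (d choose i) * (- 1) ^ i * \<theta> z ^ (d - i))"
    proof -
      have "(\<theta> z - 1) ^ d = (- 1 + \<theta> z) ^ d" by simp
      then show ?thesis unfolding \<kappa> by (simp only: binomial_ring)
    qed
    also have "\<dots> = (\<Sum>i\<le>d. fps_const (of_nat (d choose i) * (- 1) ^ i) * (fps_deriv (\<theta> z) * \<theta> z ^
      (m + (d - i))))"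
      unfolding U_def sum_distrib_left
    proof (rule sum.cong[OF refl])
      fix i
      have "fps_const (of_nat (d choose i) * (- 1) ^ i)
        = (of_nat (d choose i) * (- 1) ^ i :: 'a fps)"
        by (cases "even i") (simp_all add: fps_of_nat fps_const_neg[symmetric] del: fps_const_neg)
      then show "fps_deriv (\<theta> z) * \<theta> z ^ m * (of_nat (d choose i) * (- 1) ^ i * \<theta> z ^ (d - i)) =
          fps_const (of_nat (d choose i) * (- 1) ^ i) * (fps_deriv (\<theta> z) * \<theta> z ^ (m + (d - i)))"
        by (simp only: power_add mult.assoc mult.left_commute mult.commute)
    qed
    finally have eq: "fps_const (z ^ d) * (fps_X ^ d * (U * \<kappa> ^ d)) = (\<Sum>i\<le>d.
      fps_const (of_nat (d choose i) * (- 1) ^ i) * (fps_deriv (\<theta> z) * \<theta> z ^ (m + (d - i))))" .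
    have "z ^ d * (fps_X ^ d * (U * \<kappa> ^ d)) $ (m - 1 + d) =
      (\<Sum>i\<le>d. of_nat (d choose i) * (- 1) ^ i * (fps_deriv (\<theta> z) * \<theta> z ^ (m + (d - i))) $ (m - 1 + d))"
      using arg_cong[OF eq, of "\<lambda>f. f $ (m - 1 + d)"]
        by (simp only: fps_mult_left_const_nth fps_sum_nth)
    then have "z ^ d * (U * \<kappa> ^ d) $ (m - 1) =
      (\<Sum>i\<le>d. of_nat (d choose i) * (- 1) ^ i * (fps_deriv (\<theta> z) * \<theta> z ^ (m + (d - i))) $ (m - 1 + d))"
      by (simp add: fps_X_power_mult_nth)
    also have "\<dots> = (\<Sum>i\<le>d. of_nat (d choose i) * (- 1) ^ i * of_nat (m + d) / of_nat
      (m + 1 + d - i) *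
       \<theta> (of_nat (m + 1 + d - i) * z) $ (m + d))"
    proof (rule sum.cong[OF refl])
      fix i assume "i \<in> {..d}"
      then have j: "m + 1 + d - i = Suc (m + (d - i))" by simp
      \<comment> \<open>The product is the derivative of \<open>\<theta> z ^ j / j\<close> with
        \<open>j = m + 1 + d - i\<close>; hence the denominator \<open>j\<close>, and the factor
        \<open>m + d\<close> from differentiating.\<close>
      have "fps_deriv (\<theta> z ^ Suc (m + (d - i))) =
          of_nat (Suc (m + (d - i))) * (fps_deriv (\<theta> z) * \<theta> z ^ (m + (d - i)))"
        by (simp only: fps_deriv_power' diff_Suc_1 mult.assoc)
      then have "fps_deriv (\<theta> z ^ Suc (m + (d - i))) $ (m - 1 + d) =
          of_nat (Suc (m + (d - i))) * (fps_deriv (\<theta> z) * \<theta> z ^ (m + (d - i))) $ (m - 1 + d)"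
        by (simp only: fps_of_nat[symmetric] fps_mult_left_const_nth)
      moreover have "fps_deriv (\<theta> z ^ Suc (m + (d - i))) $ (m - 1 + d) =
          of_nat (m + d) * \<theta> (of_nat (m + 1 + d - i) * z) $ (m + d)"
        using m unfolding theta_power j by (cases m) (simp_all del: of_nat_Suc)
      ultimately have "(fps_deriv (\<theta> z) * \<theta> z ^ (m + (d - i))) $ (m - 1 + d) =
          of_nat (m + d) / of_nat (m + 1 + d - i) * \<theta> (of_nat (m + 1 + d - i) * z) $ (m + d)"
        unfolding j by (simp add: field_simps del: of_nat_Suc)
      then show "of_nat (d choose i) * (- 1) ^ i * (fps_deriv (\<theta> z) * \<theta> z ^ (m + (d - i))) $
        (m - 1 + d) =
        of_nat (d choose i) * (- 1) ^ i * of_nat (m + d) / of_nat (m + 1 + d - i) *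
        \<theta> (of_nat (m + 1 + d - i) * z) $ (m + d)"
        by simp
    qed
    finally show "a $ d * (U * \<kappa> ^ d) $ (m - 1) = of_nat ((m + d - 1) choose d) / z ^ d *
      (\<Sum>i\<le>d. of_nat (d choose i) * (- 1) ^ i * of_nat (m + d) / of_nat (m + 1 + d - i) *
       \<theta> (of_nat (m + 1 + d - i) * z) $ (m + d))"
      using z by (simp add: a_def field_simps)
  qed
  finally show ?thesis .
qed

section \<open>Derangements by number of cycles\<close>

definition derangements_on :: "'b set \<Rightarrow> ('b \<Rightarrow> 'b) set" where
  "derangements_on A = {p. p permutes A \<and> (\<forall>i\<in>A. p i \<noteq> i)}"

definition cycle_sum :: "'a::comm_ring_1 \<Rightarrow> 'b set \<Rightarrow> 'a" where
  "cycle_sum u A = (\<Sum>p\<in>derangements_on A. u ^ card (orbit p ` A))"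

lemma finite_derangements_on: "finite A \<Longrightarrow> finite (derangements_on A)"
  unfolding derangements_on_def by (rule finite_subset[OF _ finite_permutations]) auto

text \<open>\<open>x\<close> is cut out of its cycle and \<open>b\<close> is its image. The
  remaining permutation \<open>p\<close> can fix at most \<open>b\<close>, which happens when
  \<open>x\<close> and \<open>b\<close> form a 2-cycle.\<close>

lemma bij_betw_derangements_insert:
  assumes x: "x \<notin> A"
  shows "bij_betw (\<lambda>(b, p). transpose x b \<circ> p)
    (SIGMA b:A. {p. p permutes A \<and> (\<forall>i\<in>A. p i = i \<longrightarrow> i = b)}) (derangements_on (insert x A))"
    (is "bij_betw ?f ?S _")
  unfolding bij_betw_def
proof
  have at_x: "?f (b, p) x = b" if "p permutes A" for b p
    using permutes_not_in[OF that x] by simp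
  have undo: "p = transpose x b \<circ> ?f (b, p)" for b :: 'a and p :: "'a \<Rightarrow> 'a"
    by (simp add: fun_eq_iff)
  show "inj_on ?f ?S"
  proof (rule inj_onI)
    fix s t assume s: "s \<in> ?S" and t: "t \<in> ?S" and eq: "?f s = ?f t"
    obtain b p c q where st: "s = (b, p)" "t = (c, q)" by (cases s, cases t)
    have "p permutes A" "q permutes A" using s t st by auto
    then have "(transpose x b \<circ> p) x = b" "(transpose x c \<circ> q) x = c"
      using at_x[of p b] at_x[of q c] by simp_all
    moreover have "(transpose x b \<circ> p) x = (transpose x c \<circ> q) x" using eq st by simp
    ultimately have "b = c" by (simp only:)
    moreover have "p = q" using undo[of p b] undo[of q c] eq st \<open>b = c\<close> by simp
    ultimately show "s = t" using st by simp
  qed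
  show "?f ` ?S = derangements_on (insert x A)"
  proof (intro subset_antisym subsetI)
    fix q assume "q \<in> ?f ` ?S"
    then obtain s where s: "s \<in> ?S" "q = ?f s" by blast
    obtain b p where s': "s = (b, p)" by (cases s)
    have b: "b \<in> A" and p: "p permutes A" "\<forall>i\<in>A. p i = i \<longrightarrow> i = b"
      and q: "q = transpose x b \<circ> p" using s s' by simp_all
    have "q \<in> (\<lambda>(b, p). transpose x b \<circ> p) ` {(b, p). b \<in> insert x A \<and> p \<in> {p. p permutes A}}"
      using b p(1) q by (intro image_eqI[of _ _ "(b, p)"]) auto
    then have "q permutes insert x A" unfolding permutes_insert[symmetric] by simp
    moreover have "q i \<noteq> i" if "i \<in> insert x A" for i
    proof (cases "i = x")
      case True
      then show ?thesis using at_x[OF p(1), of b] q b x by auto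
    next
      case False
      then have i: "i \<in> A" using that by simp
      then have "p i \<in> A" using permutes_in_image[OF p(1)] by simp
      then have "p i \<noteq> x" using x by auto
      then show ?thesis using q p(2) i False by (cases "p i = b") (auto simp: transpose_def)
    qed
    ultimately show "q \<in> derangements_on (insert x A)" by (simp add: derangements_on_def)
  next
    fix q assume "q \<in> derangements_on (insert x A)"
    then have q: "q permutes insert x A" "\<forall>i\<in>insert x A. q i \<noteq> i"
      by (simp_all add: derangements_on_def)
    from q(1) have "q \<in> (\<lambda>(b, p). transpose x b \<circ> p) ` {(b, p). b \<in> insert x A
      \<and> p \<in> {p. p permutes A}}"
      unfolding permutes_insert[symmetric] by simp
    then obtain b p where b: "b \<in> insert x A" and p: "p permutes A"
      and q': "q = transpose x b \<circ> p" by auto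
    have "q x = b" using at_x[OF p, of b] q' by simp
    then have bA: "b \<in> A" using b q(2) by auto
    have "i = b" if "i \<in> A" "p i = i" for i
    proof (rule ccontr)
      assume "i \<noteq> b"
      moreover have "i \<noteq> x" using that(1) x by auto
      ultimately have "q i = i" using q' that(2) by (simp add: transpose_def)
      then show False using q(2) that(1) by simp
    qed
    then have "(b, p) \<in> ?S" using bA p by blast
    moreover have "q = ?f (b, p)" using q' by simp
    ultimately show "q \<in> ?f ` ?S" by (rule rev_image_eqI)
  qed
qed

text \<open>\<open>q\<close> sends the preimage of \<open>b\<close> under \<open>p\<close> to
  \<open>x\<close>, and \<open>x\<close> to \<open>b\<close>: the new point enters the cycle of
  \<open>b\<close> just before \<open>b\<close>.\<close>

lemma orbit_insert_element:
  assumes x: "x \<notin> A" and b: "b \<in> A" and p: "p permutes A" and y: "y \<in> A"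
  defines "q \<equiv> transpose x b \<circ> p"
  shows "orbit q y = (if b \<in> orbit p y then insert x (orbit p y) else orbit p y)"
proof -
  have pA: "p z \<in> A" if "z \<in> A" for z using permutes_in_image[OF p] that by simp
  have qx: "q x = b" using permutes_not_in[OF p x] by (simp add: q_def)
  have qz: "q z = (if p z = b then x else p z)" if "z \<in> A" for z
    using pA[OF that] x by (auto simp: q_def transpose_def)
  have orb: "z \<in> A" if "z \<in> orbit p y" for z
    using that by induction (simp_all add: pA y)
  have 1: "z \<in> orbit p y \<or> (z = x \<and> b \<in> orbit p y)" if "z \<in> orbit q y" for z
    using that
  proof induction
    case base
    have "p y \<in> orbit p y" by (rule orbit.base)
    then show ?case using qz[OF y] by auto
  next
    case (step z)
    show ?case
    proof (cases "z = x")
      case True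
      then show ?thesis using step.IH qx orb x by auto
    next
      case False
      then have z: "z \<in> orbit p y" using step.IH by simp
      then have "p z \<in> orbit p y" by (rule orbit.step)
      then show ?thesis using qz[OF orb[OF z]] by auto
    qed
  qed
  have next_in: "p z \<in> orbit q y" if "z \<in> A" "q z \<in> orbit q y" for z
  proof (cases "p z = b")
    case True
    then have "x \<in> orbit q y" using that qz[of z] by simp
    then have "q x \<in> orbit q y" by (rule orbit.step)
    then show ?thesis using True qx by simp
  next
    case False
    then show ?thesis using that qz[of z] by simp
  qed
  have 2: "z \<in> orbit q y" if "z \<in> orbit p y" for z
    using that
  proof induction
    case base
    show ?case by (rule next_in[OF y orbit.base])
  next
    case (step z)
    show ?case by (rule next_in[OF orb[OF step.hyps] orbit.step[OF step.IH]])
  qed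
  have 3: "x \<in> orbit q y" if "b \<in> orbit p y"
    using that
  proof cases
    case base
    then show ?thesis using qz[OF y] orbit.base[of q y] by simp
  next
    case (step z)
    then show ?thesis using qz[OF orb[OF step(2)]] orbit.step[OF 2[OF step(2)]] by simp
  qed
  show ?thesis using 1 2 3 by auto
qed

text \<open>Adding \<open>x\<close> to the cycle of \<open>b\<close>, the map \<open>g\<close>, is
  undone by removing \<open>x\<close>, hence injective; and \<open>x\<close> itself lies on the
  cycle of \<open>b\<close>, so no cycle is added.\<close>

lemma card_orbits_insert:
  assumes fin: "finite A" and x: "x \<notin> A" and b: "b \<in> A" and p: "p permutes A"
  shows "card (orbit (transpose x b \<circ> p) ` insert x A) = card (orbit p ` A)"
proof -
  define q where "q = transpose x b \<circ> p"
  define g where "g O' = (if b \<in> O' then insert x O' else O')" for O'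
  have qx: "q x = b" using permutes_not_in[OF p x] by (simp add: q_def)
  have orb: "orbit q y = g (orbit p y)" if "y \<in> A" for y
    using orbit_insert_element[OF x b p that] by (simp add: q_def g_def)
  have subA: "orbit p y \<subseteq> A" if "y \<in> A" for y
  proof
    fix z assume "z \<in> orbit p y"
    then show "z \<in> A" by induction (simp_all add: permutes_in_image[OF p] that)
  qed
  have "orbit q x = orbit q b"
  proof (intro subset_antisym subsetI)
    have perm: "b \<in> orbit q b"
    proof -
      have "permutation p" using fin p by (rule permutes_imp_permutation)
      then have "b \<in> orbit p b" by (rule permutation_self_in_orbit)
      then show ?thesis using orb[OF b] by (simp add: g_def)
    qed
    fix z assume "z \<in> orbit q x"
    then show "z \<in> orbit q b"
    proof induction
      case base
      show ?case using perm qx by simp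
    next
      case (step z)
      show ?case by (rule orbit.step[OF step.IH])
    qed
  next
    fix z assume "z \<in> orbit q b"
    then show "z \<in> orbit q x"
    proof induction
      case base
      show ?case using orbit.step[OF orbit.base[of q x]] qx by simp
    next
      case (step z)
      show ?case by (rule orbit.step[OF step.IH])
    qed
  qed
  then have "orbit q ` insert x A = orbit q ` A" using b by auto
  also have "\<dots> = g ` orbit p ` A" unfolding image_image using orb by (intro image_cong) auto
  finally have "card (orbit q ` insert x A) = card (g ` orbit p ` A)" by simp
  also have "\<dots> = card (orbit p ` A)"
  proof (rule card_image, rule inj_on_inverseI)
    fix O' assume "O' \<in> orbit p ` A"
    then have "x \<notin> O'" using subA x by blast
    then show "g O' - {x} = O'" by (simp add: g_def)
  qed
  finally show ?thesis by (simp add: q_def)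
qed

lemma card_orbits_fixed_point:
  assumes fin: "finite A" and b: "b \<in> A" and p: "p permutes (A - {b})"
  shows "card (orbit p ` A) = Suc (card (orbit p ` (A - {b})))"
proof -
  have "p b = b" using permutes_not_in[OF p] by simp
  then have ob: "orbit p b = {b}" by (simp add: orbit_eq_singleton_iff)
  have "b \<notin> orbit p y" if "y \<in> A - {b}" for y
  proof -
    have "z \<in> A - {b}" if "z \<in> orbit p y" for z
      using that by induction (simp_all only: permutes_in_image[OF p] \<open>y \<in> A - {b}\<close>)
    then show ?thesis by blast
  qed
  then have "{b} \<notin> orbit p ` (A - {b})" by (metis imageE insertI1)
  moreover have "orbit p ` A = insert {b} (orbit p ` (A - {b}))"
    using b ob by (metis image_insert insert_Diff)
  ultimately show ?thesis using fin by simp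
qed

text \<open>Without \<open>x\<close> the permutation is a derangement of \<open>A\<close>, or it
  fixes exactly \<open>b\<close>; in the second case the fixed point is a cycle of its own and
  accounts for the factor \<open>u\<close>.\<close>

lemma cycle_sum_insert:
  fixes u :: "'a::comm_ring_1"
  assumes fin: "finite A" and x: "x \<notin> A"
  shows "cycle_sum u (insert x A) = (\<Sum>b\<in>A. cycle_sum u A + u * cycle_sum u (A - {b}))"
proof -
  let ?R = "\<lambda>b. {p. p permutes A \<and> (\<forall>i\<in>A. p i = i \<longrightarrow> i = b)}"
  have finR: "finite (?R b)" for b using finite_permutations[OF fin] by simp
  have "cycle_sum u (insert x A) =
      (\<Sum>s\<in>Sigma A ?R. u ^ card (orbit ((\<lambda>(b, p). transpose x b \<circ> p) s) ` insert x A))"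
    unfolding cycle_sum_def by (rule sum.reindex_bij_betw[symmetric, OF bij_betw_derangements_insert[OF x]])
  also have "\<dots> = (\<Sum>(b, p)\<in>Sigma A ?R. u ^ card (orbit p ` A))"
  proof (rule sum.cong[OF refl])
    fix s assume s: "s \<in> Sigma A ?R"
    obtain b p where s': "s = (b, p)" by (cases s)
    then have "b \<in> A" "p permutes A" using s by simp_all
    from card_orbits_insert[OF fin x this] show "u ^ card (orbit
      ((\<lambda>(b, p). transpose x b \<circ> p) s) ` insert x A) =
        (case s of (b, p) \<Rightarrow> u ^ card (orbit p ` A))" by (simp add: s')
  qed
  also have "\<dots> = (\<Sum>b\<in>A. \<Sum>p\<in>?R b. u ^ card (orbit p ` A))"
    using fin finR by (intro sum.Sigma[symmetric]) auto
  also have "\<dots> = (\<Sum>b\<in>A. cycle_sum u A + u * cycle_sum u (A - {b}))"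
  proof (rule sum.cong[OF refl])
    fix b assume b: "b \<in> A"
    have R: "?R b = derangements_on A \<union> derangements_on (A - {b})"
    proof (intro subset_antisym subsetI)
      fix p assume "p \<in> ?R b"
      then have p: "p permutes A" "\<forall>i\<in>A. p i = i \<longrightarrow> i = b" by simp_all
      show "p \<in> derangements_on A \<union> derangements_on (A - {b})"
      proof (cases "p b = b")
        case True
        have "p permutes (A - {b})"
        proof (rule permutes_superset[OF p(1)])
          fix i assume "i \<in> A - (A - {b})"
          then show "p i = i" using True by auto
        qed
        then show ?thesis using p(2) by (auto simp: derangements_on_def)
      next
        case False
        then have "p i \<noteq> i" if "i \<in> A" for i using p(2) that by auto
        then show ?thesis using p(1) by (simp add: derangements_on_def)
      qed
    next
      fix p assume "p \<in> derangements_on A \<union> derangements_on (A - {b})"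
      then show "p \<in> ?R b"
      proof
        assume "p \<in> derangements_on A"
        then show ?thesis by (simp add: derangements_on_def)
      next
        assume "p \<in> derangements_on (A - {b})"
        then have p: "p permutes (A - {b})" "\<forall>i\<in>A - {b}. p i \<noteq> i"
          by (simp_all add: derangements_on_def)
        have "p permutes A" by (rule permutes_subset[OF p(1)]) auto
        then show ?thesis using p(2) by auto
      qed
    qed
    have "derangements_on A \<inter> derangements_on (A - {b}) = {}"
    proof -
      have "p b = b" if "p \<in> derangements_on (A - {b})" for p
        using that permutes_not_in[of p "A - {b}" b] by (simp add: derangements_on_def)
      then show ?thesis using b unfolding derangements_on_def by blast
    qed
    then have "(\<Sum>p\<in>?R b. u ^ card (orbit p ` A)) =
        cycle_sum u A + (\<Sum>p\<in>derangements_on (A - {b}). u ^ card (orbit p ` A))"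
      unfolding R cycle_sum_def using fin by (intro sum.union_disjoint finite_derangements_on) auto
    also have "(\<Sum>p\<in>derangements_on (A - {b}). u ^ card (orbit p ` A)) = u * cycle_sum u (A - {b})"
      unfolding cycle_sum_def sum_distrib_left
      by (intro sum.cong refl) (simp add: derangements_on_def card_orbits_fixed_point[OF fin b])
    finally show "(\<Sum>p\<in>?R b. u ^ card (orbit p ` A)) = cycle_sum u A + u * cycle_sum u (A - {b})" .
  qed
  finally show ?thesis .
qed

text \<open>\<open>cycle_sum_insert\<close> as a recurrence in the cardinality; for
  \<open>u = 1\<close> the derangement numbers.\<close>

fun cycle_poly :: "'a::comm_ring_1 \<Rightarrow> nat \<Rightarrow> 'a" where
  "cycle_poly u 0 = 1"
| "cycle_poly u (Suc 0) = 0"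
| "cycle_poly u (Suc (Suc n)) = of_nat (Suc n) * (cycle_poly u (Suc n) + u * cycle_poly u n)"

lemma cycle_sum_eq: "finite A \<Longrightarrow> cycle_sum u A = cycle_poly u (card A)"
proof (induction "card A" arbitrary: A rule: less_induct)
  case less
  show ?case
  proof (cases "card A")
    case 0
    then have A: "A = {}" using less.prems by simp
    have "derangements_on A = {id}" unfolding derangements_on_def A by auto
    then show ?thesis using A by (simp add: cycle_sum_def)
  next
    case (Suc n)
    then obtain x B where A: "A = insert x B" "x \<notin> B" "card B = n" "finite B"
      using less.prems by (metis card_Suc_eq finite_insert)
    have rec: "cycle_sum u A = (\<Sum>b\<in>B. cycle_sum u B + u * cycle_sum u (B - {b}))"
      unfolding A(1) by (rule cycle_sum_insert[OF A(4,2)])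
    show ?thesis
    proof (cases n)
      case 0
      then show ?thesis using rec A Suc by simp
    next
      case (Suc m)
      have "cycle_sum u B + u * cycle_sum u (B - {b}) = cycle_poly u n + u * cycle_poly u m"
        if "b \<in> B" for b
        using less.hyps[of B] less.hyps[of "B - {b}"] that A \<open>card A = Suc n\<close> Suc by simp
      then have "cycle_sum u A = of_nat n * (cycle_poly u n + u * cycle_poly u m)"
        using rec A by simp
      then show ?thesis using \<open>card A = Suc n\<close> Suc by (simp del: of_nat_Suc)
    qed
  qed
qed

text \<open>The exponential generating function of derangements by cycles is
  \<open>exp (u * (- x - ln (1 - x)))\<close>, that is \<open>\<theta> u\<close> at
  \<open>- x\<close>, whence the sign.\<close>

lemma cycle_poly_theta: "cycle_poly u n = (- 1) ^ n * fact n * \<theta> u $ n"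
proof (induction u n rule: cycle_poly.induct)
  case (1 u)
  then show ?case by simp
next
  case (2 u)
  then show ?case using theta_1[of u] by simp
next
  case (3 u n)
  have "of_nat (Suc (Suc n)) * \<theta> u $ Suc (Suc n) = u * \<theta> u $ n - of_nat (Suc n) * \<theta> u $ Suc n"
    using theta_rec[of n u] by (simp add: algebra_simps)
  then have "(- 1) ^ n * fact (Suc n) * (of_nat (Suc (Suc n)) * \<theta> u $ Suc (Suc n)) =
      (- 1) ^ n * fact (Suc n) * (u * \<theta> u $ n - of_nat (Suc n) * \<theta> u $ Suc n)" by (simp only:)
  then show ?case unfolding cycle_poly.simps 3 by (simp add: algebra_simps)
qed

lemma card_orbits_le: "finite A \<Longrightarrow> card (orbit p ` A) \<le> card A"
  by (rule card_image_le)

lemma cycle_sum_assoc_stirling1: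
  fixes u :: "'a::comm_ring_1"
  assumes "n \<le> m"
  shows "cycle_sum u {1..n} = (\<Sum>k\<le>m. of_nat (assoc_stirling1 n k) * u ^ k)"
proof -
  have "cycle_sum u {1..n} =
      (\<Sum>k\<le>m. \<Sum>p\<in>{p \<in> derangements_on {1..n}. card (orbit p ` {1..n}) = k}. u ^ card (orbit p ` {1..n}))"
    unfolding cycle_sum_def
  proof (rule sum.group[symmetric])
    show "(\<lambda>p. card (orbit p ` {1..n})) ` derangements_on {1..n} \<subseteq> {..m}"
      using card_orbits_le[of "{1..n}"] assms by (auto intro: order_trans)
  qed (simp_all add: finite_derangements_on)
  also have "\<dots> = (\<Sum>k\<le>m. of_nat (assoc_stirling1 n k) * u ^ k)"
  proof (rule sum.cong[OF refl])
    fix k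
    have "{p \<in> derangements_on {1..n}. card (orbit p ` {1..n}) = k} =
      {p. p permutes {1..n} \<and> (\<forall>i \<in> {1..n}. p i \<noteq> i) \<and> card (orbit p ` {1..n}) = k}"
      by (auto simp: derangements_on_def)
    then show "(\<Sum>p\<in>{p \<in> derangements_on {1..n}. card (orbit p ` {1..n})
      = k}. u ^ card (orbit p ` {1..n})) =
        of_nat (assoc_stirling1 n k) * u ^ k"
      by (simp add: assoc_stirling1_def)
  qed
  finally show ?thesis .
qed

lemma assoc_stirling1_theta:
  fixes u :: "'a::field_char_0"
  assumes "n \<le> m"
  shows "(\<Sum>k\<le>m. of_nat (assoc_stirling1 n k) * u ^ k) = (- 1) ^ n * fact n * \<theta> u $ n"
  using cycle_sum_eq[of "{1..n}" u] cycle_sum_assoc_stirling1[OF assms, of u] cycle_poly_theta[of u n] by simp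

text \<open>Cycles of a derangement have length at least 2. In the recurrence this appears as one
  factor \<open>x\<close> for each step of size two.\<close>

lemma degree_cycle_poly:
  fixes x :: "int poly"
  assumes x: "degree x \<le> 1"
  shows "degree (cycle_poly x n) \<le> n div 2"
  using x
proof (induction x n rule: cycle_poly.induct)
  case (3 x n)
  have "degree (cycle_poly x (Suc n)) \<le> Suc (Suc n) div 2" using 3 by simp
  moreover have "degree (x * cycle_poly x n) \<le> degree x + degree (cycle_poly x n)"
    by (rule degree_mult_le)
  then have "degree (x * cycle_poly x n) \<le> Suc (Suc n) div 2" using 3 by simp
  ultimately have "degree (cycle_poly x (Suc n) + x * cycle_poly x n) \<le> Suc (Suc n) div 2"
    by (rule degree_add_le)
  moreover have "degree (of_nat (Suc n) * (cycle_poly x (Suc n) + x * cycle_poly x n)) \<le>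
      degree (of_nat (Suc n) :: int poly) + degree (cycle_poly x (Suc n) + x * cycle_poly x n)"
    by (rule degree_mult_le)
  moreover have "degree (of_nat (Suc n) :: int poly) = 0" by (simp only: degree_of_nat)
  ultimately show ?case unfolding cycle_poly.simps by linarith
qed simp_all

text \<open>With the indeterminate in place of \<open>u\<close> the numbers become coefficients of
  \<open>cycle_poly\<close>, to which the degree bound applies.\<close>

lemma assoc_stirling1_eq_0:
  assumes "n < 2 * k"
  shows "assoc_stirling1 n k = 0"
proof -
  define x :: "int poly" where "x = monom 1 1"
  \<comment> \<open>The bound \<open>n + k\<close> keeps the index \<open>k\<close> in the range of
    summation even for \<open>k > n\<close>.\<close>
  have "coeff (cycle_poly x n) k = (\<Sum>j\<le>n + k. coeff (of_nat (assoc_stirling1 n j) * x ^ j) k)"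
    using cycle_sum_eq[of "{1..n}" x] cycle_sum_assoc_stirling1[of n "n + k" x]
    by (simp add: coeff_sum)
  also have "\<dots> = (\<Sum>j\<le>n + k. if j = k then int (assoc_stirling1 n j) else 0)"
  proof (rule sum.cong[OF refl])
    fix j
    have "of_nat (assoc_stirling1 n j) * x ^ j = monom (int (assoc_stirling1 n j)) j"
      unfolding x_def by (simp add: monom_power of_nat_monom mult_monom)
    then show "coeff (of_nat (assoc_stirling1 n j) * x ^ j) k = (if j
      = k then int (assoc_stirling1 n j) else 0)"
      by simp
  qed
  also have "\<dots> = int (assoc_stirling1 n k)" by simp
  finally have "coeff (cycle_poly x n) k = int (assoc_stirling1 n k)" .
  moreover have "degree (cycle_poly x n) < k"
    using degree_cycle_poly[of x n] assms by (simp add: x_def degree_monom_eq)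
  then have "coeff (cycle_poly x n) k = 0" by (rule coeff_eq_0)
  ultimately show ?thesis by simp
qed

section \<open>Counting simple series-parallel matroids\<close>

lemma cycle_space_rooted: "net A F \<Longrightarrow> e \<notin> A \<Longrightarrow> cycle_space (insert e A) (rooted e F)"
  by (rule sp_space_cycle_space[OF sp_space_rooted])

lemma card_rooted:
  assumes F: "net A F" and e: "e \<notin> A"
  shows "card (rooted e F) = 2 ^ Suc (nullity F)"
proof -
  have finF: "finite F" by (rule net_finite[OF F])
  have fin: "finite (symdiffs F)"
    using card_symdiffs[OF F] card_net[OF F]
      by (metis card.infinite power_not_zero zero_neq_numeral)
  have eF: "e \<notin> p" if "p \<in> layer F b" for p b using net_layer_subset[OF F that] e by blast
  have "symdiffs F \<inter> insert e ` F = {}" using eF[of _ False] by auto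
  moreover have "inj_on (insert e) F"
  proof (rule inj_on_inverseI)
    fix p assume "p \<in> F"
    then show "insert e p - {e} = p" using eF[of p True] by simp
  qed
  then have "card (insert e ` F) = card F" by (rule card_image)
  ultimately have "card (rooted e F) = card F + card F"
    unfolding rooted_def using fin finF by (simp add: card_Un_disjoint card_symdiffs[OF F])
  then show ?thesis by (simp add: card_net[OF F])
qed

text \<open>The rooted space has dimension \<open>nullity F + 1\<close> on \<open>card A + 1\<close>
  elements; the two units cancel.\<close>

lemma matroid_rank_rooted:
  assumes F: "net A F" and e: "e \<notin> A"
  shows "matroid_rank (binary_matroid (insert e A) (rooted e F)) + nullity F = card A"
proof -
  have "card (insert e A) = Suc (card A)" using e net_ground[OF F] by simp
  then have "(2::nat) ^ Suc (card A) =
      2 ^ (Suc (nullity F) + matroid_rank (binary_matroid (insert e A) (rooted e F)))"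
    using card_cycle_space[OF cycle_space_rooted[OF F e]] card_rooted[OF F e]
      by (simp add: power_add)
  then show ?thesis by (subst (asm) power_inject_exp) simp_all
qed

text \<open>Closing a path set with the root adds one element, so the bound 3 for cycles through
  \<open>e\<close> is the bound 2 in \<open>no_single\<close>.\<close>

lemma simple_matroid_rooted:
  assumes F: "net A F" and e: "e \<notin> A"
  shows "simple_matroid (binary_matroid (insert e A) (rooted e F)) \<longleftrightarrow> simple_net F \<and> no_single F"
proof -
  have card: "card (insert e p) = Suc (card p)" if "p \<in> F" for p
    using net_subset[OF F that] e net_finite_elem[OF F, of p True] that
      by (auto intro!: card_insert_disjoint)
  have "(\<forall>D\<in>rooted e F. D \<noteq> {} \<longrightarrow> 3 \<le> card D) \<longleftrightarrow>
      simple_net F \<and> (\<forall>p\<in>F. 3 \<le> card (insert e p))"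
    unfolding rooted_def simple_net_def by (simp add: ball_Un)
  also have "(\<forall>p\<in>F. 3 \<le> card (insert e p)) \<longleftrightarrow> no_single F"
    unfolding no_single_def using card by (intro ball_cong refl) simp
  finally show ?thesis using simple_binary_matroid[OF cycle_space_rooted[OF F e]] by simp
qed

lemma sp_space_card: "sp_space E Z \<Longrightarrow> 2 \<le> card E"
proof (induction rule: sp_space.induct)
  case (series E Z e f)
  then have "finite E" using sp_space_cycle_space cycle_space_ground by blast
  then show ?case using series by simp
next
  case (parallel E Z e f)
  then have "finite E" using sp_space_cycle_space cycle_space_ground by blast
  then show ?case using parallel by simp
qed simp

lemma series_parallel_matroid_sp_space:
  assumes "sp_space E Z"
  shows "series_parallel_matroid (binary_matroid E Z)"
proof -
  obtain C G :: "(nat, 'a) multigraph"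
    where G: "two_cycle C" "sp_step\<^sup>*\<^sup>* C G" "edges G = E" "cycle_sets G = Z"
    using sp_space_sp_graph[OF assms] by blast
  have "binary_matroid E Z = cycle_matroid G"
    using cycle_matroid_binary[of G] sp_graph_sp_space[OF G(2,1)] G(3,4) by simp
  moreover have "series_parallel_graph G" unfolding series_parallel_graph_def using G(1,2) by blast
  ultimately show ?thesis
    unfolding series_parallel_matroid_def
    using matroid_binary_matroid[OF sp_space_cycle_space[OF assms]] by blast
qed

lemma series_parallel_matroid_cases:
  assumes "series_parallel_matroid M"
  obtains (net) Z where "sp_space (ground M) Z" "M = binary_matroid (ground M) Z"
    | (single) G :: "(nat, 'a) multigraph"
      where "single_edge G \<or> single_loop G" "M = cycle_matroid G"
proof -
  obtain G :: "(nat, 'a) multigraph" where G: "series_parallel_graph G" "M = cycle_matroid G"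
    using assms unfolding series_parallel_matroid_def by blast
  have gr: "ground M = edges G" using G(2) by (simp add: cycle_matroid_def)
  show ?thesis
  proof (cases "single_edge G \<or> single_loop G")
    case True
    then show ?thesis using G(2) that(2) by blast
  next
    case False
    then obtain C where "two_cycle C" "sp_step\<^sup>*\<^sup>* C G" using G(1)
      unfolding series_parallel_graph_def by blast
    then have "loopless_graph G" "sp_space (edges G) (cycle_sets G)" using sp_graph_sp_space
      by blast+
    then show ?thesis using that(1)[of "cycle_sets G"] cycle_matroid_binary[of G] gr G(2) by simp
  qed
qed

text \<open>The largest element \<open>n\<close> serves as root, which leaves networks on
  \<open>{1..m}\<close>. The assumption \<open>1 \<le> m\<close> keeps out the one-element graphs,
  which do not arise from a 2-cycle.\<close>

lemma num_simple_sp_matroids_eq: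
  assumes n: "n = Suc m" "1 \<le> m"
  shows "num_simple_sp_matroids n k =
    card {F. net {1..m} F \<and> simple_net F \<and> no_single F \<and> k + nullity F = m}"
proof -
  let ?S = "{F. net {1..m} F \<and> simple_net F \<and> no_single F \<and> k + nullity F = m}"
  let ?T = "{M :: nat set_system. series_parallel_matroid M \<and> simple_matroid M \<and>
            ground M = {1..n} \<and> matroid_rank M = k}"
  let ?f = "\<lambda>F. binary_matroid {1..n} (rooted n F)"
  have ins: "insert n {1..m} = {1..n}" and nm: "n \<notin> {1..m}" using n by auto
  have "bij_betw ?f ?S ?T"
    unfolding bij_betw_def
  proof
    show "inj_on ?f ?S"
    proof (rule inj_onI)
      fix F F' assume F: "F \<in> ?S" and F': "F' \<in> ?S" and eq: "?f F = ?f F'"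
      have nets: "net {1..m} F" "net {1..m} F'" using F F' by simp_all
      have R: "rooted n F = rooted n F'"
        using binary_matroid_inj[OF cycle_space_rooted[OF nets(1) nm] cycle_space_rooted[OF nets(2) nm]] eq ins
        by simp
      note l = link_rooted[OF cosetD(1)[OF net_coset[OF nets(1)]] nm]
        link_rooted[OF cosetD(1)[OF net_coset[OF nets(2)]] nm]
      show "F = F'" using l(1) unfolding R l(2) by (rule sym)
    qed
    show "?f ` ?S = ?T"
    proof (intro subset_antisym subsetI)
      fix M assume "M \<in> ?f ` ?S"
      then obtain F where F: "net {1..m} F" "simple_net F" "no_single F" "k + nullity F = m"
        and M: "M = ?f F" by blast
      have "series_parallel_matroid M"
        using series_parallel_matroid_sp_space[OF sp_space_rooted[OF F(1) nm]] M ins by simp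
      moreover have "simple_matroid M" using simple_matroid_rooted[OF F(1) nm] F(2,3) M ins by simp
      moreover have "matroid_rank M = k" using matroid_rank_rooted[OF F(1) nm] F(4) M ins by simp
      ultimately show "M \<in> ?T" using M by simp
    next
      fix M assume "M \<in> ?T"
      then have M: "series_parallel_matroid M" "simple_matroid M" "ground M
        = {1..n}" "matroid_rank M = k"
        by simp_all
      from M(1) show "M \<in> ?f ` ?S"
      proof (cases rule: series_parallel_matroid_cases)
        case (net Z)
        have Z: "sp_space {1..n} Z" using net M(3) by simp
        have "n \<in> {1..n}" using n by simp
        from net_link[OF Z this] have L: "net {1..m} (link Z n)" using ins nm
          by (metis Diff_insert_absorb)
        have R: "rooted n (link Z n) = Z"
          by (rule rooted_link[OF sp_space_cycle_space[OF Z] net_nonempty[OF L]])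
        have M': "M = ?f (link Z n)" using net M(3) R by simp
        have "simple_net (link Z n) \<and> no_single (link Z n)"
          using simple_matroid_rooted[OF L nm] M(2) M' ins by simp
        moreover have "k + nullity (link Z n) = m"
          using matroid_rank_rooted[OF L nm] M(4) M' ins by simp
        ultimately have "link Z n \<in> ?S" using L by simp
        then show ?thesis using M' by (rule rev_image_eqI)
      next
        case (single G)
        then obtain e where "ground M = {e}"
          unfolding single_edge_def single_loop_def cycle_matroid_def by auto
        then have "card {1..n} = 1" using M(3) by simp
        then show ?thesis using n by simp
      qed
    qed
  qed
  then show ?thesis unfolding num_simple_sp_matroids_def by (rule bij_betw_same_card[symmetric])
qed

lemma series_parallel_matroid_ground:
  assumes "series_parallel_matroid M"
  shows "ground M \<noteq> {}"
  using assms
proof (cases rule: series_parallel_matroid_cases)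
  case (net Z)
  then show ?thesis using sp_space_card[OF net(1)] by auto
next
  case (single G)
  then show ?thesis unfolding single_edge_def single_loop_def cycle_matroid_def by auto
qed

lemma num_simple_sp_matroids_0: "num_simple_sp_matroids 0 k = 0"
proof -
  have "{M :: nat set_system. series_parallel_matroid M \<and> simple_matroid M \<and>
            ground M = {1..0} \<and> matroid_rank M = k} = {}"
    using series_parallel_matroid_ground by auto
  then show ?thesis unfolding num_simple_sp_matroids_def by (simp only: card.empty)
qed

lemma cycle_matroid_single_edge:
  assumes "single_edge G" "edges G = {e}"
  shows "cycle_matroid G = binary_matroid {e} {{}}"
proof -
  obtain u v where uv: "u \<noteq> v" "verts G = {u, v}" "ends G e = {u, v}"
    using assms unfolding single_edge_def by auto
  have loopless: "loopless_graph G" using uv assms(2) by (simp add: loopless_graph_def)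
  have "D \<in> cycle_sets G \<longleftrightarrow> D = {}" for D
  proof
    assume D: "D \<in> cycle_sets G"
    then have sub: "D \<subseteq> {e}" and ev: "even (card {g \<in> D. u \<in> ends G g})"
      using assms(2) by (simp_all add: cycle_sets_def)
    have "{g \<in> D. u \<in> ends G g} = D" using sub uv by auto
    then have "even (card D)" using ev by simp
    then have "D \<noteq> {e}" by auto
    then show "D = {}" using sub by auto
  qed (simp add: cycle_sets_def)
  then have "cycle_sets G = {{}}" by blast
  then show ?thesis using cycle_matroid_binary[OF loopless] assms(2) by simp
qed

text \<open>Of the two one-element graphs only the single edge counts; the matroid of the single
  loop is not simple.\<close>

lemma num_simple_sp_matroids_1: "num_simple_sp_matroids 1 1 = 1"
proof -
  let ?M = "binary_matroid {1 :: nat} {{}}"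
  have Z: "cycle_space {1 :: nat} {{}}" by (simp add: cycle_space_def)
  define G :: "(nat, nat) multigraph" where "G = \<lparr>verts = {0, 1}, edges = {1}, ends = (\<lambda>_. {0, 1})\<rparr>"
  have G: "single_edge G" unfolding single_edge_def
    by (intro exI[of _ 0] exI[of _ 1]) (simp add: G_def)
  have eq: "cycle_matroid G = ?M" using G by (rule cycle_matroid_single_edge) (simp add: G_def)
  have sp: "series_parallel_matroid ?M"
    unfolding series_parallel_matroid_def
  proof (intro conjI exI[of _ G])
    show "matroid ?M" by (rule matroid_binary_matroid[OF Z])
    show "series_parallel_graph G" using G by (simp add: series_parallel_graph_def)
    show "?M = cycle_matroid G" by (rule eq[symmetric])
  qed
  have simple: "simple_matroid ?M" by (subst simple_binary_matroid[OF Z]) simp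
  have "2 ^ card {1::nat} = card {{} :: nat set} * (2 :: nat) ^ matroid_rank ?M"
    by (rule card_cycle_space[OF Z])
  then have "(2::nat) ^ 1 = 2 ^ matroid_rank ?M" by simp
  then have rank: "matroid_rank ?M = 1" by (subst (asm) power_inject_exp) simp_all
  have "{M :: nat set_system. series_parallel_matroid M \<and> simple_matroid M \<and>
            ground M = {1..1} \<and> matroid_rank M = 1} = {?M}"
  proof (intro subset_antisym subsetI)
    fix M :: "nat set_system"
    assume "M \<in> {M. series_parallel_matroid M \<and> simple_matroid M \<and> ground M = {1..1}
      \<and> matroid_rank M = 1}"
    then have M: "series_parallel_matroid M" "simple_matroid M" "ground M = {1}" by simp_all
    from M(1) show "M \<in> {?M}"
    proof (cases rule: series_parallel_matroid_cases)
      case (net Z)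
      then show ?thesis using sp_space_card[OF net(1)] M(3) by simp
    next
      case (single H)
      have E: "edges H = {1}" using M(3) single(2) by (simp add: cycle_matroid_def)
      show ?thesis
      proof (cases "single_edge H")
        case True
        then show ?thesis using cycle_matroid_single_edge[OF True E] single(2) by simp
      next
        case False
        then obtain v where v: "verts H = {v}" "ends H 1 = {v}"
          using single(1) E unfolding single_loop_def by auto
        have cyc: "cycle_edges H {1}" unfolding cycle_edges_def
          by (rule exI[of _ "[v]"], rule exI[of _ "[1]"]) (simp add: v[simplified] E)
        have "circuit M {1}"
          unfolding circuit_def
        proof (intro conjI allI impI)
          show "{1} \<subseteq> ground M" using M(3) by simp
          show "{1} \<notin> indep M" using cyc single(2) by (auto simp: cycle_matroid_def)
          fix D :: "nat set" assume "D \<subset> {1}"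
          then have "D = {}" by auto
          have "matroid M" using M(1) by (simp add: series_parallel_matroid_def)
          then show "D \<in> indep M" unfolding \<open>D = {}\<close> by (rule matroid.indep_empty)
        qed
        then have "matroid_loop M 1" by (simp add: matroid_loop_def)
        then show ?thesis using M(2) unfolding simple_matroid_def by blast
      qed
    qed
  qed (use sp simple rank in simp)
  then show ?thesis unfolding num_simple_sp_matroids_def by (simp only:) simp
qed

section \<open>Network sums as functions of the cardinality\<close>

lemma sum_subsets_containing:
  fixes g :: "nat \<Rightarrow> nat \<Rightarrow> 'b::comm_semiring_1"
  assumes "finite A" "a \<in> A" "card A = Suc m"
  shows "(\<Sum>X | a \<in> X \<and> X \<subseteq> A. g (card X) (card (A - X)))
    = (\<Sum>i\<le>m. of_nat (m choose i) * g (Suc i) (m - i))"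
proof -
  define B where "B = A - {a}"
  have B: "finite B" "card B = m" "a \<notin> B" "A = insert a B" using assms by (auto simp: B_def)
  have "(\<Sum>X | a \<in> X \<and> X \<subseteq> A. g (card X) (card (A - X))) = (\<Sum>Y\<in>Pow B. g (Suc (card Y)) (m - card Y))"
  proof (rule sum.reindex_bij_witness[of _ "insert a" "\<lambda>X. X - {a}"])
    fix Y assume "Y \<in> Pow B"
    then show "insert a Y - {a} = Y" "insert a Y \<in> {X. a \<in> X \<and> X \<subseteq> A}" using B(3,4) by auto
  next
    fix X assume X: "X \<in> {X. a \<in> X \<and> X \<subseteq> A}"
    then show "insert a (X - {a}) = X" "X - {a} \<in> Pow B" using B(4) by auto
    have finX: "finite X" using X assms(1) by (auto intro: finite_subset)
    have "card X = Suc (card (X - {a}))" using X finX by (intro card.remove) auto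
    moreover have "card (A - X) = card A - card X" using X finX by (intro card_Diff_subset) auto
    ultimately show "g (Suc (card (X - {a}))) (m - card (X - {a})) = g (card X) (card (A - X))"
      using assms(3) by simp
  qed
  also have "\<dots> = (\<Sum>i\<le>m. \<Sum>Y\<in>{Y \<in> Pow B. card Y = i}. g (Suc (card Y)) (m - card Y))"
  proof (rule sum.group[symmetric])
    show "card ` Pow B \<subseteq> {..m}" using card_mono[OF B(1)] B(2) by auto
  qed (use B in simp_all)
  also have "\<dots> = (\<Sum>i\<le>m. of_nat (m choose i) * g (Suc i) (m - i))"
  proof (rule sum.cong[OF refl])
    fix i
    have "card {Y \<in> Pow B. card Y = i} = m choose i" using n_subsets[OF B(1), of i] B(2) by simp
    then show "(\<Sum>Y\<in>{Y \<in> Pow B. card Y = i}. g (Suc (card Y)) (m - card Y))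
      = of_nat (m choose i) * g (Suc i) (m - i)"
      by simp
  qed
  finally show ?thesis .
qed

text \<open>\<open>vals\<close> speaks of proper subsets only. In the term \<open>X = B\<close> the
  cofactor is the value at the empty set, which is 0; so the right-hand sides involve smaller sets
  in effect, and the recurrences can drive an induction.\<close>

lemma net_sums_rec:
  fixes z :: "'b::comm_ring_1" and B :: "'a set" and s q t :: "nat \<Rightarrow> 'b"
  assumes B: "finite B" "card B = Suc m" and zero: "q 0 = 0" "t 0 = 0"
    and vals: "\<And>X. X \<subset> B \<Longrightarrow>
      series_sum z X = s (card X) \<and> no_single_sum z X = q (card X) \<and> all_sum z X = t (card X)"
  shows "series_sum z B = (\<Sum>i\<le>m. of_nat (m choose i) * ((t (Suc i) - s (Suc i)) * t (m - i)))"
    and "no_single_sum z B = series_sum z B + (\<Sum>i\<le>m. of_nat (m choose i) * (z * s (Suc i) * q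
      (m - i)))"
    and "all_sum z B = no_single_sum z B + of_nat (Suc m) * ((if m = 0 then 1 else 0) + z * q m)"
proof -
  obtain a where a: "a \<in> B" using B by fastforce
  have sums: "(\<Sum>X | a \<in> X \<and> X \<subseteq> B. f X * g (B - X))
    = (\<Sum>i\<le>m. of_nat (m choose i) * (f' (Suc i) * g' (m - i)))"
    if "\<And>X. X \<subset> B \<Longrightarrow> f X = f' (card X)" "\<And>X. X \<subset> B \<Longrightarrow> g X = g' (card X)" "g' 0 = 0"
    for f g :: "'a set \<Rightarrow> 'b" and f' g'
  proof -
    have "(\<Sum>X | a \<in> X \<and> X \<subseteq> B. f X * g (B - X)) = (\<Sum>X | a \<in> X
      \<and> X \<subseteq> B. f' (card X) * g' (card (B - X)))"
    proof (rule sum.cong[OF refl])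
      fix X assume X: "X \<in> {X. a \<in> X \<and> X \<subseteq> B}"
      then have "g (B - X) = g' (card (B - X))" by (intro that(2)) auto
      moreover consider "X = B" | "X \<subset> B" using X by blast
      then have "f X * g' (card (B - X)) = f' (card X) * g' (card (B - X))"
        by cases (simp_all add: that(1,3))
      ultimately show "f X * g (B - X) = f' (card X) * g' (card (B - X))" by simp
    qed
    also have "\<dots> = (\<Sum>i\<le>m. of_nat (m choose i) * (f' (Suc i) * g' (m - i)))"
      by (rule sum_subsets_containing[OF B(1) a B(2)])
    finally show ?thesis .
  qed
  show "series_sum z B = (\<Sum>i\<le>m. of_nat (m choose i) * ((t (Suc i) - s (Suc i)) * t (m - i)))"
    unfolding series_sum_rec[OF B(1) a, of z]
    by (rule sums[of "nonseries_sum z" "\<lambda>i. t i - s i"]) (simp_all add: nonseries_sum vals zero)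
  have "(\<Sum>X | a \<in> X \<and> X \<subseteq> B. z * series_sum z X * no_single_sum z (B - X)) =
      (\<Sum>i\<le>m. of_nat (m choose i) * (z * s (Suc i) * q (m - i)))"
    by (rule sums[of "\<lambda>X. z * series_sum z X" "\<lambda>i. z * s i"]) (simp_all add: vals zero)
  then show "no_single_sum z B = series_sum z B + (\<Sum>i\<le>m. of_nat (m choose i) * (z * s (Suc i) * q
    (m - i)))"
    using no_single_sum_rec[OF B(1) a, of z] by simp
  have "(\<Sum>a\<in>B. (if B = {a} then 1 else 0) + z * no_single_sum z (B - {a})) =
      (\<Sum>a\<in>B. (if m = 0 then 1 else 0) + z * q m)"
  proof (rule sum.cong[OF refl])
    fix a assume a: "a \<in> B"
    have "B = {a} \<longleftrightarrow> m = 0"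
    proof
      assume "m = 0"
      then obtain b where "B = {b}" using B(2) card_1_singletonE by auto
      then show "B = {a}" using a by simp
    qed (use B(2) in simp)
    moreover have "B - {a} \<subset> B" using a by blast
    then have "no_single_sum z (B - {a}) = q m" using vals a B by simp
    ultimately show "(if B = {a} then 1 else 0) + z * no_single_sum z (B - {a}) = (if m
      = 0 then 1 else 0) + z * q m"
      by simp
  qed
  then show "all_sum z B = no_single_sum z B + of_nat (Suc m) * ((if m
    = 0 then 1 else 0) + z * q m)"
    using all_sum_rec[OF B(1), of z] B(2) by simp
qed

text \<open>In place of a relabelling of networks: sets of equal cardinality satisfy the same
  recurrences with the same smaller values.\<close>

lemma net_sums_card:
  fixes z :: "'b::comm_ring_1" and A :: "nat set"
  assumes "finite A"
  shows "series_sum z A = series_sum z {1..card A} \<and> no_single_sum z A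
    = no_single_sum z {1..card A} \<and>
    all_sum z A = all_sum z {1..card A}"
  using assms
proof (induction "card A" arbitrary: A rule: less_induct)
  case less
  show ?case
  proof (cases "card A")
    case 0
    then show ?thesis using less.prems by simp
  next
    case (Suc m)
    define s q t where "s i = series_sum z {1..i}" and "q i = no_single_sum z {1..i}"
      and "t i = all_sum z {1..i}"
      for i :: nat
    have zero: "q 0 = 0" "t 0 = 0" by (simp_all add: q_def t_def net_sum_empty)
    have vals: "series_sum z X = s (card X) \<and> no_single_sum z X = q (card X) \<and> all_sum z X
      = t (card X)"
      if "finite B" "card B = Suc m" "X \<subset> B" for B X :: "nat set"
    proof -
      have "card X < card A" using psubset_card_mono[OF that(1,3)] that(2) Suc by simp
      moreover have "finite X" using that by (meson finite_subset psubset_imp_subset)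
      ultimately show ?thesis using less.hyps[of X] by (simp add: s_def q_def t_def)
    qed
    have B: "finite {1..Suc m}" "card {1..Suc m} = Suc m" by simp_all
    note A = less.prems Suc
    note recA = net_sums_rec[OF A zero vals[OF A]] and recB = net_sums_rec[OF B zero vals[OF B]]
    have S: "series_sum z A = series_sum z {1..Suc m}"
      by (rule trans[OF recA(1) recB(1)[symmetric]])
    have Q: "no_single_sum z A = no_single_sum z {1..Suc m}" by (simp only: recA(2) recB(2) S)
    have "all_sum z A = all_sum z {1..Suc m}" by (simp only: recA(3) recB(3) Q)
    with S Q Suc show ?thesis by simp
  qed
qed

lemma net_sum_equations:
  fixes z :: "'b::comm_ring_1"
  defines "s \<equiv> \<lambda>i. series_sum z {1..i::nat}" and "q \<equiv> \<lambda>i. no_single_sum z {1..i::nat}"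
    and "t \<equiv> \<lambda>i. all_sum z {1..i::nat}"
  shows "s (Suc m) = (\<Sum>i\<le>m. of_nat (m choose i) * ((t (Suc i) - s (Suc i)) * t (m - i)))"
    and "q (Suc m) = s (Suc m) + (\<Sum>i\<le>m. of_nat (m choose i) * (z * s (Suc i) * q (m - i)))"
    and "t (Suc m) = q (Suc m) + of_nat (Suc m) * ((if m = 0 then 1 else 0) + z * q m)"
proof -
  have zero: "q 0 = 0" "t 0 = 0" by (simp_all add: q_def t_def net_sum_empty)
  have vals: "series_sum z X = s (card X) \<and> no_single_sum z X = q (card X) \<and> all_sum z X
    = t (card X)"
    if "X \<subset> {1..Suc m}" for X :: "nat set"
    using net_sums_card[of X z] finite_subset[OF psubset_imp_subset[OF that]]
      by (simp add: s_def q_def t_def)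
  have B: "finite {1..Suc m}" "card {1..Suc m} = Suc m" by simp_all
  note rec = net_sums_rec[OF B zero vals]
  show "s (Suc m) = (\<Sum>i\<le>m. of_nat (m choose i) * ((t (Suc i) - s (Suc i)) * t (m - i)))"
    using rec(1) by (simp only: s_def)
  show "q (Suc m) = s (Suc m) + (\<Sum>i\<le>m. of_nat (m choose i) * (z * s (Suc i) * q (m - i)))"
    using rec(2) by (simp only: s_def q_def)
  show "t (Suc m) = q (Suc m) + of_nat (Suc m) * ((if m = 0 then 1 else 0) + z * q m)"
    using rec(3) by (simp only: q_def t_def)
qed

text \<open>The shift \<open>Suc\<close> in the first factor stands for a derivative and marks the
  part that contains the distinguished element.\<close>

lemma egf_mult:
  fixes f g :: "nat \<Rightarrow> 'a::field_char_0"
  shows "(Abs_fps (\<lambda>m. f (Suc m) / fact m) * Abs_fps (\<lambda>m. g m / fact m)) $ m =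
    (\<Sum>i\<le>m. of_nat (m choose i) * (f (Suc i) * g (m - i))) / fact m"
  unfolding fps_mult_nth sum_divide_distrib atLeast0AtMost
  by (intro sum.cong refl) (simp add: binomial_fact field_simps)

lemma egf_deriv:
  fixes f :: "nat \<Rightarrow> 'a::field_char_0"
  shows "fps_deriv (Abs_fps (\<lambda>m. f m / fact m)) = Abs_fps (\<lambda>m. f (Suc m) / fact m)"
  by (rule fps_ext) (simp add: field_simps del: of_nat_Suc)

lemma no_single_sum_formula:
  fixes z :: "'a::field_char_0"
  assumes z: "z \<noteq> 0" and m: "1 \<le> m" "m \<le> K"
  shows "of_nat m * z * (no_single_sum z {1..m} / fact m)
    = (\<Sum>d\<le>K. of_nat ((m + d - 1) choose d) / z ^ d *
    (\<Sum>i\<le>d. of_nat (d choose i) * (- 1) ^ i * of_nat (m + d) / of_nat (m + 1 + d - i) *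
       \<theta> (of_nat (m + 1 + d - i) * z) $ (m + d)))"
proof -
  define s q t where "s i = series_sum z {1..i}" and "q i = no_single_sum z {1..i}"
    and "t i = all_sum z {1..i}"
    for i :: nat
  note eqs = net_sum_equations[of z, folded s_def q_def t_def]
  define S Q N where "S = Abs_fps (\<lambda>m. s m / fact m)" and "Q = Abs_fps (\<lambda>m. q m / fact m)"
    and "N = Abs_fps (\<lambda>m. t m / fact m)"
  have zero: "N $ 0 = 0" "S $ 0 = 0" "Q $ 0 = 0"
    by (simp_all add: N_def S_def Q_def s_def q_def t_def net_sum_empty)
  have D: "fps_deriv N - fps_deriv S = Abs_fps (\<lambda>m. (t (Suc m) - s (Suc m)) / fact m)"
    by (rule fps_ext) (simp add: N_def S_def egf_deriv diff_divide_distrib)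
  have eS: "fps_deriv S = (fps_deriv N - fps_deriv S) * N"
  proof (rule fps_ext)
    fix n
    have "((fps_deriv N - fps_deriv S) * N) $ n = s (Suc n) / fact n"
      unfolding D eqs(1)[of n] unfolding N_def by (rule egf_mult[of "\<lambda>i. t i - s i" t n])
    then show "fps_deriv S $ n = ((fps_deriv N - fps_deriv S) * N) $ n"
      by (simp only: S_def egf_deriv fps_nth_Abs_fps)
  qed
  have eQ: "fps_deriv Q = fps_deriv S + fps_const z * fps_deriv S * Q"
  proof (rule fps_ext)
    fix n
    have "(fps_const z * fps_deriv S * Q) $ n = z * (fps_deriv S * Q) $ n" by (simp add: mult.assoc)
    also have "\<dots> = z * ((\<Sum>i\<le>n. of_nat (n choose i) * (s (Suc i) * q (n - i))) / fact n)"
      by (simp only: S_def egf_deriv Q_def egf_mult)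
    also have "\<dots> = (\<Sum>i\<le>n. of_nat (n choose i) * (z * s (Suc i) * q (n - i))) / fact n"
      by (simp add: sum_distrib_left algebra_simps)
    finally show "fps_deriv Q $ n = (fps_deriv S + fps_const z * fps_deriv S * Q) $ n"
      using eqs(2)[of n] by (simp add: Q_def S_def egf_deriv add_divide_distrib)
  qed
  have eN: "N = fps_X + Q + fps_const z * fps_X * Q"
  proof (rule fps_ext)
    fix n
    show "N $ n = (fps_X + Q + fps_const z * fps_X * Q) $ n"
    proof (cases n)
      case 0
      then show ?thesis using zero by simp
    next
      case (Suc m)
      have "(fps_const z * fps_X * Q) $ n = z * (q m / fact m)" by (simp add: Suc mult.assoc Q_def)
      moreover have "N $ n = (q (Suc m) + of_nat (Suc m) * ((if m
        = 0 then 1 else 0) + z * q m)) / fact (Suc m)"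
        using eqs(3)[of m] Suc by (simp add: N_def)
      moreover have "of_nat (Suc m) * x / fact (Suc m) = x / fact m" for x :: 'a
        by (simp only: fact_Suc) (simp del: of_nat_Suc)
      ultimately have "N $ n = q (Suc m) / fact (Suc m) + ((if m
        = 0 then 1 else 0) + z * q m) / fact m"
        by (simp only: add_divide_distrib)
      then show ?thesis using Suc \<open>(fps_const z * fps_X * Q) $ n = z * (q m / fact m)\<close>
        by (simp add: Q_def add_divide_distrib del: fact_Suc)
    qed
  qed
  have "Q $ m = no_single_sum z {1..m} / fact m" by (simp add: Q_def q_def)
  with net_fps_coeff[OF z zero eS eQ eN m] show ?thesis by simp
qed

section \<open>Comparison of coefficients in \<open>z\<close>\<close>

lemma nullity_le: "net A F \<Longrightarrow> nullity F \<le> card A"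
proof -
  assume F: "net A F"
  have "finite A" using net_ground[OF F] by simp
  then have "card F \<le> card (Pow A)" using cosetD(1)[OF net_coset[OF F]] by (intro card_mono) auto
  then have "(2::nat) ^ nullity F \<le> 2 ^ card A" using \<open>finite A\<close>
    by (simp add: card_net[OF F] card_Pow)
  then show ?thesis by (subst (asm) power_increasing_iff) simp_all
qed

lemma no_single_sum_poly:
  "no_single_sum z {1..m::nat} =
    (\<Sum>e\<le>m. of_nat (card {F. net {1..m} F \<and> simple_net F \<and> no_single F \<and> nullity F = e}) * z ^ e)"
proof -
  let ?S = "{F. net {1..m} F \<and> simple_net F \<and> no_single F}"
  have "no_single_sum z {1..m} = (\<Sum>F\<in>?S. z ^ nullity F)" by (simp add: net_sum_def)
  also have "\<dots> = (\<Sum>e\<le>m. \<Sum>F\<in>{F \<in> ?S. nullity F = e}. z ^ nullity F)"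
  proof (rule sum.group[symmetric])
    show "finite ?S" by (rule finite_nets)
    show "nullity ` ?S \<subseteq> {..m}" using nullity_le by fastforce
  qed simp
  also have "\<dots> = (\<Sum>e\<le>m. of_nat (card {F. net {1..m} F \<and> simple_net F \<and> no_single F \<and> nullity F
    = e}) * z ^ e)"
    by (intro sum.cong refl) (simp add: conj_assoc)
  finally show ?thesis .
qed

lemma poly_eq_nonzero:
  fixes p q :: "'a::field_char_0 poly"
  assumes "\<And>z. z \<noteq> 0 \<Longrightarrow> poly p z = poly q z"
  shows "p = q"
proof (rule ccontr)
  assume "p \<noteq> q"
  then have "finite {z. poly (p - q) z = 0}" by (intro poly_roots_finite) simp
  moreover have "- {0} \<subseteq> {z. poly (p - q) z = 0}" using assms by auto
  ultimately have "finite (- {0 :: 'a})" by (rule finite_subset[rotated])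
  then have "finite (UNIV :: 'a set)" by (simp add: finite_compl infinite_UNIV_char_0)
  then show False by (simp add: infinite_UNIV_char_0)
qed

text \<open>Contribution of \<open>d\<close> and \<open>b\<close> to the coefficient at exponent
  \<open>b - d - 1\<close> of \<open>z\<close> in the network sum. The quotient
  \<open>j ^ b / j\<close> with \<open>j = m + 1 + d - i\<close> is \<open>j ^ (b - 1)\<close> in a
  form that stays correct for \<open>b = 0\<close>.\<close>

definition term_coeff :: "nat \<Rightarrow> nat \<Rightarrow> nat \<Rightarrow> rat" where
  "term_coeff m d b = of_nat (assoc_stirling1 (m + d) b) *
    (\<Sum>i\<le>d. (- 1) ^ (i + m + d) * of_nat (m + 1 + d - i) ^ b / of_nat (m + 1 + d - i) / (fact i * fact (d - i)))"

text \<open>The factor \<open>z ^ Suc K\<close> clears the powers \<open>1 / z ^ d\<close> and the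
  extra \<open>z\<close> of \<open>no_single_sum_formula\<close>, so that both sides are polynomial
  in \<open>z\<close>. The Stirling numbers enter through \<open>assoc_stirling1_theta\<close> at
  the argument \<open>j * z\<close>.\<close>

lemma no_single_sum_term_coeff:
  fixes z :: rat
  assumes z: "z \<noteq> 0" and m: "1 \<le> m" "m \<le> K"
  shows "z ^ Suc K * no_single_sum z {1..m} = (\<Sum>d\<le>K. \<Sum>b\<le>m + K. term_coeff m d b * z ^ (K - d + b))"
proof -
  have "z ^ Suc K * no_single_sum z {1..m} =
     fact (m - 1) * z ^ K * (of_nat m * z * (no_single_sum z {1..m} / fact m))"
    using m by (cases m) simp_all
  also have "\<dots> = (\<Sum>d\<le>K. fact (m - 1) * z ^ K * (of_nat ((m + d - 1) choose d) / z ^ d *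
    (\<Sum>i\<le>d. of_nat (d choose i) * (- 1) ^ i * of_nat (m + d) / of_nat (m + 1 + d - i) *
       \<theta> (of_nat (m + 1 + d - i) * z) $ (m + d))))"
    by (simp only: no_single_sum_formula[OF z m] sum_distrib_left)
  also have "\<dots> = (\<Sum>d\<le>K. \<Sum>b\<le>m + K. term_coeff m d b * z ^ (K - d + b))"
  proof (rule sum.cong[OF refl])
    fix d assume "d \<in> {..K}"
    then have d: "d \<le> K" by simp
    have zK: "z ^ K / z ^ d = z ^ (K - d)" using z d by (simp add: power_diff)
    have inner: "fact (m - 1) * of_nat ((m + d - 1) choose d) * (of_nat (d choose i) * (- 1) ^ i
      * of_nat (m + d) /
        of_nat (m + 1 + d - i) * \<theta> (of_nat (m + 1 + d - i) * z) $ (m + d)) =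
        (\<Sum>b\<le>m + K. of_nat (assoc_stirling1 (m + d) b) * ((- 1) ^ (i + m + d) *
          of_nat (m + 1 + d - i) ^ b / of_nat (m + 1 + d - i) / (fact i * fact (d - i))) * z ^ b)"
      if "i \<le> d" for i
    proof -
      define j :: rat where "j = of_nat (m + 1 + d - i)"
      have "(\<Sum>b\<le>m + K. of_nat (assoc_stirling1 (m + d) b) * (j * z) ^ b) =
          (- 1) ^ (m + d) * fact (m + d) * \<theta> (j * z) $ (m + d)"
        using d by (intro assoc_stirling1_theta) simp
      then have th: "\<theta> (j * z) $ (m + d) =
          (- 1) ^ (m + d) * (\<Sum>b\<le>m + K. of_nat (assoc_stirling1 (m + d) b) * (j * z) ^ b) / fact (m + d)"
        by (simp flip: mult.assoc power_add)
      have 1: "of_nat ((m + d - 1) choose d) = (fact (m + d - 1) / (fact d * fact (m - 1)) :: rat)"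
        using m(1) binomial_fact[of d "m + d - 1", where 'a = rat] by simp
      have 2: "of_nat (d choose i) = (fact d / (fact i * fact (d - i)) :: rat)"
        by (rule binomial_fact[OF that])
      have 3: "(fact (m + d) :: rat) = of_nat (m + d) * fact (m + d - 1)"
        using m(1) by (intro fact_reduce) simp
      have 4: "of_nat (m + d) \<noteq> (0 :: rat)" using m(1) by simp
      have "fact (m - 1) * of_nat ((m + d - 1) choose d) * (of_nat (d choose i) * (- 1) ^ i
        * of_nat (m + d) /
        j * \<theta> (j * z) $ (m + d)) =
        (- 1) ^ i * (- 1) ^ (m + d) * (\<Sum>b\<le>m + K. of_nat (assoc_stirling1 (m + d) b) * (j * z) ^ b) /
          j / (fact i * fact (d - i))"
        unfolding th 1 2 3 using 4 by (simp add: divide_simps)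
      also have "\<dots> = (\<Sum>b\<le>m + K. of_nat (assoc_stirling1 (m + d) b) * ((- 1) ^ (i + m + d) *
          j ^ b / j / (fact i * fact (d - i))) * z ^ b)"
        by (simp add: sum_distrib_left sum_divide_distrib power_add power_mult_distrib mult_ac)
      finally show ?thesis unfolding j_def .
    qed
    have "fact (m - 1) * z ^ K * (of_nat ((m + d - 1) choose d) / z ^ d *
      (\<Sum>i\<le>d. of_nat (d choose i) * (- 1) ^ i * of_nat (m + d) / of_nat (m + 1 + d - i) *
         \<theta> (of_nat (m + 1 + d - i) * z) $ (m + d))) =
      z ^ (K - d) * (\<Sum>i\<le>d. fact (m - 1) * of_nat ((m + d - 1) choose d) * (of_nat (d choose i) * (- 1) ^ i *
        of_nat (m + d) / of_nat (m + 1 + d - i) * \<theta> (of_nat (m + 1 + d - i) * z) $ (m + d)))"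
      unfolding zK[symmetric] sum_distrib_left[symmetric] by (simp add: mult_ac)
    also have "\<dots> = z ^ (K - d) * (\<Sum>i\<le>d. \<Sum>b\<le>m + K. of_nat (assoc_stirling1 (m + d) b) * ((- 1) ^
      (i + m + d) *
          of_nat (m + 1 + d - i) ^ b / of_nat (m + 1 + d - i) / (fact i * fact (d - i))) * z ^ b)"
      by (intro arg_cong[of _ _ "\<lambda>x. z ^ (K - d) * x"] sum.cong[OF refl] inner) simp
    also have "\<dots> = z ^ (K - d) * (\<Sum>b\<le>m + K. \<Sum>i\<le>d. of_nat (assoc_stirling1 (m + d) b) * ((- 1) ^
      (i + m + d) *
          of_nat (m + 1 + d - i) ^ b / of_nat (m + 1 + d - i) / (fact i * fact (d - i))) * z ^ b)"
      by (subst sum.swap) (rule refl)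
    also have "\<dots> = (\<Sum>b\<le>m + K. term_coeff m d b * z ^ (K - d + b))"
      unfolding term_coeff_def by (simp add: sum_distrib_left sum_distrib_right power_add mult_ac)
    finally show "fact (m - 1) * z ^ K * (of_nat ((m + d - 1) choose d) / z ^ d *
      (\<Sum>i\<le>d. of_nat (d choose i) * (- 1) ^ i * of_nat (m + d) / of_nat (m + 1 + d - i) *
         \<theta> (of_nat (m + 1 + d - i) * z) $ (m + d))) =
      (\<Sum>b\<le>m + K. term_coeff m d b * z ^ (K - d + b))" .
  qed
  finally show ?thesis .
qed

text \<open>Nullity \<open>m - k\<close> sits at the exponent \<open>Suc K + m - k\<close>, which
  \<open>K - d + b\<close> attains for \<open>b = d + 1 + m - k\<close>. For
  \<open>k = Suc m\<close> this exponent is \<open>K\<close>, below all exponents of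
  \<open>P\<close>, in agreement with the empty set of networks.\<close>

lemma card_nets_term_coeff:
  assumes m: "1 \<le> m" "m \<le> K" and k: "1 \<le> k" "k \<le> Suc m"
  shows "of_nat (card {F. net {1..m} F \<and> simple_net F \<and> no_single F \<and> k + nullity F = m}) =
    (\<Sum>d\<le>K. term_coeff m d (d + 1 + m - k))"
proof -
  define c where "c e = card {F. net {1..m} F \<and> simple_net F \<and> no_single F \<and> nullity F = e}" for e
  define P where "P = (\<Sum>e\<le>m. monom (of_nat (c e) :: rat) (Suc K + e))"
  define R where "R = (\<Sum>d\<le>K. \<Sum>b\<le>m + K. monom (term_coeff m d b) (K - d + b))"
  have "P = R"
  proof (rule poly_eq_nonzero)
    fix z :: rat assume z: "z \<noteq> 0"
    have "poly P z = z ^ Suc K * no_single_sum z {1..m}"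
      unfolding no_single_sum_poly P_def c_def
      by (simp add: poly_sum poly_monom power_add sum_distrib_left mult_ac)
    also have "\<dots> = poly R z"
      unfolding no_single_sum_term_coeff[OF z m] R_def by (simp add: poly_sum poly_monom)
    finally show "poly P z = poly R z" .
  qed
  then have "coeff P (Suc K + m - k) = coeff R (Suc K + m - k)" by simp
  moreover have "coeff P (Suc K + m - k) = of_nat (card {F. net {1..m} F \<and> simple_net F
    \<and> no_single F \<and> k + nullity F = m})"
  proof -
    have "coeff P (Suc K + m - k) = (\<Sum>e\<le>m. if Suc K + e = Suc K + m - k then of_nat (c e) else 0)"
      by (simp add: P_def coeff_sum)
    also have "\<dots> = (\<Sum>e\<le>m. if e + k = m then of_nat (c e) else 0)"
      by (intro sum.cong refl) (use k m in auto)
    also have "\<dots> = of_nat (card {F. net {1..m} F \<and> simple_net F \<and> no_single F \<and> k + nullity F = m})"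
    proof (cases "k \<le> m")
      case True
      then have "(\<Sum>e\<le>m. if e + k = m then of_nat (c e) else 0 :: rat) = (\<Sum>e\<le>m. if e
        = m - k then of_nat (c e) else 0)"
        by (intro sum.cong refl) auto
      also have "\<dots> = of_nat (c (m - k))" by simp
      also have "c (m - k) = card {F. net {1..m} F \<and> simple_net F \<and> no_single F \<and> k + nullity F
        = m}"
      proof -
        have "nullity F = m - k \<longleftrightarrow> k + nullity F = m" for F :: "nat set set" using True by auto
        then show ?thesis by (simp add: c_def)
      qed
      finally show ?thesis .
    next
      case False
      then have 1: "(\<Sum>e\<le>m. if e + k = m then of_nat (c e) else 0 :: rat) = 0"
        by (intro sum.neutral) auto
      have 2: "{F. net {1..m} F \<and> simple_net F \<and> no_single F \<and> k + nullity F = m} = {}"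
        using False by auto
      show ?thesis unfolding 1 2 by simp
    qed
    finally show ?thesis .
  qed
  moreover have "coeff R (Suc K + m - k) = (\<Sum>d\<le>K. term_coeff m d (d + 1 + m - k))"
  proof -
    have "coeff R (Suc K + m - k) = (\<Sum>d\<le>K. \<Sum>b\<le>m + K. if K - d + b
      = Suc K + m - k then term_coeff m d b else 0)"
      by (simp add: R_def coeff_sum)
    also have "\<dots> = (\<Sum>d\<le>K. term_coeff m d (d + 1 + m - k))"
    proof (rule sum.cong[OF refl])
      fix d assume d: "d \<in> {..K}"
      have "(\<Sum>b\<le>m + K. if K - d + b = Suc K + m - k then term_coeff m d b else 0) =
          (\<Sum>b\<le>m + K. if b = d + 1 + m - k then term_coeff m d b else 0)"
        by (intro sum.cong refl if_cong) (use d k in auto)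
      also have "\<dots> = term_coeff m d (d + 1 + m - k)" using d k by simp
      finally show "(\<Sum>b\<le>m + K. if K - d + b = Suc K + m - k then term_coeff m d b else 0) =
          term_coeff m d (d + 1 + m - k)" .
    qed
    finally show ?thesis .
  qed
  ultimately show ?thesis by simp
qed

text \<open>Put \<open>m + 1 = 2 * k - r\<close> and \<open>d = r - p\<close>. Then
  \<open>m + d = 2 * k - p - 1\<close> and \<open>d + 1 + m - k = k - p\<close>, which turns
  \<open>card_nets_term_coeff\<close> into the stated sum.\<close>

theorem theorem1p6:
  fixes r k :: nat
  assumes "r \<le> k"
  shows "(of_nat (num_simple_sp_matroids (2 * k - r) k) :: rat) =
    (\<Sum>p = 1..r. of_nat (assoc_stirling1 (2 * k - p - 1) (k - p)) *
      (\<Sum>i = 0..r - p.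
        ((- 1) ^ (i + p + 1) * (of_nat (2 * k - p - i) :: rat) powi (int k - int p - 1))
          / (fact i * fact (r - p - i))))"
proof -
  \<comment> \<open>Splitting off a root requires two elements. Fewer occur only for
    \<open>k = 0\<close>, with empty ground, and for \<open>k = r = 1\<close>, with one
    element.\<close>
  consider "k = 0" | "k = 1" "r = 1" | "2 \<le> 2 * k - r" using assms by linarith
  then show ?thesis
  proof cases
    case 1
    then show ?thesis using assms num_simple_sp_matroids_0 by simp
  next
    case 2
    have "derangements_on ({} :: nat set) = {id}" by (auto simp: derangements_on_def)
    then have "assoc_stirling1 0 0 = 1"
      using cycle_sum_assoc_stirling1[of 0 0 "1::int"] by (simp add: cycle_sum_def)
    then show ?thesis using 2 num_simple_sp_matroids_1 by simp
  next
    case 3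
    define m where "m = 2 * k - r - 1"
    have m: "1 \<le> m" "m \<le> m + r" "2 * k - r = Suc m" "2 * k = Suc m + r" and k: "1 \<le> k" "k \<le> Suc m"
      using 3 assms by (simp_all add: m_def)
    let ?t = "\<lambda>d. term_coeff m d (d + 1 + m - k)"
    have "of_nat (num_simple_sp_matroids (2 * k - r) k) = (\<Sum>d\<le>m + r. ?t d)"
      unfolding num_simple_sp_matroids_eq[OF m(3,1)] by (rule card_nets_term_coeff[OF m(1,2) k])
    \<comment> \<open>For \<open>d \<ge> r\<close> a derangement of \<open>m + d\<close> points
      would need \<open>d + 1 + m - k\<close> cycles, more than half the number of its
      points.\<close>
    also have "\<dots> = (\<Sum>d<r. ?t d)"
    proof (rule sum.mono_neutral_right)
      show "\<forall>d\<in>{..m + r} - {..<r}. ?t d = 0"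
      proof
        fix d assume "d \<in> {..m + r} - {..<r}"
        then have "m + d < 2 * (d + 1 + m - k)" using m(4) k by auto
        then show "?t d = 0" by (simp add: term_coeff_def assoc_stirling1_eq_0)
      qed
    qed auto
    also have "\<dots> = (\<Sum>p = 1..r. ?t (r - p))"
      by (rule sum.reindex_bij_witness[of _ "\<lambda>p. r - p" "\<lambda>d. r - d"]) auto
    also have "\<dots> = (\<Sum>p = 1..r. of_nat (assoc_stirling1 (2 * k - p - 1) (k - p)) *
      (\<Sum>i = 0..r - p.
        ((- 1) ^ (i + p + 1) * (of_nat (2 * k - p - i) :: rat) powi (int k - int p - 1))
          / (fact i * fact (r - p - i))))"
    proof (rule sum.cong[OF refl])
      fix p assume "p \<in> {1..r}"
      then have p: "1 \<le> p" "p \<le> r" by simp_all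
      have a: "m + (r - p) = 2 * k - p - 1" using p m(4) by linarith
      have b: "r - p + 1 + m - k = k - p" using p m(4) assms by linarith
      have "(\<Sum>i\<le>r - p. (- 1) ^ (i + m + (r - p)) * of_nat (m + 1 + (r - p) - i) ^ (k - p) /
          of_nat (m + 1 + (r - p) - i) / (fact i * fact (r - p - i))) =
        (\<Sum>i = 0..r - p. ((- 1) ^ (i + p + 1) * (of_nat (2 * k - p - i) :: rat) powi (int k - int p - 1))
          / (fact i * fact (r - p - i)))"
        unfolding atLeast0AtMost
      proof (rule sum.cong[OF refl])
        fix i assume "i \<in> {..r - p}"
        then have i: "i \<le> r - p" by simp
        have j: "m + 1 + (r - p) - i = 2 * k - p - i" using p m(4) by linarith
        have j0: "of_nat (2 * k - p - i) \<noteq> (0 :: rat)" using i p m(4) by simp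
        have e: "int k - int p - 1 = int (k - p) - 1" using p assms by simp
        have "(of_nat (2 * k - p - i) :: rat) powi (int k - int p - 1) =
            of_nat (2 * k - p - i) ^ (k - p) / of_nat (2 * k - p - i)"
          unfolding e using j0 by (simp add: power_int_diff)
        moreover have "(- 1) ^ (i + m + (r - p)) = ((- 1) ^ (i + p + 1) :: rat)"
        proof -
          \<comment> \<open>The two exponents of \<open>- 1\<close> have equal parity; even amounts
            are added to both so that no subtraction occurs.\<close>
          have "i + m + (r - p) + 2 * p = i + p + 1 + 2 * (k - 1)" using p m(4) k by linarith
          then have "(- 1 :: rat) ^ (i + m + (r - p) + 2 * p) = (- 1) ^ (i + p + 1 + 2 * (k - 1))"
            by (simp only:)
          then show ?thesis by (simp only: power_add power_mult) simp
        qed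
        ultimately show "(- 1) ^ (i + m + (r - p)) * of_nat (m + 1 + (r - p) - i) ^ (k - p) /
            of_nat (m + 1 + (r - p) - i) / (fact i * fact (r - p - i)) =
          ((- 1) ^ (i + p + 1) * (of_nat (2 * k - p - i) :: rat) powi (int k - int p - 1)) / (fact i * fact (r - p - i))"
          unfolding j by simp
      qed
      then show "?t (r - p) = of_nat (assoc_stirling1 (2 * k - p - 1) (k - p)) *
        (\<Sum>i = 0..r - p. ((- 1) ^ (i + p + 1) * (of_nat (2 * k - p - i) :: rat) powi (int k - int p - 1))
          / (fact i * fact (r - p - i)))"
        unfolding term_coeff_def a b by simp
    qed
    finally show ?thesis .
  qed
qed

end
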